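(* Let $\kappa<1$, let $U\subset\mathbb C$ be an open set and let $\mathcal T^\delta$, $\delta\to0$, be a sequence of t-embeddings covering $U$ and satisfying $\mathrm{Lip}(\kappa,\delta)$ on $U$ for all sufficiently small $\delta$. Assume that the origami maps $\mathcal O^\delta$ of $\mathcal T^\delta$ converge as $\delta\to0$ to a function $\vartheta:U\to\mathbb C$, uniformly on compact subsets of $U$. Then, for each subsequential limit $f_{\mathfrak w}:U\to\mathbb C$ (in the topology of uniform convergence on compact subsets of $U$) of t-white-holomorphic functions $F^\delta_{\mathfrak w}$ on $\mathcal T^\delta\cap U$ that are uniformly bounded on compact subsets of $U$, the differential form $f_{\mathfrak w}(z)\,dz+\overline{f_{\mathfrak w}(z)}\,d\overline{\vartheta(z)}$ is closed. Similarly, for each subsequential limit $f_{\mathfrak b}:U\to\mathbb C$ of t-black-holomorphic functions $F^\delta_{\mathfrak b}$ that are uniformly bounded on compact subsets of $U$, the differential form $f_{\mathfrak b}(z)\,dz+\overline{f_{\mathfrak b}(z)}\,d\vartheta(z)$ is closed. In particular, if $\vartheta\equiv0$, then all such subsequential limits are holomorphic in $U$.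
   Context: **t-embeddings.** A t-embedding $\mathcal T$ of the whole plane is a locally finite planar graph drawn in $\mathbb C$ with non-degenerate straight edges, whose faces are convex polygons that do not overlap, cover $\mathbb C$, and are coloured black/white so that faces sharing an edge have different colours ($B$, $W$ are the sets of black and white faces), and such that at each vertex the angles of adjacent black faces sum up to $\pi$, and so do those of adjacent white faces. A finite t-embedding: take a finite bipartite planar graph on the sphere, replace a marked vertex $v_{\rm out}$ of its dual by a cycle of length $\deg v_{\rm out}$ (each edge formerly at $v_{\rm out}$ is attached to its own vertex of the cycle), and draw the resulting graph with the same requirements, the cycle bounding the outer uncoloured face; the angle condition is required only at vertices not adjacent to the outer face. For $b\sim w$ (black and white faces sharing an edge) $bw^*$ is this edge oriented so that $b$ is on its right, and $d\mathcal T(bw^* )\in\mathbb C$ is the corresponding vector. **Origami map.** Fix $\eta:B\cup W\to\{|z|=1\}$ (up to the sign at each face) with $\overline\eta_b\overline\eta_w=d\mathcal T(bw^* )/|d\mathcal T(bw^* )|$ for $b\sim w$. $\mathcal O$ is a primitive of the closed form equal to $\eta_w^2dz$ on white faces and to $\overline\eta_b^2d\bar z$ on black faces. **Lip$(\kappa,\delta)$ on $U$:** $|\mathcal O(z')-\mathcal O(z)|\le\kappa|z'-z|$ for all $z,z'\in U$ with $|z-z'|\ge\delta$. $\Pr(F,\eta\mathbb R):=\frac12(F+\eta^2\overline F)$. **t-holomorphic functions.** A function $F^\bullet_{\mathfrak w}$ on black faces of a region is t-white-holomorphic if $F^\bullet_{\mathfrak w}(b)\in\eta_b\mathbb R$ for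 all $b$ and $\sum_{b\sim w}F^\bullet_{\mathfrak w}(b)\,d\mathcal T(bw^* )=0$ for each inner white face $w$ of the region. Fix a white splitting: cut white faces of degree $\ge4$ into triangles by diagonals, regard each diagonal as a two-sided black face, and extend $\eta$ (pieces of $w$ inherit $\eta_w$, diagonals get values by the same defining rule). Then $F^\bullet_{\mathfrak w}$ extends uniquely to diagonals together with complex values $F^\circ_{\mathfrak w}(w)$ on white triangles so that $F^\bullet_{\mathfrak w}(b)=\Pr(F^\circ_{\mathfrak w}(w),\eta_b\mathbb R)$ for all $b\sim w$ in the splitting. Boundedness and convergence of $F_{\mathfrak w}$ refer to the values $F^\circ_{\mathfrak w}$ (as functions on white triangles in $\mathbb C$). t-black-holomorphic functions $F_{\mathfrak b}$ are defined by exchanging the colours: $F^\circ_{\mathfrak b}(w)\in\eta_w\mathbb R$, $\sum_{w\sim b}F^\circ_{\mathfrak b}(w)\,d\mathcal T(bw^* )=0$, and boundedness and convergence refer to the complex values $F^\bullet_{\mathfrak b}$ on black triangles. **Closedness.** $\vartheta$ is a Lipschitz function; integrals against $d\vartheta$, $d\overline\vartheta$ along smooth curves are understood in the Riemann–Stieltjes sense, and a form is closed if its integral over each smooth loop contractible in $U$ vanishes.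
   Formalization: Subsequential limits are taken among continuous functions on U: convergence of values on triangles of one colour leaves a limit arbitrary at points those triangles always miss, so without continuity the claim (e.g. holomorphicity when ϑ≡0) fails. *)

theory Defs
  imports "HOL-Analysis.Analysis"
begin

section \<open>Coloured planar graphs with straight edges\<close>

text \<open>
  An edge is the set of its two endpoints, drawn as its convex hull; the vertices are the points
  of \<open>\<Union>E\<close>. A face is an open set, namely a connected component of the complement of the
  drawing, so that faces never overlap and their closures cover the plane. (No isolated vertices
  are lost in this encoding: they would make the surrounding face non-convex.)
\<close>

record tgraph =
  edges :: "complex set set"
  black :: "complex set set"
  white :: "complex set set"

definition drawing :: "complex set set \<Rightarrow> bool" where
  "drawing E \<longleftrightarrow>
     (\<forall>e\<in>E. card e = 2) \<and>
     (\<forall>e\<in>E. \<forall>e'\<in>E. e \<noteq> e' \<longrightarrow> convex hull e \<inter> convex hull e' = e \<inter> e') \<and>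
     (\<forall>K. bounded K \<longrightarrow> finite {e \<in> E. convex hull e \<inter> K \<noteq> {}})"

definition faces :: "complex set set \<Rightarrow> complex set set" where
  "faces E = components (- (\<Union>e\<in>E. convex hull e))"

definition convex_polygon :: "complex set \<Rightarrow> bool" where
  "convex_polygon f \<longleftrightarrow> convex f \<and> polytope (closure f)"

text \<open>
  The angle of a convex face \<open>f\<close> at its vertex \<open>v\<close>, between the two edges of \<open>f\<close> issuing from \<open>v\<close>.
\<close>

definition face_angle :: "complex set set \<Rightarrow> complex set \<Rightarrow> complex \<Rightarrow> real" where
  "face_angle E f v =
     (THE \<alpha>. \<exists>u u'. u \<noteq> u' \<and> {v, u} \<in> E \<and> {v, u'} \<in> E \<and>
        convex hull {v, u} \<subseteq> closure f \<and> convex hull {v, u'} \<subseteq> closure f \<and>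
        \<alpha> = \<bar>Arg ((u - v) / (u' - v))\<bar>)"

definition angle_condition :: "tgraph \<Rightarrow> complex \<Rightarrow> bool" where
  "angle_condition G v \<longleftrightarrow>
     (\<Sum>f | f \<in> black G \<and> v \<in> closure f. face_angle (edges G) f v) = pi \<and>
     (\<Sum>f | f \<in> white G \<and> v \<in> closure f. face_angle (edges G) f v) = pi"

definition properly_coloured :: "tgraph \<Rightarrow> bool" where
  "properly_coloured G \<longleftrightarrow>
     black G \<inter> white G = {} \<and>
     (\<forall>f\<in>black G \<union> white G. \<forall>g\<in>black G \<union> white G. \<forall>e\<in>edges G.
        f \<noteq> g \<and> convex hull e \<subseteq> closure f \<inter> closure g \<longrightarrow> (f \<in> black G \<longleftrightarrow> g \<in> white G))"


section \<open>t-embeddings\<close>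

definition plane_t_embedding :: "tgraph \<Rightarrow> bool" where
  "plane_t_embedding G \<longleftrightarrow>
     drawing (edges G) \<and>
     faces (edges G) = black G \<union> white G \<and>
     (\<forall>f\<in>black G \<union> white G. convex_polygon f) \<and>
     properly_coloured G \<and>
     (\<forall>v\<in>\<Union>(edges G). angle_condition G v)"

text \<open>
  In a finite t-embedding the unbounded face \<open>out\<close> is bounded by a cycle \<open>c 0, \<dots>, c (n - 1)\<close>. The
  cycle replaces a vertex of the dual graph, each former edge of that vertex being attached to its
  own vertex of the cycle: besides its two cycle edges, every \<open>c i\<close> has exactly one other edge.
\<close>

definition finite_t_embedding :: "tgraph \<Rightarrow> bool" where
  "finite_t_embedding G \<longleftrightarrow>
     finite (edges G) \<and>
     drawing (edges G) \<and>
     (\<forall>f\<in>black G \<union> white G. convex_polygon f) \<and>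
     properly_coloured G \<and>
     (\<exists>out (n::nat) c.
        out \<in> faces (edges G) \<and> \<not> bounded out \<and>
        black G \<union> white G = faces (edges G) - {out} \<and>
        3 \<le> n \<and> inj_on c {..<n} \<and>
        (\<forall>i<n. {c i, c (Suc i mod n)} \<in> edges G) \<and>
        frontier out = (\<Union>i<n. convex hull {c i, c (Suc i mod n)}) \<and>
        (\<forall>i<n. card {e \<in> edges G. c i \<in> e} = 3) \<and>
        (\<forall>v \<in> \<Union>(edges G) - c ` {..<n}. angle_condition G v))"

definition t_embedding :: "tgraph \<Rightarrow> bool" where
  "t_embedding G \<longleftrightarrow> plane_t_embedding G \<or> finite_t_embedding G"

definition covers :: "tgraph \<Rightarrow> complex set \<Rightarrow> bool" where
  "covers G U \<longleftrightarrow> U \<subseteq> (\<Union>f\<in>black G \<union> white G. closure f)"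

text \<open>
  The oriented edges \<open>bw\<^sup>*\<close>: a quadruple \<open>(b, w, u, v)\<close> stands for the edge from \<open>u\<close> to \<open>v\<close> with the
  black face \<open>b\<close> on its right and the white face \<open>w\<close> on its left; \<open>v - u\<close> is its vector.
\<close>

definition bw_star :: "tgraph \<Rightarrow> (complex set \<times> complex set \<times> complex \<times> complex) set" where
  "bw_star G =
     {(b, w, u, v). b \<in> black G \<and> w \<in> white G \<and> {u, v} \<in> edges G \<and>
        convex hull {u, v} \<subseteq> closure b \<inter> closure w \<and>
        (\<forall>z\<in>b. Im ((z - u) / (v - u)) < 0) \<and> (\<forall>z\<in>w. Im ((z - u) / (v - u)) > 0)}"


section \<open>Origami square root and origami map\<close>

text \<open>
  The function \<open>\<eta>\<close> is defined only up to sign at each face, so its defining identity is one between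
  numbers up to sign: around a vertex of degree divisible by 4 the signs cannot be chosen
  consistently. Everything below depends only on \<open>\<eta>\<^sup>2\<close>.
\<close>

definition origami_sqrt :: "tgraph \<Rightarrow> (complex set \<Rightarrow> complex) \<Rightarrow> bool" where
  "origami_sqrt G \<eta> \<longleftrightarrow>
     (\<forall>f\<in>black G \<union> white G. norm (\<eta> f) = 1) \<and>
     (\<forall>(b, w, u, v)\<in>bw_star G. cnj (\<eta> b) * cnj (\<eta> w) \<in> {sgn (v - u), - sgn (v - u)})"

text \<open>
  A primitive of the piecewise constant form \<open>\<eta>\<^sub>w\<^sup>2 dz\<close> on white faces, \<open>cnj \<eta>\<^sub>b\<^sup>2 d(cnj z)\<close> on black
  ones. The increments are prescribed on closed faces, so the pieces fit together continuously.
\<close>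

definition origami_map :: "tgraph \<Rightarrow> (complex set \<Rightarrow> complex) \<Rightarrow> (complex \<Rightarrow> complex) \<Rightarrow> bool" where
  "origami_map G \<eta> Om \<longleftrightarrow>
     (\<forall>w\<in>white G. \<forall>z\<in>closure w. \<forall>z'\<in>closure w. Om z' - Om z = (\<eta> w)\<^sup>2 * (z' - z)) \<and>
     (\<forall>b\<in>black G. \<forall>z\<in>closure b. \<forall>z'\<in>closure b. Om z' - Om z = (cnj (\<eta> b))\<^sup>2 * cnj (z' - z))"

definition Lip :: "real \<Rightarrow> real \<Rightarrow> complex set \<Rightarrow> (complex \<Rightarrow> complex) \<Rightarrow> bool" where
  "Lip \<kappa> \<delta> U Om \<longleftrightarrow>
     (\<forall>z\<in>U. \<forall>z'\<in>U. norm (z - z') \<ge> \<delta> \<longrightarrow> norm (Om z' - Om z) \<le> \<kappa> * norm (z' - z))"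

definition Pr :: "complex \<Rightarrow> complex \<Rightarrow> complex" where
  "Pr F \<eta> = (F + \<eta>\<^sup>2 * cnj F) / 2"


section \<open>Splittings\<close>

text \<open>
  In what follows \<open>Q\<close> is the set of all faces of the colour to be split and \<open>P\<close> the set of faces of
  the other colour. A splitting is given by its set \<open>D\<close> of diagonals. A diagonal \<open>{u, v}\<close> plays the
  role of a two-sided face of the other colour; functions on faces take it as an additional
  argument (being a finite set, it is never a face itself).
\<close>

definition pieces :: "tgraph \<Rightarrow> complex set set \<Rightarrow> complex set set \<Rightarrow> complex set set" where
  "pieces G Q D = {t \<in> faces (edges G \<union> D). \<exists>f\<in>Q. t \<subseteq> f}"

definition splitting :: "tgraph \<Rightarrow> complex set set \<Rightarrow> complex set set \<Rightarrow> bool" where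
  "splitting G Q D \<longleftrightarrow>
     (\<forall>d\<in>D. \<exists>u v. d = {u, v} \<and> u \<noteq> v \<and> u \<in> \<Union>(edges G) \<and> v \<in> \<Union>(edges G) \<and>
        (\<exists>f\<in>Q. open_segment u v \<subseteq> f)) \<and>
     (\<forall>d\<in>D. \<forall>d'\<in>D. d \<noteq> d' \<longrightarrow> convex hull d \<inter> convex hull d' = d \<inter> d') \<and>
     (\<forall>t\<in>pieces G Q D. \<exists>x y z. closure t = convex hull {x, y, z} \<and>
        {x, y} \<in> edges G \<union> D \<and> {y, z} \<in> edges G \<union> D \<and> {x, z} \<in> edges G \<union> D)"

definition sqrt_on_diagonals ::
    "complex set set \<Rightarrow> complex set set \<Rightarrow> (complex set \<Rightarrow> complex) \<Rightarrow> bool" where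
  "sqrt_on_diagonals Q D \<eta> \<longleftrightarrow>
     (\<forall>f\<in>Q. \<forall>u v. {u, v} \<in> D \<and> open_segment u v \<subseteq> f \<longrightarrow>
        norm (\<eta> {u, v}) = 1 \<and> cnj (\<eta> {u, v}) * cnj (\<eta> f) \<in> {sgn (v - u), - sgn (v - u)})"


section \<open>t-holomorphic functions\<close>

text \<open>
  The region of \<open>G\<close> in \<open>U\<close> consists of the faces whose closure lies in \<open>U\<close>; a face of it is inner if
  across each of its edges there is another face of the region.
\<close>

definition inner_faces ::
    "tgraph \<Rightarrow> complex set \<Rightarrow> complex set set \<Rightarrow> complex set set \<Rightarrow> complex set set" where
  "inner_faces G U P Q =
     {q \<in> Q. closure q \<subseteq> U \<and>
        (\<forall>e\<in>edges G. convex hull e \<subseteq> closure q \<longrightarrow>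
           (\<exists>p\<in>P. closure p \<subseteq> U \<and> convex hull e \<subseteq> closure p))}"

definition t_white_holomorphic ::
    "tgraph \<Rightarrow> complex set \<Rightarrow> (complex set \<Rightarrow> complex) \<Rightarrow> (complex set \<Rightarrow> complex) \<Rightarrow> bool" where
  "t_white_holomorphic G U \<eta> F \<longleftrightarrow>
     (\<forall>b\<in>black G. closure b \<subseteq> U \<longrightarrow> (\<exists>r::real. F b = of_real r * \<eta> b)) \<and>
     (\<forall>w\<in>inner_faces G U (black G) (white G).
        (\<Sum>(b, u, v) | (b, w, u, v) \<in> bw_star G. F b * (v - u)) = 0)"

definition t_black_holomorphic ::
    "tgraph \<Rightarrow> complex set \<Rightarrow> (complex set \<Rightarrow> complex) \<Rightarrow> (complex set \<Rightarrow> complex) \<Rightarrow> bool" where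
  "t_black_holomorphic G U \<eta> F \<longleftrightarrow>
     (\<forall>w\<in>white G. closure w \<subseteq> U \<longrightarrow> (\<exists>r::real. F w = of_real r * \<eta> w)) \<and>
     (\<forall>b\<in>inner_faces G U (white G) (black G).
        (\<Sum>(w, u, v) | (b, w, u, v) \<in> bw_star G. F w * (v - u)) = 0)"

definition triangles ::
    "tgraph \<Rightarrow> complex set \<Rightarrow> complex set set \<Rightarrow> complex set set \<Rightarrow> complex set set \<Rightarrow> complex set set"
  where
  "triangles G U P Q D = pieces G (inner_faces G U P Q) D"

text \<open>
  \<open>Fc\<close> is the system of complex values on the triangles that belongs to the values \<open>F\<close> on the faces
  in \<open>P\<close> and (by extension) on the diagonals.
\<close>

definition complex_values ::
    "tgraph \<Rightarrow> complex set \<Rightarrow> (complex set \<Rightarrow> complex) \<Rightarrow> complex set set \<Rightarrow> complex set set \<Rightarrow>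
     complex set set \<Rightarrow> (complex set \<Rightarrow> complex) \<Rightarrow> (complex set \<Rightarrow> complex) \<Rightarrow> bool" where
  "complex_values G U \<eta> P Q D F Fc \<longleftrightarrow>
     (\<forall>t\<in>triangles G U P Q D.
        (\<forall>p\<in>P. (\<exists>e\<in>edges G. convex hull e \<subseteq> closure p \<inter> closure t) \<longrightarrow> F p = Pr (Fc t) (\<eta> p)) \<and>
        (\<forall>d\<in>D. convex hull d \<subseteq> closure t \<longrightarrow> F d = Pr (Fc t) (\<eta> d)))"


section \<open>Boundedness and convergence on compact sets\<close>

text \<open>
  Here \<open>Tri n\<close> is the \<open>n\<close>-th set of triangles and \<open>Fc n t\<close> the value on the triangle \<open>t \<in> Tri n\<close>.
  Since the triangles (of one colour) do not cover \<open>U\<close>, uniform closeness on them leaves a limit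
  unconstrained at the points which they miss; limits are therefore taken among the continuous
  functions on \<open>U\<close>.
\<close>

definition bounded_on_compacts ::
    "complex set \<Rightarrow> (nat \<Rightarrow> complex set set) \<Rightarrow> (nat \<Rightarrow> complex set \<Rightarrow> complex) \<Rightarrow> bool" where
  "bounded_on_compacts U Tri Fc \<longleftrightarrow>
     (\<forall>K. compact K \<and> K \<subseteq> U \<longrightarrow>
        (\<exists>C. \<forall>n. \<forall>t\<in>Tri n. closure t \<inter> K \<noteq> {} \<longrightarrow> norm (Fc n t) \<le> C))"

definition converges_on_compacts ::
    "complex set \<Rightarrow> (nat \<Rightarrow> complex set set) \<Rightarrow> (nat \<Rightarrow> complex set \<Rightarrow> complex) \<Rightarrow>
     (complex \<Rightarrow> complex) \<Rightarrow> bool" where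
  "converges_on_compacts U Tri Fc f \<longleftrightarrow>
     continuous_on U f \<and>
     (\<forall>K. compact K \<and> K \<subseteq> U \<longrightarrow>
        (\<forall>\<epsilon>>0. \<forall>\<^sub>F n in sequentially. \<forall>t\<in>Tri n. \<forall>z\<in>closure t \<inter> K. norm (Fc n t - f z) < \<epsilon>))"

definition white_subsequential_limit ::
    "(nat \<Rightarrow> tgraph) \<Rightarrow> complex set \<Rightarrow> (nat \<Rightarrow> complex set \<Rightarrow> complex) \<Rightarrow>
     (nat \<Rightarrow> complex set set) \<Rightarrow> (complex \<Rightarrow> complex) \<Rightarrow> bool" where
  "white_subsequential_limit G U \<eta> D f \<longleftrightarrow>
     (\<exists>F Fc r. let Tri = (\<lambda>n. triangles (G n) U (black (G n)) (white (G n)) (D n)) in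
        (\<forall>n. t_white_holomorphic (G n) U (\<eta> n) (F n)) \<and>
        (\<forall>n. complex_values (G n) U (\<eta> n) (black (G n)) (white (G n)) (D n) (F n) (Fc n)) \<and>
        bounded_on_compacts U Tri Fc \<and>
        strict_mono r \<and> converges_on_compacts U (Tri \<circ> r) (Fc \<circ> r) f)"

definition black_subsequential_limit ::
    "(nat \<Rightarrow> tgraph) \<Rightarrow> complex set \<Rightarrow> (nat \<Rightarrow> complex set \<Rightarrow> complex) \<Rightarrow>
     (nat \<Rightarrow> complex set set) \<Rightarrow> (complex \<Rightarrow> complex) \<Rightarrow> bool" where
  "black_subsequential_limit G U \<eta> D f \<longleftrightarrow>
     (\<exists>F Fc r. let Tri = (\<lambda>n. triangles (G n) U (white (G n)) (black (G n)) (D n)) in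
        (\<forall>n. t_black_holomorphic (G n) U (\<eta> n) (F n)) \<and>
        (\<forall>n. complex_values (G n) U (\<eta> n) (white (G n)) (black (G n)) (D n) (F n) (Fc n)) \<and>
        bounded_on_compacts U Tri Fc \<and>
        strict_mono r \<and> converges_on_compacts U (Tri \<circ> r) (Fc \<circ> r) f)"


section \<open>Closed forms\<close>

text \<open>Riemann-Stieltjes integral of \<open>\<phi>\<close> against \<open>dg\<close> over \<open>[0, 1]\<close>, as the mesh tends to zero.\<close>

definition has_RS_integral ::
    "(real \<Rightarrow> complex) \<Rightarrow> (real \<Rightarrow> complex) \<Rightarrow> complex \<Rightarrow> bool" where
  "has_RS_integral \<phi> g I \<longleftrightarrow>
     (\<forall>\<epsilon>>0. \<exists>d>0. \<forall>p. p tagged_division_of {0..1} \<and> (\<forall>(x, k)\<in>p. diameter k < d) \<longrightarrow>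
        norm ((\<Sum>(x, k)\<in>p. \<phi> x * (g (Sup k) - g (Inf k))) - I) < \<epsilon>)"

text \<open>Closedness in \<open>U\<close> of the form \<open>f dz + cnj f dg\<close>.\<close>

definition closed_form :: "complex set \<Rightarrow> (complex \<Rightarrow> complex) \<Rightarrow> (complex \<Rightarrow> complex) \<Rightarrow> bool" where
  "closed_form U f g \<longleftrightarrow>
     (\<forall>\<gamma>. \<gamma> C1_differentiable_on {0..1} \<and> (\<exists>a. homotopic_loops U \<gamma> (linepath a a)) \<longrightarrow>
        (\<exists>I J. has_RS_integral (\<lambda>t. f (\<gamma> t)) \<gamma> I \<and>
               has_RS_integral (\<lambda>t. cnj (f (\<gamma> t))) (\<lambda>t. g (\<gamma> t)) J \<and>
               I + J = 0))"

end

theory Submission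
  imports Defs "HOL-Complex_Analysis.Cauchy_Integral_Formula"
begin

text \<open>
  Let \<open>g\<close> be the conjugate of the origami map in the white case and the origami map itself in the black
  case, and let \<open>a\<close> be the complex value on a triangle. At an edge of this triangle, \<open>dg\<close> equals
  \<open>\<eta>\<^sup>2 dz\<close>, where \<open>\<eta>\<close> belongs to the face or diagonal on the other side, so that
  \<open>a dz + cnj a dg = 2 * Pr a \<eta> dz\<close> on the edge. Now \<open>Pr a \<eta>\<close> is the real-direction value of the function
  at that face or diagonal, which all triangles adjacent to it have in common. Therefore the form
  \<open>a dz + cnj a dg\<close>, with \<open>a\<close> constant on each triangle and, on each face of the other colour, equal to the
  value on some adjacent triangle, has matching increments on common boundaries
  (\<open>increments_agree\<close>): it is closed. By \<open>Lip\<close> the faces have diameter less than \<open>\<delta>\<close> (\<open>face_small\<close>), so on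
  compact sets the coefficients \<open>a\<close> are uniformly close to \<open>f\<close>, and \<open>g\<close> converges to the limit of the
  origami maps or its conjugate. The integrals of \<open>f dz + cnj f d\<theta>\<close> over contractible loops are
  limits of integrals of closed forms, hence zero.

  The coefficients converge uniformly, but of \<open>dg\<close> nothing more is known than that the functions \<open>g\<close>
  converge and are isometric on each face. This is enough for Riemann--Stieltjes sums: over an interval on
  which \<open>f\<close> is almost constant along the curve, the increment of a primitive of the discrete form
  differs from \<open>f dz + cnj f dg\<close>, with \<open>f\<close> frozen at the tag, by a small multiple of the length
  (\<open>primitive_along_path_estimate\<close>), and for a fixed division the sums converge as \<open>g\<close> does
  (\<open>primitive_along_path_limit\<close>).

  The discrete forms are integrated by means of primitives pulled back along a map from a square, which
  exist by gluing local ones (\<open>primitive_along_unit_square\<close>). For a null-homotopy they show that the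
  increment around the loop vanishes (\<open>closed_form_limit\<close>); for the map of a square onto a triangle they
  give the hypothesis of Morera's theorem if the limit of the origami maps is zero (\<open>holomorphic_limit\<close>).

  What remains is plane geometry: faces are locally finite (\<open>faces_locally_finite\<close>), and two
  different convex faces whose closures share more than a point are the two sides of a common edge
  (\<open>touching_faces_share_edge\<close>).
\<close>

section \<open>Riemann--Stieltjes integrals against Lipschitz functions\<close>

lemma tagged_division_unit_intervalE:
  fixes p :: "(real \<times> real set) set"
  assumes "p tagged_division_of {0..1}" "(x, k) \<in> p"
  obtains u v where "k = {u..v}" "0 \<le> u" "u \<le> x" "x \<le> v" "v \<le> 1"
    "Sup k = v" "Inf k = u" "diameter k = v - u"
proof -
  obtain u v where k: "k = cbox u v"
    using tagged_division_ofD(4)[OF assms] by blast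
  have "x \<in> k" "k \<subseteq> {0..1}"
    using tagged_division_ofD(2,3)[OF assms] by auto
  with k have "u \<le> x" "x \<le> v" "0 \<le> u" "v \<le> 1" by auto
  moreover have "diameter k = v - u"
    using k \<open>u \<le> x\<close> \<open>x \<le> v\<close> diameter_cbox[of u v] by (simp add: dist_real_def)
  ultimately show ?thesis using that k by auto
qed

definition RS_sum :: "(real \<Rightarrow> complex) \<Rightarrow> (real \<Rightarrow> complex) \<Rightarrow> (real \<times> real set) set \<Rightarrow> complex" where
  "RS_sum \<phi> g p = (\<Sum>(x, k)\<in>p. \<phi> x * (g (Sup k) - g (Inf k)))"

definition tagged_mesh_less :: "real \<Rightarrow> (real \<times> real set) set \<Rightarrow> bool" where
  "tagged_mesh_less d p \<longleftrightarrow> p tagged_division_of {0..1} \<and> (\<forall>(x, k)\<in>p. diameter k < d)"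

lemma has_RS_integral_iff:
  "has_RS_integral \<phi> g I \<longleftrightarrow>
     (\<forall>\<epsilon>>0. \<exists>d>0. \<forall>p. tagged_mesh_less d p \<longrightarrow> norm (RS_sum \<phi> g p - I) < \<epsilon>)"
  by (simp add: has_RS_integral_def RS_sum_def tagged_mesh_less_def)

lemma tagged_mesh_less_mono:
  "tagged_mesh_less d p \<Longrightarrow> d \<le> d' \<Longrightarrow> tagged_mesh_less d' p"
  by (fastforce simp: tagged_mesh_less_def)

lemma tagged_sum_norm_le:
  fixes f :: "real \<times> real set \<Rightarrow> 'a::real_normed_vector"
  assumes p: "p tagged_division_of {0..1::real}"
    and le: "\<And>x k. (x, k) \<in> p \<Longrightarrow> norm (f (x, k)) \<le> c * (Sup k - Inf k)"
  shows "norm (\<Sum>xk\<in>p. f xk) \<le> c"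
proof -
  have "norm (\<Sum>xk\<in>p. f xk) \<le> (\<Sum>xk\<in>p. c * (Sup (snd xk) - Inf (snd xk)))"
    using le by (intro sum_norm_le) auto
  also have "\<dots> = c * (\<Sum>(x, k)\<in>p. Sup k - Inf k)"
    by (simp add: sum_distrib_left case_prod_unfold)
  also have "(\<Sum>(x, k)\<in>p. Sup k - Inf k) = 1"
    using additive_tagged_division_1[OF _ p, of "\<lambda>x. x"] by simp
  finally show ?thesis by simp
qed

lemma fine_imp_tagged_mesh_less:
  assumes "d > 0" "p tagged_division_of {0..1::real}" "(\<lambda>x. ball x (d / 3)) fine p"
  shows "tagged_mesh_less d p"
proof -
  have "diameter k < d" if "(x, k) \<in> p" for x k
  proof -
    obtain u v where k: "k = {u..v}" "u \<le> x" "x \<le> v" "diameter k = v - u"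
      using tagged_division_unit_intervalE[OF assms(2) \<open>(x, k) \<in> p\<close>] by metis
    have "k \<subseteq> ball x (d / 3)" using assms(3) that by (auto simp: fine_def)
    then have "dist x u < d / 3" "dist x v < d / 3" using k by (auto simp: subset_iff)
    then show ?thesis using k assms(1) by (auto simp: dist_real_def)
  qed
  then show ?thesis using assms(2) by (auto simp: tagged_mesh_less_def)
qed

lemma fine_tagged_division_exists:
  assumes "d > 0"
  obtains p where "tagged_mesh_less d p"
proof -
  have "gauge (\<lambda>x::real. ball x (d / 3))" using assms by auto
  then obtain p where "p tagged_division_of {0..1::real}" "(\<lambda>x. ball x (d / 3)) fine p"
    using fine_division_exists_real by blast
  then show ?thesis using that fine_imp_tagged_mesh_less[OF assms] by blast
qed

text \<open>
  Integration by parts produces the value of the integral: for a differentiable integrand it is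
  \<open>\<phi> 1 * g 1 - \<phi> 0 * g 0 - \<integral> g d\<phi>\<close>.
\<close>

lemma has_RS_integral_by_parts:
  fixes \<phi> g :: "real \<Rightarrow> complex"
  assumes g: "M-lipschitz_on {0..1} g"
    and d: "\<And>x. (\<phi> has_vector_derivative \<phi>' x) (at x)"
    and c: "continuous_on {0..1} \<phi>'"
  shows "\<exists>I. has_RS_integral \<phi> g I"
proof -
  have M: "M \<ge> 0" using g by (rule lipschitz_on_nonneg)
  have cg: "continuous_on {0..1} g" using g by (rule lipschitz_on_continuous_on)
  obtain B where B: "B > 0" "\<And>x. x \<in> {0..1} \<Longrightarrow> norm (\<phi>' x) \<le> B"
    using compact_imp_bounded[OF compact_continuous_image[OF c compact_Icc]]
    unfolding bounded_pos by auto
  have int: "(\<lambda>r. g r * \<phi>' r) integrable_on {u..v}" "\<phi>' integrable_on {u..v}"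
    if "0 \<le> u" "v \<le> 1" for u v
    using that by (auto intro!: integrable_continuous_real continuous_intros
        continuous_on_subset[OF cg] continuous_on_subset[OF c])
  have FTC: "(\<phi>' has_integral (\<phi> v - \<phi> u)) {u..v}" if "u \<le> v" for u v
    using that d by (intro fundamental_theorem_of_calculus) (auto intro: has_vector_derivative_at_within)
  define \<Psi> where "\<Psi> s = \<phi> s * g s - integral {0..s} (\<lambda>r. g r * \<phi>' r)" for s
  have \<Psi>: "\<Psi> v - \<Psi> u = \<phi> v * g v - \<phi> u * g u - integral {u..v} (\<lambda>r. g r * \<phi>' r)"
    if "0 \<le> u" "u \<le> v" "v \<le> 1" for u v
  proof -
    have "integral {0..v} (\<lambda>r. g r * \<phi>' r) = integral {0..u} (\<lambda>r. g r * \<phi>' r) + integral {u..v} (\<lambda>r. g r * \<phi>' r)"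
      using Henstock_Kurzweil_Integration.integral_combine[OF that(1,2) int(1)[OF order_refl that(3)]] by simp
    then show ?thesis by (simp add: \<Psi>_def)
  qed
  have lip\<phi>: "norm (\<phi> v - \<phi> u) \<le> B * (v - u)" if "0 \<le> u" "u \<le> v" "v \<le> 1" for u v
    using has_integral_bound_real[OF _ finite.emptyI FTC[OF that(2)], of B] B that by fastforce
  have key: "norm (\<phi> x * (g v - g u) - (\<Psi> v - \<Psi> u)) \<le> 3 * B * M * (v - u) * (v - u)"
    if "0 \<le> u" "u \<le> x" "x \<le> v" "v \<le> 1" for u x v
  proof -
    have uv: "u \<le> v" using that by simp
    define J where "J = integral {u..v} (\<lambda>r. (g r - g x) * \<phi>' r)"
    have Jeq: "J = integral {u..v} (\<lambda>r. g r * \<phi>' r) - g x * (\<phi> v - \<phi> u)"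
    proof -
      have "J = integral {u..v} (\<lambda>r. g r * \<phi>' r) - integral {u..v} (\<lambda>r. g x * \<phi>' r)"
        unfolding J_def left_diff_distrib
        using int[OF that(1,4)] by (intro Henstock_Kurzweil_Integration.integral_diff) (auto intro: integrable_on_mult_right)
      then show ?thesis using integral_unique[OF FTC[OF uv]] by simp
    qed
    have glip: "norm (g r - g x) \<le> M * (v - u)" if "u \<le> r" "r \<le> v" for r
    proof -
      have "norm (g r - g x) \<le> M * dist r x"
        using lipschitz_onD[OF g, of r x] that \<open>0 \<le> u\<close> \<open>v \<le> 1\<close> \<open>u \<le> x\<close> \<open>x \<le> v\<close>
        by (simp add: dist_norm)
      also have "\<dots> \<le> M * (v - u)"
        using that \<open>u \<le> x\<close> \<open>x \<le> v\<close> M by (intro mult_left_mono) (auto simp: dist_real_def)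
      finally show ?thesis .
    qed
    have "(\<lambda>r. (g r - g x) * \<phi>' r) integrable_on {u..v}"
      using that by (auto intro!: integrable_continuous_real continuous_intros
          continuous_on_subset[OF cg] continuous_on_subset[OF c])
    then have "((\<lambda>r. (g r - g x) * \<phi>' r) has_integral J) {u..v}"
      unfolding J_def by (rule integrable_integral)
    then have Jb: "norm J \<le> M * (v - u) * B * (v - u)"
    proof -
      assume hi: "((\<lambda>r. (g r - g x) * \<phi>' r) has_integral J) {u..v}"
      have "norm ((g r - g x) * \<phi>' r) \<le> M * (v - u) * B" if "r \<in> {u..v} - {}" for r
        unfolding norm_mult using glip[of r] B(2)[of r] that \<open>0 \<le> u\<close> \<open>v \<le> 1\<close> M uv
        by (intro mult_mono) auto
      from has_integral_bound_real[OF _ finite.emptyI hi this] show ?thesis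
        using uv M B(1) by simp
    qed
    have n: "norm (\<phi> v - \<phi> x) \<le> B * (v - u)" "norm (\<phi> u - \<phi> x) \<le> B * (v - u)"
    proof -
      have "norm (\<phi> v - \<phi> x) \<le> B * (v - x)" "norm (\<phi> x - \<phi> u) \<le> B * (x - u)"
        using lip\<phi>[of x v] lip\<phi>[of u x] that by auto
      moreover have "B * (v - x) \<le> B * (v - u)" "B * (x - u) \<le> B * (v - u)"
        using that B(1) by auto
      ultimately show "norm (\<phi> v - \<phi> x) \<le> B * (v - u)" "norm (\<phi> u - \<phi> x) \<le> B * (v - u)"
        by (auto simp: norm_minus_commute)
    qed
    \<comment> \<open>Subtracting the constant \<open>g x\<close> from \<open>g\<close> makes both factors of every term small.\<close>
    have "\<phi> x * (g v - g u) - (\<Psi> v - \<Psi> u)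
        = J + (\<phi> u - \<phi> x) * (g u - g x) - (\<phi> v - \<phi> x) * (g v - g x)"
      using \<Psi>[OF that(1) uv that(4)] by (simp add: Jeq algebra_simps)
    also have "norm \<dots> \<le> norm J + norm ((\<phi> u - \<phi> x) * (g u - g x)) + norm ((\<phi> v - \<phi> x) * (g v - g x))"
      by norm
    also have "\<dots> \<le> M * (v - u) * B * (v - u) + B * (v - u) * (M * (v - u)) + B * (v - u) * (M * (v - u))"
      unfolding norm_mult using Jb n glip[of u] glip[of v] uv M B(1)
      by (intro add_mono mult_mono) auto
    finally show ?thesis by (simp add: algebra_simps)
  qed
  have "has_RS_integral \<phi> g (\<Psi> 1 - \<Psi> 0)"
    unfolding has_RS_integral_iff
  proof (intro allI impI)
    fix \<epsilon> :: real assume \<epsilon>: "\<epsilon> > 0"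
    define d where "d = \<epsilon> / (3 * B * M + 1)"
    have pos: "3 * B * M + 1 > 0" using B M by (simp add: add_nonneg_pos)
    have d0: "d > 0" using \<epsilon> pos by (simp add: d_def)
    have dlt: "3 * B * M * d < \<epsilon>"
      using pos \<epsilon> by (simp add: d_def field_simps)
    show "\<exists>d>0. \<forall>p. tagged_mesh_less d p \<longrightarrow> norm (RS_sum \<phi> g p - (\<Psi> 1 - \<Psi> 0)) < \<epsilon>"
    proof (intro exI conjI allI impI)
      show "d > 0" by fact
      fix p :: "(real \<times> real set) set"
      assume p: "tagged_mesh_less d p"
      then have tp: "p tagged_division_of {0..1}" by (simp add: tagged_mesh_less_def)
      have "RS_sum \<phi> g p - (\<Psi> 1 - \<Psi> 0)
          = (\<Sum>xk\<in>p. (case xk of (x, k) \<Rightarrow> \<phi> x * (g (Sup k) - g (Inf k)) - (\<Psi> (Sup k) - \<Psi> (Inf k))))"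
        using additive_tagged_division_1[OF _ tp, of \<Psi>]
        by (simp add: RS_sum_def sum_subtractf case_prod_unfold)
      also have "norm \<dots> \<le> 3 * B * M * d"
      proof (rule tagged_sum_norm_le[OF tp])
        fix x k assume xk: "(x, k) \<in> p"
        obtain u v where k: "k = {u..v}" "0 \<le> u" "u \<le> x" "x \<le> v" "v \<le> 1"
          "Sup k = v" "Inf k = u" "diameter k = v - u"
          using tagged_division_unit_intervalE[OF tp xk] by metis
        have "v - u < d" using p xk k(8) by (auto simp: tagged_mesh_less_def)
        have "3 * B * M * (v - u) * (v - u) \<le> 3 * B * M * d * (v - u)"
          using \<open>v - u < d\<close> k(3,4) B M by (intro mult_right_mono mult_left_mono) auto
        then show "norm (case (x, k) of (x, k) \<Rightarrow> \<phi> x * (g (Sup k) - g (Inf k)) - (\<Psi> (Sup k) - \<Psi> (Inf k)))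
           \<le> 3 * B * M * d * (Sup k - Inf k)"
          using key[OF k(2-5)] k by simp
      qed
      also have "\<dots> < \<epsilon>" by fact
      finally show "norm (RS_sum \<phi> g p - (\<Psi> 1 - \<Psi> 0)) < \<epsilon>" .
    qed
  qed
  then show ?thesis by blast
qed

lemma RS_sum_diff_le:
  fixes \<phi> \<psi> g :: "real \<Rightarrow> complex"
  assumes g: "M-lipschitz_on {0..1} g" and p: "tagged_mesh_less d p"
    and le: "\<And>x. x \<in> {0..1} \<Longrightarrow> norm (\<phi> x - \<psi> x) \<le> e"
  shows "norm (RS_sum \<phi> g p - RS_sum \<psi> g p) \<le> e * M"
proof -
  have tp: "p tagged_division_of {0..1}" using p by (simp add: tagged_mesh_less_def)
  have "RS_sum \<phi> g p - RS_sum \<psi> g p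
    = (\<Sum>xk\<in>p. (case xk of (x, k) \<Rightarrow> (\<phi> x - \<psi> x) * (g (Sup k) - g (Inf k))))"
    by (simp add: RS_sum_def sum_subtractf[symmetric] case_prod_unfold left_diff_distrib)
  also have "norm \<dots> \<le> e * M"
  proof (rule tagged_sum_norm_le[OF tp])
    fix x k assume xk: "(x, k) \<in> p"
    obtain u v where k: "k = {u..v}" "0 \<le> u" "u \<le> x" "x \<le> v" "v \<le> 1"
      "Sup k = v" "Inf k = u" "diameter k = v - u"
      using tagged_division_unit_intervalE[OF tp xk] by metis
    have "norm (\<phi> x - \<psi> x) \<le> e" using le k by auto
    moreover have "norm (g v - g u) \<le> M * (v - u)"
      using lipschitz_onD[OF g, of v u] k by (simp add: dist_norm)
    moreover have "0 \<le> e" using calculation(1) norm_ge_zero order_trans by blast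
    ultimately show "norm (case (x, k) of (x, k) \<Rightarrow> (\<phi> x - \<psi> x) * (g (Sup k) - g (Inf k))) \<le> e * M * (Sup k - Inf k)"
      using k by (simp add: norm_mult mult_mono mult.assoc)
  qed
  finally show ?thesis .
qed

text \<open>
  A continuous integrand is a uniform limit of polynomials, and the Riemann--Stieltjes sums depend on
  the integrand in a Lipschitz way, with the same constant for all divisions.
\<close>

lemma has_RS_integral_exists:
  fixes \<phi> g :: "real \<Rightarrow> complex"
  assumes \<phi>: "continuous_on {0..1} \<phi>" and g: "M-lipschitz_on {0..1} g"
  shows "\<exists>I. has_RS_integral \<phi> g I"
proof -
  have M: "M \<ge> 0" using g by (rule lipschitz_on_nonneg)
  have ex: "\<exists>\<psi> I. (\<forall>x\<in>{0..1}. norm (\<phi> x - \<psi> x) \<le> e) \<and> has_RS_integral \<psi> g I" if e: "e > 0" for e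
  proof -
    obtain q where q: "polynomial_function q" "\<And>x. x \<in> {0..1} \<Longrightarrow> norm (\<phi> x - q x) < e"
      using Stone_Weierstrass_polynomial_function[OF compact_Icc \<phi> e] by auto
    obtain q' where q': "polynomial_function q'" "\<And>x. (q has_vector_derivative q' x) (at x)"
      using has_vector_derivative_polynomial_function[OF q(1)] by metis
    show ?thesis
      using has_RS_integral_by_parts[OF g q'(2) continuous_on_polymonial_function[OF q'(1)]] q(2)
      by (metis less_imp_le)
  qed
  have "\<forall>n. \<exists>\<psi> I. (\<forall>x\<in>{0..1}. norm (\<phi> x - \<psi> x) \<le> inverse (real (Suc n))) \<and> has_RS_integral \<psi> g I"
    using ex by simp
  then obtain \<psi> I where \<psi>: "\<And>n x. x \<in> {0..1} \<Longrightarrow> norm (\<phi> x - \<psi> n x) \<le> inverse (real (Suc n))"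
    and I: "\<And>n. has_RS_integral (\<psi> n) g (I n)" by metis
  define e where "e n = inverse (real (Suc n)) * M" for n
  have near: "\<exists>d>0. \<forall>p. tagged_mesh_less d p \<longrightarrow> norm (RS_sum \<phi> g p - I n) < e n + \<epsilon>" if \<epsilon>: "\<epsilon> > 0" for n \<epsilon>
  proof -
    obtain d where "d > 0" and d: "\<And>p. tagged_mesh_less d p \<Longrightarrow> norm (RS_sum (\<psi> n) g p - I n) < \<epsilon>"
      using I[of n] \<epsilon> unfolding has_RS_integral_iff by blast
    have "norm (RS_sum \<phi> g p - I n) < e n + \<epsilon>" if "tagged_mesh_less d p" for p
      using RS_sum_diff_le[OF g that, of \<phi> "\<psi> n", OF \<psi>] d[OF that]
        norm_triangle_ineq[of "RS_sum \<phi> g p - RS_sum (\<psi> n) g p" "RS_sum (\<psi> n) g p - I n"]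
      by (simp add: e_def)
    then show ?thesis using \<open>d > 0\<close> by blast
  qed
  have II: "norm (I m - I n) \<le> e m + e n" for m n
  proof (rule field_le_epsilon)
    fix \<epsilon> :: real assume "\<epsilon> > 0"
    then have e2: "\<epsilon> / 2 > 0" by simp
    obtain d where d: "d > 0" "\<And>p. tagged_mesh_less d p \<Longrightarrow> norm (RS_sum \<phi> g p - I m) < e m + \<epsilon> / 2"
      using near[OF e2, of m] by blast
    obtain d' where d': "d' > 0" "\<And>p. tagged_mesh_less d' p \<Longrightarrow> norm (RS_sum \<phi> g p - I n) < e n + \<epsilon> / 2"
      using near[OF e2, of n] by blast
    obtain p where p: "tagged_mesh_less (min d d') p"
      using fine_tagged_division_exists[of "min d d'"] d(1) d'(1) by auto
    have "norm (RS_sum \<phi> g p - I m) < e m + \<epsilon> / 2" "norm (RS_sum \<phi> g p - I n) < e n + \<epsilon> / 2"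
      using d(2) d'(2) tagged_mesh_less_mono[OF p] by auto
    then show "norm (I m - I n) \<le> e m + e n + \<epsilon>"
      using norm_triangle_ineq4[of "RS_sum \<phi> g p - I n" "RS_sum \<phi> g p - I m"] by simp
  qed
  have e0: "e \<longlonglongrightarrow> 0"
    using tendsto_mult_right[OF LIMSEQ_inverse_real_of_nat, of M] by (simp add: e_def[abs_def])
  have small: "\<exists>N. \<forall>n\<ge>N. e n < \<epsilon>" if "\<epsilon> > 0" for \<epsilon>
    using order_tendstoD(2)[OF e0 that] by (simp add: eventually_sequentially)
  have "Cauchy I"
    unfolding Cauchy_altdef2
  proof (intro allI impI)
    fix \<epsilon> :: real assume "\<epsilon> > 0"
    then obtain N where N: "\<forall>n\<ge>N. e n < \<epsilon> / 2" using small[of "\<epsilon> / 2"] by auto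
    have "dist (I n) (I N) < \<epsilon>" if "n \<ge> N" for n
    proof -
      have "e n < \<epsilon> / 2" "e N < \<epsilon> / 2" using N that by blast+
      then show ?thesis using II[of n N] by (simp add: dist_norm)
    qed
    then show "\<exists>N. \<forall>n\<ge>N. dist (I n) (I N) < \<epsilon>" by blast
  qed
  then obtain L where L: "I \<longlonglongrightarrow> L" using Cauchy_convergent convergent_def by blast
  have "has_RS_integral \<phi> g L"
    unfolding has_RS_integral_iff
  proof (intro allI impI)
    fix \<epsilon> :: real assume "\<epsilon> > 0"
    then have e3: "\<epsilon> / 3 > 0" by simp
    obtain N where N: "\<forall>n\<ge>N. e n < \<epsilon> / 3" using small[OF e3] by auto
    obtain N' where N': "\<forall>n\<ge>N'. norm (I n - L) < \<epsilon> / 3" using LIMSEQ_D[OF L e3] by auto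
    define n where "n = max N N'"
    have n: "e n < \<epsilon> / 3" "norm (I n - L) < \<epsilon> / 3" using N N' unfolding n_def by simp_all
    obtain d where "d > 0" and d: "\<And>p. tagged_mesh_less d p \<Longrightarrow> norm (RS_sum \<phi> g p - I n) < e n + \<epsilon> / 3"
      using near[OF e3, of n] by blast
    have "norm (RS_sum \<phi> g p - L) < \<epsilon>" if "tagged_mesh_less d p" for p
      using d[OF that] n norm_triangle_ineq[of "RS_sum \<phi> g p - I n" "I n - L"] by simp
    then show "\<exists>d>0. \<forall>p. tagged_mesh_less d p \<longrightarrow> norm (RS_sum \<phi> g p - L) < \<epsilon>"
      using \<open>d > 0\<close> by blast
  qed
  then show ?thesis by blast
qed

lemma linepath_lipschitz: "(norm (b - a))-lipschitz_on S (linepath a b)"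
proof (rule lipschitz_onI)
  show "dist (linepath a b x) (linepath a b y) \<le> norm (b - a) * dist x y" for x y
  proof -
    have "linepath a b x - linepath a b y = (x - y) *\<^sub>R (b - a)"
      by (simp add: linepath_def algebra_simps)
    then show ?thesis by (simp add: dist_norm)
  qed
qed simp

text \<open>
  A division that is fine for a gauge of small constant radius has small mesh, so the sums of the
  Henstock--Kurzweil integral which defines the contour integral converge to the same limit.
\<close>

lemma has_RS_integral_linepath:
  assumes f: "continuous_on (closed_segment a b) f"
  shows "has_RS_integral (\<lambda>t. f (linepath a b t)) (linepath a b) (contour_integral (linepath a b) f)"
proof -
  have "continuous_on {0..1} (\<lambda>t. f (linepath a b t))"
    by (rule continuous_on_compose2[OF f])
      (auto intro: continuous_on_linepath simp: linepath_in_path)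
  then obtain I where I: "has_RS_integral (\<lambda>t. f (linepath a b t)) (linepath a b) I"
    using has_RS_integral_exists[OF _ linepath_lipschitz] by blast
  have "((\<lambda>t. f (linepath a b t) * (b - a)) has_integral I) (cbox 0 1)"
    unfolding has_integral
  proof (intro allI impI)
    fix e :: real assume "e > 0"
    then obtain d where d: "d > 0" "\<And>p. tagged_mesh_less d p \<Longrightarrow>
        norm (RS_sum (\<lambda>t. f (linepath a b t)) (linepath a b) p - I) < e"
      using I unfolding has_RS_integral_iff by blast
    have "norm ((\<Sum>(x, k)\<in>p. measure lborel k *\<^sub>R (f (linepath a b x) * (b - a))) - I) < e"
      if p: "p tagged_division_of cbox 0 1" "(\<lambda>x. ball x (d / 3)) fine p" for p
    proof -
      have tp: "p tagged_division_of {0..1}" using p by simp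
      have "measure lborel k *\<^sub>R (f (linepath a b x) * (b - a))
          = f (linepath a b x) * (linepath a b (Sup k) - linepath a b (Inf k))" if xk: "(x, k) \<in> p" for x k
      proof -
        obtain u v where k: "k = {u..v}" "u \<le> x" "x \<le> v" "Sup k = v" "Inf k = u"
          using tagged_division_unit_intervalE[OF tp xk] by metis
        then show ?thesis
          by (simp add: linepath_def algebra_simps scaleR_conv_of_real)
      qed
      then have "(\<Sum>(x, k)\<in>p. measure lborel k *\<^sub>R (f (linepath a b x) * (b - a)))
          = RS_sum (\<lambda>t. f (linepath a b t)) (linepath a b) p"
        unfolding RS_sum_def by (intro sum.cong) auto
      then show ?thesis using d(2)[OF fine_imp_tagged_mesh_less[OF d(1) tp p(2)]] by simp
    qed
    then show "\<exists>\<gamma>. gauge \<gamma> \<and> (\<forall>\<D>. \<D> tagged_division_of cbox 0 1 \<and> \<gamma> fine \<D> \<longrightarrow>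
        norm ((\<Sum>(x, k)\<in>\<D>. measure lborel k *\<^sub>R (f (linepath a b x) * (b - a))) - I) < e)"
      using d(1) by (intro exI[of _ "\<lambda>x. ball x (d / 3)"]) auto
  qed
  then have "contour_integral (linepath a b) f = I"
    by (intro contour_integral_unique) (simp add: has_contour_integral_linepath)
  with I show ?thesis by simp
qed

section \<open>Primitives of piecewise constant forms\<close>

text \<open>
  The locale describes the form \<open>a dz + cnj a dg\<close>, where \<open>a\<close> is constant on each piece. On the closure
  of the piece \<open>t\<close> it has the potential \<open>a t * z + cnj (a t) * g z\<close>. The form is closed because two such
  potentials have equal increments between common points of the pieces; this replaces every
  argument about the combinatorics of the pieces around a vertex.
\<close>

locale piecewise_form =
  fixes K :: "complex set" and g :: "complex \<Rightarrow> complex"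
    and \<P> :: "complex set set" and a :: "complex set \<Rightarrow> complex"
  assumes locally_finite: "x \<in> K \<Longrightarrow> \<exists>r>0. finite {t \<in> \<P>. closure t \<inter> ball x r \<noteq> {}}"
    and covered: "K \<subseteq> (\<Union>t\<in>\<P>. closure t)"
    and isometric: "\<lbrakk>t \<in> \<P>; x \<in> closure t; y \<in> closure t\<rbrakk> \<Longrightarrow> norm (g y - g x) = norm (y - x)"
    and compatible: "\<lbrakk>s \<in> \<P>; t \<in> \<P>; x \<in> closure s \<inter> closure t; y \<in> closure s \<inter> closure t\<rbrakk> \<Longrightarrow>
      a s * (y - x) + cnj (a s) * (g y - g x) = a t * (y - x) + cnj (a t) * (g y - g x)"
begin

definition increment :: "complex set \<Rightarrow> complex \<Rightarrow> complex \<Rightarrow> complex" where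
  "increment t x y = a t * (y - x) + cnj (a t) * (g y - g x)"

lemma increment_refl [simp]: "increment t x x = 0"
  by (simp add: increment_def)

lemma increment_diff: "increment t x z - increment t x y = increment t y z"
  by (simp add: increment_def algebra_simps)

lemma increment_eq:
  assumes "s \<in> \<P>" "t \<in> \<P>" "x \<in> closure s" "x \<in> closure t" "y \<in> closure s" "y \<in> closure t"
  shows "increment s x y = increment t x y"
  using compatible[OF assms(1,2), of x y] assms(3-) by (simp add: increment_def)

lemma pieces_near_point_contain_it:
  assumes "x \<in> K"
  obtains r where "r > 0" "\<And>t y. t \<in> \<P> \<Longrightarrow> y \<in> closure t \<Longrightarrow> dist x y < r \<Longrightarrow> x \<in> closure t"
proof -
  obtain r where r: "r > 0" "finite {t \<in> \<P>. closure t \<inter> ball x r \<noteq> {}}" (is "finite ?F")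
    using locally_finite[OF assms] by blast
  let ?C = "\<Union>t\<in>{t \<in> ?F. x \<notin> closure t}. closure t"
  have "closed ?C" by (intro closed_UN finite_subset[OF _ r(2)]) auto
  then have op: "open (- ?C)" by (rule open_Compl)
  have "x \<in> - ?C" by auto
  then obtain e where e: "e > 0" "ball x e \<subseteq> - ?C" using openE[OF op] by blast
  show thesis
  proof (rule that[of "min r e"])
    show "x \<in> closure t" if "t \<in> \<P>" "y \<in> closure t" "dist x y < min r e" for t y
    proof (rule ccontr)
      assume "x \<notin> closure t"
      moreover have "t \<in> ?F" using that by auto
      ultimately have "y \<in> ?C" using that by blast
      moreover have "y \<in> ball x e" using that by simp
      ultimately show False using e(2) by blast
    qed
  qed (use r e in auto)
qed

text \<open>
  Pulled back to the domain of \<open>h\<close>, the form has a primitive even where it has none on \<open>K\<close>, as for a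
  curve around a hole. Therefore the increments are prescribed only between nearby points of \<open>X\<close>.
\<close>

definition primitive_along ::
    "('b::topological_space \<Rightarrow> complex) \<Rightarrow> 'b set \<Rightarrow> ('b \<Rightarrow> complex) \<Rightarrow> bool" where
  "primitive_along h X k \<longleftrightarrow>
     (\<forall>x\<in>X. \<forall>\<^sub>F y in at x within X. \<forall>t\<in>\<P>.
        h x \<in> closure t \<and> h y \<in> closure t \<longrightarrow> k y - k x = increment t (h x) (h y))"

lemma primitive_along_subset:
  assumes "primitive_along h X k" "Y \<subseteq> X"
  shows "primitive_along h Y k"
  using assms unfolding primitive_along_def
  by (meson at_le filter_leD subsetD)

lemma primitive_along_cong:
  assumes "primitive_along h X k" "\<And>x. x \<in> X \<Longrightarrow> h x = h' x" "\<And>x. x \<in> X \<Longrightarrow> k x = k' x"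
  shows "primitive_along h' X k'"
  unfolding primitive_along_def
proof
  fix x assume x: "x \<in> X"
  have "\<forall>\<^sub>F y in at x within X. y \<in> X"
    by (simp add: eventually_at_topological) auto
  moreover have "\<forall>\<^sub>F y in at x within X. \<forall>t\<in>\<P>.
        h x \<in> closure t \<and> h y \<in> closure t \<longrightarrow> k y - k x = increment t (h x) (h y)"
    using assms(1) x by (simp add: primitive_along_def)
  ultimately show "\<forall>\<^sub>F y in at x within X. \<forall>t\<in>\<P>.
        h' x \<in> closure t \<and> h' y \<in> closure t \<longrightarrow> k' y - k' x = increment t (h' x) (h' y)"
    by eventually_elim (use assms(2,3) x in auto)
qed

lemma primitive_along_add_const:
  "primitive_along h X k \<Longrightarrow> primitive_along h X (\<lambda>x. k x + c)"
  by (simp add: primitive_along_def)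

lemma primitive_along_compose:
  assumes k: "primitive_along h X k" and \<gamma>: "continuous_on Y \<gamma>" "\<gamma> ` Y \<subseteq> X"
  shows "primitive_along (h \<circ> \<gamma>) Y (k \<circ> \<gamma>)"
  unfolding primitive_along_def
proof
  fix x assume x: "x \<in> Y"
  then have "\<gamma> x \<in> X" using \<gamma> by auto
  then obtain S where S: "open S" "\<gamma> x \<in> S" "\<And>y. \<lbrakk>y \<in> S; y \<noteq> \<gamma> x; y \<in> X\<rbrakk> \<Longrightarrow> \<forall>t\<in>\<P>.
      h (\<gamma> x) \<in> closure t \<and> h y \<in> closure t \<longrightarrow> k y - k (\<gamma> x) = increment t (h (\<gamma> x)) (h y)"
    using k unfolding primitive_along_def eventually_at_topological by metis
  have "\<forall>\<^sub>F y in at x within Y. \<gamma> y \<in> S"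
    using topological_tendstoD[of \<gamma> "\<gamma> x" "at x within Y" S] \<gamma>(1) S(1,2) x by (simp add: continuous_on_def)
  moreover have "\<forall>\<^sub>F y in at x within Y. y \<in> Y"
    by (simp add: eventually_at_topological) auto
  ultimately show "\<forall>\<^sub>F y in at x within Y. \<forall>t\<in>\<P>. (h \<circ> \<gamma>) x \<in> closure t \<and> (h \<circ> \<gamma>) y \<in> closure t \<longrightarrow>
      (k \<circ> \<gamma>) y - (k \<circ> \<gamma>) x = increment t ((h \<circ> \<gamma>) x) ((h \<circ> \<gamma>) y)"
  proof eventually_elim
    case (elim y)
    show ?case
    proof (cases "\<gamma> y = \<gamma> x")
      case False
      then show ?thesis using S(3)[of "\<gamma> y"] elim \<gamma>(2) by auto
    qed simp
  qed
qed

text \<open>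
  Every piece that meets a small neighbourhood of a point contains the point itself, so a primitive is
  determined near each point by its value there.
\<close>

lemma primitive_along_unique:
  assumes X: "connected X" and h: "continuous_on X h" "h ` X \<subseteq> K"
    and k: "primitive_along h X k" and k': "primitive_along h X k'"
  shows "(\<lambda>x. k x - k' x) constant_on X"
proof (rule locally_constant_imp_constant[OF X])
  fix x assume x: "x \<in> X"
  then have "h x \<in> K" using h by auto
  then obtain r where r: "r > 0" "\<And>t y. t \<in> \<P> \<Longrightarrow> y \<in> closure t \<Longrightarrow> dist (h x) y < r \<Longrightarrow> h x \<in> closure t"
    using pieces_near_point_contain_it by metis
  have "\<forall>\<^sub>F y in at x within X. dist (h y) (h x) < r"
    using h(1) x r(1) by (simp add: continuous_on_def tendstoD)
  moreover have "\<forall>\<^sub>F y in at x within X. y \<in> X"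
    by (simp add: eventually_at_topological) auto
  moreover note k[unfolded primitive_along_def, rule_format, OF x]
    k'[unfolded primitive_along_def, rule_format, OF x]
  ultimately have "\<forall>\<^sub>F y in at x within X. k y - k' y = k x - k' x"
  proof eventually_elim
    case (elim y)
    then obtain t where t: "t \<in> \<P>" "h y \<in> closure t" using covered h(2) by blast
    then have "h x \<in> closure t" using r(2) elim(1) by (metis dist_commute)
    then have "k y - k x = increment t (h x) (h y)" "k' y - k' x = increment t (h x) (h y)"
      using elim t by blast+
    then show ?case by (metis add_diff_cancel_left diff_add_cancel diff_diff_eq2 add.commute)
  qed
  then obtain S where "open S" "x \<in> S" "\<forall>y\<in>S. y \<noteq> x \<longrightarrow> y \<in> X \<longrightarrow> k y - k' y = k x - k' x"
    unfolding eventually_at_topological by metis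
  then show "\<exists>T. openin (top_of_set X) T \<and> x \<in> T \<and> (\<forall>y\<in>T. k y - k' y = k x - k' x)"
    using x by (intro exI[of _ "X \<inter> S"]) auto
qed

text \<open>
  Near \<open>h x\<close> the increment from \<open>h x\<close> is itself a primitive: compatibility makes it independent of the
  piece in which it is computed.
\<close>

lemma primitive_along_local:
  assumes h: "continuous_on X h" "h ` X \<subseteq> K" and x: "x \<in> X"
  shows "\<exists>S k. open S \<and> x \<in> S \<and> primitive_along h (X \<inter> S) k"
proof -
  have "h x \<in> K" using h x by auto
  then obtain r where r: "r > 0" "\<And>t y. t \<in> \<P> \<Longrightarrow> y \<in> closure t \<Longrightarrow> dist (h x) y < r \<Longrightarrow> h x \<in> closure t"
    using pieces_near_point_contain_it by metis
  have "\<forall>\<^sub>F y in at x within X. h y \<in> ball (h x) r"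
    using h(1) x r(1) unfolding continuous_on_def
    by (metis centre_in_ball open_ball topological_tendstoD)
  then obtain S where S: "open S" "x \<in> S" "\<And>y. \<lbrakk>y \<in> S; y \<noteq> x; y \<in> X\<rbrakk> \<Longrightarrow> h y \<in> ball (h x) r"
    unfolding eventually_at_topological by metis
  have near: "h x \<in> closure t" if "y \<in> X \<inter> S" "t \<in> \<P>" "h y \<in> closure t" for y t
    using that r(2)[of t "h y"] S(3)[of y] by (cases "y = x") auto
  define k where "k y = increment (SOME t. t \<in> \<P> \<and> h y \<in> closure t) (h x) (h y)" for y
  have k: "k y = increment t (h x) (h y)" if "y \<in> X \<inter> S" "t \<in> \<P>" "h y \<in> closure t" for y t
  proof -
    define s where "s = (SOME t. t \<in> \<P> \<and> h y \<in> closure t)"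
    have "s \<in> \<P> \<and> h y \<in> closure s" unfolding s_def by (rule someI) (use that in auto)
    then show ?thesis
      unfolding k_def s_def[symmetric] using near that by (intro increment_eq) auto
  qed
  have "primitive_along h (X \<inter> S) k"
    unfolding primitive_along_def
  proof
    fix y assume y: "y \<in> X \<inter> S"
    have "\<forall>\<^sub>F z in at y within X \<inter> S. z \<in> X \<inter> S"
      by (simp add: eventually_at_topological) auto
    then show "\<forall>\<^sub>F z in at y within X \<inter> S. \<forall>t\<in>\<P>. h y \<in> closure t \<and> h z \<in> closure t \<longrightarrow>
       k z - k y = increment t (h y) (h z)"
      by eventually_elim (use k y increment_diff in auto)
  qed
  then show ?thesis using S by blast
qed

lemma primitive_along_glue:
  assumes cl: "closed X" "closed Y" and k: "primitive_along h X k" and l: "primitive_along h Y l"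
    and eq: "\<And>x. x \<in> X \<inter> Y \<Longrightarrow> k x = l x"
  shows "primitive_along h (X \<union> Y) (\<lambda>x. if x \<in> X then k x else l x)"
proof -
  let ?k = "\<lambda>x. if x \<in> X then k x else l x"
  let ?P = "\<lambda>x y. \<forall>t\<in>\<P>. h x \<in> closure t \<and> h y \<in> closure t \<longrightarrow> ?k y - ?k x = increment t (h x) (h y)"
  have kX: "primitive_along h X ?k"
    by (rule primitive_along_cong[OF k]) auto
  have kY: "primitive_along h Y ?k"
    by (rule primitive_along_cong[OF l]) (use eq in auto)
  have one: "\<forall>\<^sub>F y in at x within Z. ?P x y" if "primitive_along h Z ?k" "closed Z" for x Z
  proof (cases "x \<in> Z")
    case True
    then show ?thesis using that(1) by (simp only: primitive_along_def)
  next
    case False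
    then show ?thesis
      unfolding eventually_at_topological using that(2) by (intro exI[of _ "- Z"]) auto
  qed
  show ?thesis
    unfolding primitive_along_def at_within_union eventually_sup
    using one[OF kX cl(1)] one[OF kY cl(2)] by blast
qed

lemma primitive_along_join:
  assumes cl: "closed X" "closed Y" and k: "primitive_along h X k" and l: "primitive_along h Y l"
    and XY: "connected (X \<inter> Y)" and h: "continuous_on (X \<inter> Y) h" "h ` (X \<inter> Y) \<subseteq> K"
  shows "\<exists>m. primitive_along h (X \<union> Y) m"
proof -
  have "primitive_along h (X \<inter> Y) k" "primitive_along h (X \<inter> Y) l"
    using k l primitive_along_subset by blast+
  then obtain c where c: "\<And>x. x \<in> X \<inter> Y \<Longrightarrow> k x - l x = c"
    using primitive_along_unique[OF XY h] unfolding constant_on_def by metis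
  show ?thesis
    using primitive_along_glue[OF cl k primitive_along_add_const[OF l, of c]] c by force
qed

text \<open>
  Primitives on two rectangles with a common side differ on it by a constant and can be joined. Two
  bisection arguments, in the second and then in the first coordinate, lead from small rectangles to
  arbitrary ones.
\<close>

lemma primitive_along_rectangle:
  fixes h :: "real \<times> real \<Rightarrow> complex"
  assumes h: "continuous_on UNIV h" "range h \<subseteq> K" and le: "p \<le> q" "c \<le> d"
  shows "\<exists>k. primitive_along h ({p..q} \<times> {c..d}) k"
proof -
  let ?R = "\<lambda>p q c d. \<exists>k. primitive_along h ({p..q} \<times> {c..d}) k"
  have h': "continuous_on A h" "h ` A \<subseteq> K" for A
    using h by (auto intro: continuous_on_subset)
  have sub: "?R p' q' c' d'" if "?R p q c d" "p \<le> p'" "q' \<le> q" "c \<le> c'" "d' \<le> d" for p q c d p' q' c' d'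
  proof -
    have "{p'..q'} \<times> {c'..d'} \<subseteq> {p..q} \<times> {c..d}" using that by auto
    then show ?thesis using that(1) primitive_along_subset by blast
  qed
  have loc: "\<exists>e>0. ?R (x - e) (x + e) (y - e) (y + e)" for x y
  proof -
    obtain S k where S: "open S" "(x, y) \<in> S" "primitive_along h (UNIV \<inter> S) k"
      using primitive_along_local[OF h, of "(x, y)"] by auto
    obtain A B where AB: "open A" "open B" "x \<in> A" "y \<in> B" "A \<times> B \<subseteq> S"
      using open_prod_elim[OF S(1,2)] by (metis mem_Sigma_iff)
    obtain e where e: "e > 0" "cball x e \<subseteq> A" using AB(1,3) open_contains_cball[of A] by blast
    obtain e' where e': "e' > 0" "cball y e' \<subseteq> B" using AB(2,4) open_contains_cball[of B] by blast
    define m where "m = min e e'"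
    have "{x - m..x + m} \<times> {y - m..y + m} \<subseteq> cball x e \<times> cball y e'"
      by (auto simp: m_def dist_real_def)
    also have "\<dots> \<subseteq> UNIV \<inter> S" using AB(5) e(2) e'(2) by auto
    finally have "?R (x - m) (x + m) (y - m) (y + m)" using S(3) primitive_along_subset by blast
    moreover have "m > 0" using e e' by (simp add: m_def)
    ultimately show ?thesis by blast
  qed
  have hor: "?R p q c d" if r: "?R p q c e" "?R p q e d" "c \<le> e" "e \<le> d" for p q c d e
  proof -
    obtain k l where "primitive_along h ({p..q} \<times> {c..e}) k" "primitive_along h ({p..q} \<times> {e..d}) l"
      using r by blast
    moreover have i: "({p..q} \<times> {c..e}) \<inter> ({p..q} \<times> {e..d}) = {p..q} \<times> {e}"
      and u: "({p..q} \<times> {c..e}) \<union> ({p..q} \<times> {e..d}) = {p..q} \<times> {c..d}"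
      using that by auto
    ultimately show ?thesis
      using primitive_along_join[of "{p..q} \<times> {c..e}" "{p..q} \<times> {e..d}" h k l] h'
      by (auto intro!: closed_Times connected_Times)
  qed
  have ver: "?R p q c d" if r: "?R p e c d" "?R e q c d" "p \<le> e" "e \<le> q" for p q c d e
  proof -
    obtain k l where "primitive_along h ({p..e} \<times> {c..d}) k" "primitive_along h ({e..q} \<times> {c..d}) l"
      using r by blast
    moreover have i: "({p..e} \<times> {c..d}) \<inter> ({e..q} \<times> {c..d}) = {e} \<times> {c..d}"
      and u: "({p..e} \<times> {c..d}) \<union> ({e..q} \<times> {c..d}) = {p..q} \<times> {c..d}"
      using that by auto
    ultimately show ?thesis
      using primitive_along_join[of "{p..e} \<times> {c..d}" "{e..q} \<times> {c..d}" h k l] h'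
      by (auto intro!: closed_Times connected_Times)
  qed
  have strip: "\<exists>e>0. ?R (x - e) (x + e) c d" for x
    using le(2)
  proof (induction rule: Bolzano)
    case (trans a b c)
    then obtain e e' where "e > 0" "e' > 0" "?R (x - e) (x + e) a b" "?R (x - e') (x + e') b c" by blast
    then have "?R (x - min e e') (x + min e e') a b" "?R (x - min e e') (x + min e e') b c"
      by (auto intro: sub)
    with hor[OF _ _ trans(3,4)] \<open>e > 0\<close> \<open>e' > 0\<close> show ?case by (metis min_less_iff_conj)
  next
    case (local y)
    obtain e where e: "e > 0" "?R (x - e) (x + e) (y - e) (y + e)" using loc by blast
    have "?R (x - e) (x + e) a b" if "a \<le> y \<and> y \<le> b \<and> b - a < e" for a b
      using that by (intro sub[OF e(2)]) auto
    then show ?case using e(1) by blast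
  qed
  show ?thesis
    using le(1)
  proof (induction rule: Bolzano)
    case (trans a b c)
    then show ?case using ver by blast
  next
    case (local x)
    obtain e where e: "e > 0" "?R (x - e) (x + e) c d" using strip by blast
    have "?R a b c d" if "a \<le> x \<and> x \<le> b \<and> b - a < e" for a b
      using that by (intro sub[OF e(2)]) auto
    then show ?case using e(1) by blast
  qed
qed

lemma primitive_along_unit_square:
  fixes h :: "real \<times> real \<Rightarrow> complex"
  assumes h: "continuous_on ({0..1} \<times> {0..1}) h" "h ` ({0..1} \<times> {0..1}) \<subseteq> K"
  shows "\<exists>k. primitive_along h ({0..1} \<times> {0..1}) k"
proof -
  \<comment> \<open>Retracting the plane onto the square avoids boundary cases in the local existence.\<close>
  define clip where "clip x = max 0 (min 1 x)" for x :: real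
  define C where "C z = (clip (fst z), clip (snd z))" for z
  define h' where "h' = h \<circ> C"
  have "continuous_on UNIV C"
    unfolding C_def clip_def by (intro continuous_intros)
  moreover have C: "range C \<subseteq> {0..1} \<times> {0..1}"
    by (auto simp: C_def clip_def)
  ultimately have "continuous_on UNIV h'"
    unfolding h'_def by (rule continuous_on_compose[OF _ continuous_on_subset[OF h(1)]])
  moreover have "range h' \<subseteq> K"
    unfolding h'_def image_comp[symmetric] using image_mono[OF C, of h] h(2) by (rule order_trans)
  ultimately obtain k where k: "primitive_along h' ({0..1} \<times> {0..1}) k"
    using primitive_along_rectangle[of h' 0 1 0 1] by auto
  have "primitive_along h ({0..1} \<times> {0..1}) k"
    by (rule primitive_along_cong[OF k]) (auto simp: h'_def C_def clip_def)
  then show ?thesis by blast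
qed

text \<open>
  Within a single piece the error is \<open>(a t - \<alpha>) dz + cnj (a t - \<alpha>) dg\<close>, of size at most
  \<open>2 * norm (a t - \<alpha>)\<close> times the length since \<open>g\<close> is isometric there. Hence the error is locally, and by
  bisection globally, Lipschitz along the curve, however many pieces the curve crosses.
\<close>

lemma primitive_along_path_estimate:
  fixes \<gamma> :: "real \<Rightarrow> complex"
  assumes k: "primitive_along \<gamma> {0..1} k" and \<gamma>: "M-lipschitz_on {0..1} \<gamma>" "\<gamma> ` {0..1} \<subseteq> K"
    and uv: "0 \<le> u" "u \<le> v" "v \<le> 1"
    and close: "\<And>s t. \<lbrakk>s \<in> {u..v}; t \<in> \<P>; \<gamma> s \<in> closure t\<rbrakk> \<Longrightarrow> norm (a t - \<alpha>) \<le> e"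
  shows "norm (k v - k u - (\<alpha> * (\<gamma> v - \<gamma> u) + cnj \<alpha> * (g (\<gamma> v) - g (\<gamma> u)))) \<le> 2 * e * M * (v - u)"
proof -
  define E where "E s = k s - (\<alpha> * \<gamma> s + cnj \<alpha> * g (\<gamma> s))" for s
  define L where "L = 2 * e * M"
  have M: "M \<ge> 0" using \<gamma>(1) by (rule lipschitz_on_nonneg)
  define P where "P p q \<longleftrightarrow> (u \<le> p \<and> q \<le> v \<longrightarrow> norm (E q - E p) \<le> L * (q - p))" for p q
  have loc: "\<exists>d>0. \<forall>y\<in>{u..v}. \<bar>y - s\<bar> < d \<longrightarrow> norm (E y - E s) \<le> L * \<bar>y - s\<bar>" if s: "s \<in> {u..v}" for s
  proof -
    have s01: "s \<in> {0..1}" using s uv by auto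
    then have "\<gamma> s \<in> K" using \<gamma> by auto
    then obtain r where r: "r > 0"
      "\<And>t y. t \<in> \<P> \<Longrightarrow> y \<in> closure t \<Longrightarrow> dist (\<gamma> s) y < r \<Longrightarrow> \<gamma> s \<in> closure t"
      using pieces_near_point_contain_it by metis
    have cont: "continuous_on {0..1} \<gamma>" using \<gamma>(1) by (rule lipschitz_on_continuous_on)
    have "\<forall>\<^sub>F y in at s within {0..1}. dist (\<gamma> y) (\<gamma> s) < r"
      using cont s01 r(1) by (simp add: continuous_on_def tendstoD)
    moreover have "\<forall>\<^sub>F y in at s within {0..1}. y \<in> {0..1}"
      by (simp add: eventually_at_topological) auto
    moreover note k[unfolded primitive_along_def, rule_format, OF s01]
    ultimately have "\<forall>\<^sub>F y in at s within {0..1}. y \<in> {u..v} \<longrightarrow> norm (E y - E s) \<le> L * \<bar>y - s\<bar>"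
    proof eventually_elim
      case (elim y)
      then obtain t where t: "t \<in> \<P>" "\<gamma> y \<in> closure t" using covered \<gamma>(2) by blast
      then have ts: "\<gamma> s \<in> closure t" using r(2) elim(1) by (metis dist_commute)
      have "k y - k s = increment t (\<gamma> s) (\<gamma> y)" using elim t ts by blast
      then have "E y - E s = (a t - \<alpha>) * (\<gamma> y - \<gamma> s) + cnj (a t - \<alpha>) * (g (\<gamma> y) - g (\<gamma> s))"
        by (simp add: E_def increment_def algebra_simps)
      also have "norm \<dots> \<le> norm (a t - \<alpha>) * norm (\<gamma> y - \<gamma> s) + norm (a t - \<alpha>) * norm (g (\<gamma> y) - g (\<gamma> s))"
        using norm_triangle_ineq[of "(a t - \<alpha>) * (\<gamma> y - \<gamma> s)" "cnj (a t - \<alpha>) * (g (\<gamma> y) - g (\<gamma> s))"]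
        by (simp only: norm_mult complex_mod_cnj)
      also have "\<dots> = 2 * norm (a t - \<alpha>) * norm (\<gamma> y - \<gamma> s)"
        using isometric[OF t(1) ts t(2)] by simp
      finally have *: "norm (E y - E s) \<le> 2 * norm (a t - \<alpha>) * norm (\<gamma> y - \<gamma> s)" .
      have lip: "norm (\<gamma> y - \<gamma> s) \<le> M * \<bar>y - s\<bar>"
        using lipschitz_onD[OF \<gamma>(1), of y s] elim(2) s01 by (simp add: dist_norm)
      have "2 * norm (a t - \<alpha>) * norm (\<gamma> y - \<gamma> s) \<le> 2 * e * (M * \<bar>y - s\<bar>)"
        using close[OF s t(1) ts] lip by (intro mult_mono) (auto intro: order_trans[OF norm_ge_zero])
      with * show ?case by (simp add: L_def mult.assoc)
    qed
    then obtain d where d: "d > 0" "\<And>y. \<lbrakk>y \<in> {0..1}; y \<noteq> s; dist y s < d; y \<in> {u..v}\<rbrakk> \<Longrightarrow> norm (E y - E s) \<le> L * \<bar>y - s\<bar>"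
      unfolding eventually_at by blast
    have "norm (E y - E s) \<le> L * \<bar>y - s\<bar>" if "y \<in> {u..v}" "\<bar>y - s\<bar> < d" for y
      using d(2)[of y] that uv by (cases "y = s") (auto simp: dist_real_def)
    then show ?thesis using d(1) by blast
  qed
  have "P u v"
    using uv(2)
  proof (induction rule: Bolzano)
    case (trans p q w)
    show ?case
      unfolding P_def
    proof (intro impI)
      assume "u \<le> p \<and> w \<le> v"
      then have "norm (E q - E p) \<le> L * (q - p)" "norm (E w - E q) \<le> L * (w - q)" using trans by (auto simp: P_def)
      moreover have "norm (E w - E p) \<le> norm (E q - E p) + norm (E w - E q)" by norm
      ultimately show "norm (E w - E p) \<le> L * (w - p)" by (simp add: right_diff_distrib)
    qed
  next
    case (local s)
    then obtain d where d: "d > 0" "\<And>y. \<lbrakk>y \<in> {u..v}; \<bar>y - s\<bar> < d\<rbrakk> \<Longrightarrow> norm (E y - E s) \<le> L * \<bar>y - s\<bar>"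
      using loc[of s] by auto
    have "P p q" if "p \<le> s \<and> s \<le> q \<and> q - p < d" for p q
      unfolding P_def
    proof (intro impI)
      assume "u \<le> p \<and> q \<le> v"
      then have "norm (E p - E s) \<le> L * (s - p)" "norm (E q - E s) \<le> L * (q - s)"
        using d(2)[of p] d(2)[of q] that by auto
      moreover have "norm (E q - E p) \<le> norm (E p - E s) + norm (E q - E s)" by norm
      ultimately show "norm (E q - E p) \<le> L * (q - p)" by (simp add: right_diff_distrib)
    qed
    then show ?case using d(1) by blast
  qed
  moreover have "E v - E u = k v - k u - (\<alpha> * (\<gamma> v - \<gamma> u) + cnj \<alpha> * (g (\<gamma> v) - g (\<gamma> u)))"
    by (simp add: E_def algebra_simps)
  ultimately show ?thesis by (simp add: L_def P_def)
qed

end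

section \<open>Passing to the limit\<close>

lemma RS_sum_tendsto:
  assumes p: "p tagged_division_of {0..1}"
    and g: "\<And>t. t \<in> {0..1} \<Longrightarrow> (\<lambda>n. g n t) \<longlonglongrightarrow> g' t"
  shows "(\<lambda>n. RS_sum \<phi> (g n) p) \<longlonglongrightarrow> RS_sum \<phi> g' p"
  unfolding RS_sum_def case_prod_unfold
proof (intro tendsto_sum tendsto_mult tendsto_const tendsto_diff)
  fix xk assume "xk \<in> p"
  then have "(fst xk, snd xk) \<in> p" by simp
  from tagged_division_unit_intervalE[OF p this]
  have "Sup (snd xk) \<in> {0..1}" "Inf (snd xk) \<in> {0..1}" by (metis atLeastAtMost_iff order_trans)+
  then show "(\<lambda>n. g n (Sup (snd xk))) \<longlonglongrightarrow> g' (Sup (snd xk))"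
    "(\<lambda>n. g n (Inf (snd xk))) \<longlonglongrightarrow> g' (Inf (snd xk))" using g by auto
qed

text \<open>
  One fine division serves all \<open>n\<close>: on each of its intervals the increment of the primitive is compared
  with the term of the Riemann--Stieltjes sum, with an error proportional to the length of the
  interval, and for a fixed division the sums converge with \<open>n\<close>.
\<close>

lemma primitive_along_path_limit:
  fixes g :: "nat \<Rightarrow> complex \<Rightarrow> complex"
  assumes f: "continuous_on K f"
    and \<gamma>: "M-lipschitz_on {0..1} \<gamma>" "\<gamma> ` {0..1} \<subseteq> K"
    and I: "has_RS_integral (\<lambda>t. f (\<gamma> t)) \<gamma> I"
    and J: "has_RS_integral (\<lambda>t. cnj (f (\<gamma> t))) (\<lambda>t. \<theta> (\<gamma> t)) J"
    and g: "\<And>z. z \<in> K \<Longrightarrow> (\<lambda>n. g n z) \<longlonglongrightarrow> \<theta> z"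
    and \<epsilon>: "\<epsilon> > 0"
  shows "\<forall>\<^sub>F n in sequentially. \<forall>\<P> a k. piecewise_form K (g n) \<P> a \<longrightarrow>
      (\<forall>t\<in>\<P>. \<forall>z\<in>closure t \<inter> K. norm (a t - f z) \<le> \<epsilon>) \<longrightarrow>
      piecewise_form.primitive_along (g n) \<P> a \<gamma> {0..1} k \<longrightarrow>
      norm (k 1 - k 0 - (I + J)) \<le> (4 * M + 3) * \<epsilon>"
proof -
  have M: "M \<ge> 0" using \<gamma>(1) by (rule lipschitz_on_nonneg)
  let ?\<phi> = "\<lambda>t. f (\<gamma> t)" and ?\<psi> = "\<lambda>t. cnj (f (\<gamma> t))"
  obtain d1 where d1: "d1 > 0" "\<And>p. tagged_mesh_less d1 p \<Longrightarrow> norm (RS_sum ?\<phi> \<gamma> p - I) < \<epsilon>"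
    using I \<epsilon> unfolding has_RS_integral_iff by blast
  obtain d2 where d2: "d2 > 0" "\<And>p. tagged_mesh_less d2 p \<Longrightarrow> norm (RS_sum ?\<psi> (\<lambda>t. \<theta> (\<gamma> t)) p - J) < \<epsilon>"
    using J \<epsilon> unfolding has_RS_integral_iff by blast
  have "continuous_on {0..1} ?\<phi>"
    using continuous_on_compose2[OF f lipschitz_on_continuous_on[OF \<gamma>(1)] \<gamma>(2)] by simp
  then have "uniformly_continuous_on {0..1} ?\<phi>"
    by (intro compact_uniformly_continuous) auto
  then obtain d3 where d3: "d3 > 0"
    "\<And>s t. \<lbrakk>s \<in> {0..1}; t \<in> {0..1}; dist t s < d3\<rbrakk> \<Longrightarrow> norm (f (\<gamma> t) - f (\<gamma> s)) < \<epsilon>"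
    using \<epsilon> unfolding uniformly_continuous_on_def dist_norm[where 'a=complex] by blast
  define d where "d = min d1 (min d2 d3)"
  have "d > 0" using d1 d2 d3 by (simp add: d_def)
  then obtain p where p: "tagged_mesh_less d p" using fine_tagged_division_exists by blast
  then have tp: "p tagged_division_of {0..1}" by (simp add: tagged_mesh_less_def)
  have dI: "norm (RS_sum ?\<phi> \<gamma> p - I) < \<epsilon>" "norm (RS_sum ?\<psi> (\<lambda>t. \<theta> (\<gamma> t)) p - J) < \<epsilon>"
    using d1(2) d2(2) tagged_mesh_less_mono[OF p] by (auto simp: d_def)
  have "(\<lambda>n. RS_sum ?\<psi> (\<lambda>t. g n (\<gamma> t)) p) \<longlonglongrightarrow> RS_sum ?\<psi> (\<lambda>t. \<theta> (\<gamma> t)) p"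
    using \<gamma>(2) by (intro RS_sum_tendsto[OF tp] g) auto
  then have "\<forall>\<^sub>F n in sequentially. norm (RS_sum ?\<psi> (\<lambda>t. g n (\<gamma> t)) p - RS_sum ?\<psi> (\<lambda>t. \<theta> (\<gamma> t)) p) < \<epsilon>"
    using \<epsilon> by (auto simp: dist_norm dest: tendstoD)
  then show ?thesis
  proof (eventually_elim, intro allI impI)
    fix n \<P> a k
    assume near: "norm (RS_sum ?\<psi> (\<lambda>t. g n (\<gamma> t)) p - RS_sum ?\<psi> (\<lambda>t. \<theta> (\<gamma> t)) p) < \<epsilon>"
      and "piecewise_form K (g n) \<P> a"
      and close: "\<forall>t\<in>\<P>. \<forall>z\<in>closure t \<inter> K. norm (a t - f z) \<le> \<epsilon>"
      and k: "piecewise_form.primitive_along (g n) \<P> a \<gamma> {0..1} k"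
    interpret piecewise_form K "g n" \<P> a by fact
    let ?S = "RS_sum ?\<phi> \<gamma> p + RS_sum ?\<psi> (\<lambda>t. g n (\<gamma> t)) p"
    let ?f = "\<lambda>(x, k'). k (Sup k') - k (Inf k') - (f (\<gamma> x) * (\<gamma> (Sup k') - \<gamma> (Inf k'))
        + cnj (f (\<gamma> x)) * (g n (\<gamma> (Sup k')) - g n (\<gamma> (Inf k'))))"
    have "k 1 - k 0 - ?S = (\<Sum>xk\<in>p. ?f xk)"
      using additive_tagged_division_1[OF _ tp, of k]
      by (simp add: RS_sum_def sum_subtractf sum.distrib case_prod_unfold)
    also have "norm \<dots> \<le> 4 * M * \<epsilon>"
    proof (rule tagged_sum_norm_le[OF tp])
      fix x k' assume xk: "(x, k') \<in> p"
      obtain u v where k': "k' = {u..v}" "0 \<le> u" "u \<le> x" "x \<le> v" "v \<le> 1"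
        "Sup k' = v" "Inf k' = u" "diameter k' = v - u"
        using tagged_division_unit_intervalE[OF tp xk] by metis
      have len: "v - u < d3" using p xk k'(8) by (auto simp: tagged_mesh_less_def d_def)
      have "norm (a t - f (\<gamma> x)) \<le> 2 * \<epsilon>" if "s \<in> {u..v}" "t \<in> \<P>" "\<gamma> s \<in> closure t" for s t
      proof -
        have s: "s \<in> {0..1}" "x \<in> {0..1}" "dist s x < d3"
          using that k' len by (auto simp: dist_real_def)
        then have "norm (f (\<gamma> s) - f (\<gamma> x)) < \<epsilon>" using d3(2) by blast
        moreover have "norm (a t - f (\<gamma> s)) \<le> \<epsilon>" using close that \<gamma>(2) s(1) by blast
        ultimately show ?thesis
          using norm_triangle_ineq[of "a t - f (\<gamma> s)" "f (\<gamma> s) - f (\<gamma> x)"] by simp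
      qed
      then have "norm (k v - k u - (f (\<gamma> x) * (\<gamma> v - \<gamma> u) + cnj (f (\<gamma> x)) * (g n (\<gamma> v) - g n (\<gamma> u))))
          \<le> 2 * (2 * \<epsilon>) * M * (v - u)"
        using k' by (intro primitive_along_path_estimate[OF k \<gamma>]) auto
      then show "norm (?f (x, k')) \<le> 4 * M * \<epsilon> * (Sup k' - Inf k')"
        using k' by (simp add: mult_ac)
    qed
    finally have "norm (k 1 - k 0 - ?S) \<le> 4 * M * \<epsilon>" .
    moreover have "k 1 - k 0 - (I + J) = (k 1 - k 0 - ?S) + ((RS_sum ?\<phi> \<gamma> p - I) +
        ((RS_sum ?\<psi> (\<lambda>t. \<theta> (\<gamma> t)) p - J) +
         (RS_sum ?\<psi> (\<lambda>t. g n (\<gamma> t)) p - RS_sum ?\<psi> (\<lambda>t. \<theta> (\<gamma> t)) p)))"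
      by simp
    ultimately have "norm (k 1 - k 0 - (I + J)) \<le> 4 * M * \<epsilon> + (\<epsilon> + (\<epsilon> + \<epsilon>))"
      using dI near by (simp only:) (intro norm_triangle_le add_mono; simp)
    then show "norm (k 1 - k 0 - (I + J)) \<le> (4 * M + 3) * \<epsilon>" by (simp add: algebra_simps)
  qed
qed

text \<open>
  What the discrete side has to deliver: forms on \<open>K\<close> with coefficients uniformly close to \<open>f\<close>. The set of
  pieces may depend on the required accuracy.
\<close>

definition approximating_forms ::
    "complex set \<Rightarrow> (nat \<Rightarrow> complex \<Rightarrow> complex) \<Rightarrow> (complex \<Rightarrow> complex) \<Rightarrow> bool" where
  "approximating_forms K g f \<longleftrightarrow> (\<forall>\<epsilon>>0. \<forall>\<^sub>F n in sequentially. \<exists>\<P> a. piecewise_form K (g n) \<P> a \<and>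
      (\<forall>t\<in>\<P>. \<forall>z\<in>closure t \<inter> K. norm (a t - f z) \<le> \<epsilon>))"

lemma C1_lipschitz_on:
  fixes \<gamma> :: "real \<Rightarrow> complex"
  assumes "\<gamma> C1_differentiable_on {0..1}"
  shows "\<exists>M. M-lipschitz_on {0..1} \<gamma>"
proof -
  obtain D where D: "\<And>x. x \<in> {0..1} \<Longrightarrow> (\<gamma> has_vector_derivative D x) (at x)" "continuous_on {0..1} D"
    using assms unfolding C1_differentiable_on_def by blast
  obtain B where B: "B > 0" "\<And>x. x \<in> {0..1} \<Longrightarrow> norm (D x) \<le> B"
    using compact_imp_bounded[OF compact_continuous_image[OF D(2) compact_Icc]]
    unfolding bounded_pos by auto
  have "B-lipschitz_on {0..1} \<gamma>"
  proof (rule bounded_derivative_imp_lipschitz)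
    show "(\<gamma> has_derivative (\<lambda>h. h *\<^sub>R D x)) (at x within {0..1})" if "x \<in> {0..1}" for x
      using D(1)[OF that] by (simp add: has_vector_derivative_def has_derivative_at_withinI)
    show "onorm (\<lambda>h. h *\<^sub>R D x) \<le> B" if "x \<in> {0..1}" for x
      using B(2)[OF that] by (intro onorm_le) (simp, metis abs_ge_zero mult.commute mult_right_mono)
  qed (use B in auto)
  then show ?thesis by blast
qed

lemma (in piecewise_form) primitive_along_constant_path:
  assumes "primitive_along h {0..1::real} k" "x \<in> K" "\<And>s. s \<in> {0..1} \<Longrightarrow> h s = x"
  shows "k 1 = k 0"
proof -
  have "primitive_along (\<lambda>_. x) {0..1::real} k"
    using primitive_along_cong[OF assms(1)] assms(3) by auto
  moreover have "primitive_along (\<lambda>_. x) {0..1::real} (\<lambda>_. 0)"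
    by (simp add: primitive_along_def)
  ultimately have "(\<lambda>s. k s - 0) constant_on {0..1}"
    using assms(2) by (intro primitive_along_unique[where h = "\<lambda>_. x"]) auto
  then obtain c where "\<And>s. s \<in> {0..1} \<Longrightarrow> k s - 0 = c" by (auto simp: constant_on_def)
  from this[of 0] this[of 1] show ?thesis by simp
qed

text \<open>
  Along a homotopy of loops, the two vertical sides of the square carry the same map, so that the
  increments around all loops of the homotopy agree.
\<close>

lemma (in piecewise_form) primitive_along_null_homotopy:
  fixes h :: "real \<times> real \<Rightarrow> complex"
  assumes k: "primitive_along h ({0..1} \<times> {0..1}) k"
    and h: "continuous_on ({0..1} \<times> {0..1}) h" "h ` ({0..1} \<times> {0..1}) \<subseteq> K"
    and loops: "\<And>s. s \<in> {0..1} \<Longrightarrow> h (s, 0) = h (s, 1)"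
    and const: "\<And>t. t \<in> {0..1} \<Longrightarrow> h (1, t) = x"
  shows "k (0, 1) = k (0, 0)"
proof -
  have side: "primitive_along (\<lambda>s. h (s, c)) {0..1} (\<lambda>s. k (s, c))" if "c \<in> {0..1}" for c
  proof -
    have "primitive_along (h \<circ> (\<lambda>s. (s, c))) {0..1} (k \<circ> (\<lambda>s. (s, c)))"
      by (rule primitive_along_compose[OF k]) (use that in \<open>auto intro!: continuous_intros\<close>)
    then show ?thesis by (simp add: o_def)
  qed
  have "primitive_along (\<lambda>s. h (s, 0)) {0..1} (\<lambda>s. k (s, 1))"
    by (rule primitive_along_cong[OF side[of 1]]) (use loops in auto)
  moreover have "continuous_on {0..1} (\<lambda>s. h (s, 0))"
    by (rule continuous_on_compose2[OF h(1)]) (auto intro!: continuous_intros)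
  ultimately have "(\<lambda>s. k (s, 1) - k (s, 0)) constant_on {0..1}"
    using side[of 0] h(2) by (intro primitive_along_unique[where h = "\<lambda>s. h (s, 0)"]) auto
  then have eq: "k (0, 1) - k (0, 0) = k (1, 1) - k (1, 0)"
    unfolding constant_on_def by (metis atLeastAtMost_iff order_refl zero_le_one)
  have "primitive_along (h \<circ> Pair 1) {0..1} (k \<circ> Pair 1)"
    by (rule primitive_along_compose[OF k]) (auto intro!: continuous_intros)
  then have "primitive_along (\<lambda>t. h (1, t)) {0..1} (\<lambda>t. k (1, t))"
    by (simp add: o_def)
  moreover have "x \<in> K" using h(2) const[of 0] by force
  ultimately have "k (1, 1) = k (1, 0)" using primitive_along_constant_path const by blast
  with eq show ?thesis by simp
qed

lemma closed_form_limit: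
  fixes g :: "nat \<Rightarrow> complex \<Rightarrow> complex"
  assumes f: "continuous_on U f"
    and appr: "\<And>K. compact K \<Longrightarrow> K \<subseteq> U \<Longrightarrow> approximating_forms K g f"
    and g: "\<And>z. z \<in> U \<Longrightarrow> (\<lambda>n. g n z) \<longlonglongrightarrow> \<theta> z"
    and \<theta>: "L-lipschitz_on U \<theta>"
  shows "closed_form U f \<theta>"
  unfolding closed_form_def
proof (intro allI impI)
  fix \<gamma> :: "real \<Rightarrow> complex"
  assume *: "\<gamma> C1_differentiable_on {0..1} \<and> (\<exists>a. homotopic_loops U \<gamma> (linepath a a))"
  then obtain M where M: "M-lipschitz_on {0..1} \<gamma>" using C1_lipschitz_on by blast
  then have M0: "M \<ge> 0" by (rule lipschitz_on_nonneg)
  from * obtain x h where h: "continuous_on ({0..1::real} \<times> {0..1::real}) h"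
      "h \<in> ({0..1} \<times> {0..1}) \<rightarrow> U" "\<And>t. t \<in> {0..1} \<Longrightarrow> h (0, t) = \<gamma> t"
      "\<And>t. t \<in> {0..1} \<Longrightarrow> h (1, t) = linepath x x t"
      "\<And>s. s \<in> {0..1} \<Longrightarrow> pathfinish (h \<circ> Pair s) = pathstart (h \<circ> Pair s)"
    unfolding homotopic_loops by metis
  define K where "K = h ` ({0..1} \<times> {0..1})"
  have K: "compact K" "K \<subseteq> U"
    using h(1,2) unfolding K_def by (auto intro!: compact_continuous_image compact_Times)
  have \<gamma>K: "\<gamma> ` {0..1} \<subseteq> K"
  proof
    fix z assume "z \<in> \<gamma> ` {0..1}"
    then obtain t where "t \<in> {0..1}" "z = h (0, t)" using h(3) by auto
    then show "z \<in> K" by (auto simp: K_def)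
  qed
  have fK: "continuous_on K f" using f K(2) by (rule continuous_on_subset)
  have cf: "continuous_on {0..1} (\<lambda>t. f (\<gamma> t))"
    using continuous_on_compose2[OF fK lipschitz_on_continuous_on[OF M] \<gamma>K] .
  obtain I where I: "has_RS_integral (\<lambda>t. f (\<gamma> t)) \<gamma> I"
    using has_RS_integral_exists[OF cf M] by blast
  have "(L * M)-lipschitz_on {0..1} (\<lambda>t. \<theta> (\<gamma> t))"
    using lipschitz_on_compose2[OF M lipschitz_on_subset[OF \<theta>]] \<gamma>K K(2) by auto
  then obtain J where J: "has_RS_integral (\<lambda>t. cnj (f (\<gamma> t))) (\<lambda>t. \<theta> (\<gamma> t)) J"
    using has_RS_integral_exists[of "\<lambda>t. cnj (f (\<gamma> t))"] continuous_on_cnj[OF cf] by blast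
  have bound: "norm (I + J) \<le> (4 * M + 3) * \<epsilon>" if \<epsilon>: "\<epsilon> > 0" for \<epsilon>
  proof -
    have "\<forall>\<^sub>F n in sequentially. \<exists>\<P> a. piecewise_form K (g n) \<P> a \<and>
      (\<forall>t\<in>\<P>. \<forall>z\<in>closure t \<inter> K. norm (a t - f z) \<le> \<epsilon>)"
      using appr[OF K] \<epsilon> unfolding approximating_forms_def by blast
    moreover have "\<forall>\<^sub>F n in sequentially. \<forall>\<P> a k. piecewise_form K (g n) \<P> a \<longrightarrow>
      (\<forall>t\<in>\<P>. \<forall>z\<in>closure t \<inter> K. norm (a t - f z) \<le> \<epsilon>) \<longrightarrow>
      piecewise_form.primitive_along (g n) \<P> a \<gamma> {0..1} k \<longrightarrow>
      norm (k 1 - k 0 - (I + J)) \<le> (4 * M + 3) * \<epsilon>"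
      using g K(2) by (intro primitive_along_path_limit[OF fK M \<gamma>K I J _ \<epsilon>]) auto
    ultimately have "\<forall>\<^sub>F n in sequentially. norm (I + J) \<le> (4 * M + 3) * \<epsilon>"
    proof eventually_elim
      case (elim n)
      then obtain \<P> a where pf: "piecewise_form K (g n) \<P> a"
        and cl: "\<forall>t\<in>\<P>. \<forall>z\<in>closure t \<inter> K. norm (a t - f z) \<le> \<epsilon>" by blast
      interpret piecewise_form K "g n" \<P> a by fact
      obtain k where k: "primitive_along h ({0..1} \<times> {0..1}) k"
        using primitive_along_unit_square[OF h(1)] by (auto simp: K_def)
      have "primitive_along (h \<circ> Pair 0) {0..1} (k \<circ> Pair 0)"
        by (rule primitive_along_compose[OF k]) (auto intro!: continuous_intros)
      then have "primitive_along \<gamma> {0..1} (k \<circ> Pair 0)"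
        by (rule primitive_along_cong) (use h(3) in auto)
      then have "norm ((k \<circ> Pair 0) 1 - (k \<circ> Pair 0) 0 - (I + J)) \<le> (4 * M + 3) * \<epsilon>"
        using elim(2) pf cl by blast
      moreover have "k (0, 1) = k (0, 0)"
        using h(4,5) by (intro primitive_along_null_homotopy[OF k h(1), of x])
          (auto simp: K_def pathstart_def pathfinish_def)
      ultimately show ?case using norm_minus_cancel[of "I + J"] by simp
    qed
    then show ?thesis by simp
  qed
  have "norm (I + J) \<le> 0"
  proof (rule field_le_epsilon)
    fix e :: real assume "e > 0"
    then show "norm (I + J) \<le> 0 + e"
      using bound[of "e / (4 * M + 3)"] M0 by (simp add: add_nonneg_pos)
  qed
  then have "I + J = 0" by simp
  with I J show "\<exists>I J. has_RS_integral (\<lambda>t. f (\<gamma> t)) \<gamma> I \<and>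
      has_RS_integral (\<lambda>t. cnj (f (\<gamma> t))) (\<lambda>t. \<theta> (\<gamma> t)) J \<and> I + J = 0" by blast
qed

text \<open>
  Morera's theorem: a triangle is a square with one side contracted to a vertex, and a primitive along
  this map compares the integrals over the three other sides.
\<close>

lemma holomorphic_limit:
  fixes g :: "nat \<Rightarrow> complex \<Rightarrow> complex"
  assumes U: "open U" and f: "continuous_on U f"
    and appr: "\<And>K. compact K \<Longrightarrow> K \<subseteq> U \<Longrightarrow> approximating_forms K g f"
    and g: "\<And>z. z \<in> U \<Longrightarrow> (\<lambda>n. g n z) \<longlonglongrightarrow> 0"
  shows "f holomorphic_on U"
proof -
  have tri: "contour_integral (linepath a b) f + contour_integral (linepath b c) f + contour_integral (linepath c a) f = 0"
    if abc: "convex hull {a, b, c} \<subseteq> U" for a b c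
  proof -
    define K where "K = convex hull {a, b, c}"
    have K: "compact K" "K \<subseteq> U" "convex K" "a \<in> K" "b \<in> K" "c \<in> K"
      using abc by (auto simp: K_def finite_imp_compact_convex_hull hull_inc)
    define h where "h = (\<lambda>(s, t). linepath a (linepath b c t) s)"
    have h: "continuous_on ({0..1} \<times> {0..1}) h"
      unfolding h_def linepath_def case_prod_unfold by (intro continuous_intros)
    have segK: "linepath x y t \<in> K" if "x \<in> K" "y \<in> K" "t \<in> {0..1}" for x y t
    proof -
      have "linepath x y t \<in> closed_segment x y" using that by (simp add: linepath_in_path)
      then show ?thesis using closed_segment_subset[OF that(1,2) K(3)] by blast
    qed
    have hK: "h ` ({0..1} \<times> {0..1}) \<subseteq> K" using segK K by (auto simp: h_def)
    have fK: "continuous_on K f" using f K(2) by (rule continuous_on_subset)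
    have J: "has_RS_integral \<phi> (\<lambda>t. 0) 0" for \<phi> by (simp add: has_RS_integral_def zero_less_one exI[of _ 1])
    define M where "M = norm (b - a) + norm (c - b) + norm (c - a)"
    let ?I = "\<lambda>x y. contour_integral (linepath x y) f"
    have side: "\<forall>\<^sub>F n in sequentially. \<forall>\<P> A k. piecewise_form K (g n) \<P> A \<longrightarrow>
      (\<forall>t\<in>\<P>. \<forall>z\<in>closure t \<inter> K. norm (A t - f z) \<le> \<epsilon>) \<longrightarrow>
      piecewise_form.primitive_along (g n) \<P> A (linepath x y) {0..1} k \<longrightarrow>
      norm (k 1 - k 0 - ?I x y) \<le> (4 * M + 3) * \<epsilon>"
      if xy: "x \<in> K" "y \<in> K" "norm (y - x) \<le> M" and \<epsilon>: "\<epsilon> > 0" for x y \<epsilon>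
    proof -
      have l: "M-lipschitz_on {0..1} (linepath x y)"
        using lipschitz_on_mono[OF linepath_lipschitz order_refl xy(3)] .
      have cf: "continuous_on (closed_segment x y) f"
        using closed_segment_subset[OF xy(1,2) K(3)] fK continuous_on_subset by blast
      have im: "linepath x y ` {0..1} \<subseteq> K" using segK[OF xy(1,2)] by blast
      have "(\<lambda>n. g n z) \<longlonglongrightarrow> 0" if "z \<in> K" for z using g K(2) that by blast
      from primitive_along_path_limit[where \<theta> = "\<lambda>_. 0" and J = 0 and g = g,
          OF fK l im has_RS_integral_linepath[OF cf] J this \<epsilon>]
      show ?thesis by simp
    qed
    have M: "norm (b - a) \<le> M" "norm (c - b) \<le> M" "norm (c - a) \<le> M" "M \<ge> 0"
      by (auto simp: M_def)
    have bound: "norm (?I a b + ?I b c - ?I a c) \<le> 3 * ((4 * M + 3) * \<epsilon>)" if \<epsilon>: "\<epsilon> > 0" for \<epsilon>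
    proof -
      have "\<forall>\<^sub>F n in sequentially. \<exists>\<P> A. piecewise_form K (g n) \<P> A \<and>
        (\<forall>t\<in>\<P>. \<forall>z\<in>closure t \<inter> K. norm (A t - f z) \<le> \<epsilon>)"
        using appr[OF K(1,2)] \<epsilon> unfolding approximating_forms_def by blast
      moreover note side[OF K(4,5) M(1) \<epsilon>] side[OF K(5,6) M(2) \<epsilon>] side[OF K(4,6) M(3) \<epsilon>]
      ultimately have "\<forall>\<^sub>F n in sequentially. norm (?I a b + ?I b c - ?I a c) \<le> 3 * ((4 * M + 3) * \<epsilon>)"
      proof eventually_elim
        case (elim n)
        then obtain \<P> A where pf: "piecewise_form K (g n) \<P> A"
          and cl: "\<forall>t\<in>\<P>. \<forall>z\<in>closure t \<inter> K. norm (A t - f z) \<le> \<epsilon>" by blast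
        interpret piecewise_form K "g n" \<P> A by fact
        obtain k where k: "primitive_along h ({0..1} \<times> {0..1}) k"
          using primitive_along_unit_square[OF h hK] by blast
        have comp: "primitive_along (\<lambda>s. h (\<gamma> s)) {0..1} (\<lambda>s. k (\<gamma> s))"
          if "continuous_on {0..1} \<gamma>" "\<gamma> ` {0..1} \<subseteq> {0..1} \<times> {0..1}" for \<gamma> :: "real \<Rightarrow> real \<times> real"
          using primitive_along_compose[OF k that] by (simp add: o_def)
        have "primitive_along (linepath a b) {0..1} (\<lambda>s. k (s, 0))"
          by (rule primitive_along_cong[OF comp[of "\<lambda>s. (s, 0)"]])
            (auto simp: h_def linepath_def intro!: continuous_intros)
        then have 1: "norm (k (1, 0) - k (0, 0) - ?I a b) \<le> (4 * M + 3) * \<epsilon>"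
          using elim(2) pf cl by blast
        have "primitive_along (linepath b c) {0..1} (\<lambda>s. k (1, s))"
          by (rule primitive_along_cong[OF comp[of "\<lambda>s. (1, s)"]])
            (auto simp: h_def linepath_def intro!: continuous_intros)
        then have 2: "norm (k (1, 1) - k (1, 0) - ?I b c) \<le> (4 * M + 3) * \<epsilon>"
          using elim(3) pf cl by blast
        have "primitive_along (linepath a c) {0..1} (\<lambda>s. k (s, 1))"
          by (rule primitive_along_cong[OF comp[of "\<lambda>s. (s, 1)"]])
            (auto simp: h_def linepath_def intro!: continuous_intros)
        then have 3: "norm (k (1, 1) - k (0, 1) - ?I a c) \<le> (4 * M + 3) * \<epsilon>"
          using elim(4) pf cl by blast
        have 4: "k (0, 1) = k (0, 0)"
          by (rule primitive_along_constant_path[OF comp[of "\<lambda>s. (0, s)"] K(4)])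
            (auto simp: h_def linepath_def intro!: continuous_intros)
        have "?I a b + ?I b c - ?I a c = (k (1, 1) - k (0, 1) - ?I a c)
          - (k (1, 0) - k (0, 0) - ?I a b) - (k (1, 1) - k (1, 0) - ?I b c)"
          using 4 by simp
        also have "norm \<dots> \<le> 3 * ((4 * M + 3) * \<epsilon>)"
          using norm_triangle_ineq4[of "k (1, 1) - k (0, 1) - ?I a c" "k (1, 0) - k (0, 0) - ?I a b"]
            norm_triangle_ineq4[of "(k (1, 1) - k (0, 1) - ?I a c) - (k (1, 0) - k (0, 0) - ?I a b)"
              "k (1, 1) - k (1, 0) - ?I b c"] 1 2 3 by linarith
        finally show ?case .
      qed
      then show ?thesis by simp
    qed
    have "norm (?I a b + ?I b c - ?I a c) \<le> 0"
    proof (rule field_le_epsilon)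
      fix e :: real assume "e > 0"
      have eq: "3 * (X * (e / (3 * X))) = e" if "X > 0" for X :: real using that by simp
      have pos: "4 * M + 3 > 0" using M(4) by simp
      have "norm (?I a b + ?I b c - ?I a c) \<le> 3 * ((4 * M + 3) * (e / (3 * (4 * M + 3))))"
        using pos \<open>e > 0\<close> by (intro bound divide_pos_pos mult_pos_pos) simp_all
      also have "\<dots> = e" by (rule eq[OF pos])
      finally show "norm (?I a b + ?I b c - ?I a c) \<le> 0 + e" by simp
    qed
    moreover have "?I c a = - ?I a c"
      using closed_segment_subset[OF K(6,4,3)]
      by (intro contour_integral_reverse_linepath continuous_on_subset[OF fK])
    ultimately show ?thesis by simp
  qed
  have "f analytic_on U"
    by (rule Morera_triangle[OF f U]) (use tri in blast)
  then show ?thesis by (rule analytic_imp_holomorphic)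
qed

section \<open>Straight-line drawings and their faces\<close>

definition drawn :: "complex set set \<Rightarrow> complex set" where
  "drawn E = (\<Union>e\<in>E. convex hull e)"

lemma faces_eq_components: "faces E = components (- drawn E)"
  by (simp add: faces_def drawn_def)

lemma drawing_edgeE:
  assumes "drawing E" "e \<in> E"
  obtains u v where "e = {u, v}" "u \<noteq> v"
  using assms unfolding drawing_def card_2_iff by metis

lemma drawing_locally_finite:
  "drawing E \<Longrightarrow> bounded B \<Longrightarrow> finite {e \<in> E. convex hull e \<inter> B \<noteq> {}}"
  by (simp add: drawing_def)

lemma drawing_hull_Int:
  "\<lbrakk>drawing E; e \<in> E; e' \<in> E; e \<noteq> e'\<rbrakk> \<Longrightarrow> convex hull e \<inter> convex hull e' = e \<inter> e'"
  by (simp add: drawing_def)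

lemma finite_edge: "drawing E \<Longrightarrow> e \<in> E \<Longrightarrow> finite e"
  unfolding drawing_def by (metis card.infinite zero_neq_numeral)

lemma compact_edge: "drawing E \<Longrightarrow> e \<in> E \<Longrightarrow> compact (convex hull e)"
  by (simp add: finite_edge finite_imp_compact_convex_hull)

lemma drawing_closed_subdrawing:
  assumes E: "drawing E" and A: "A \<subseteq> E"
  shows "closed (\<Union>e\<in>A. convex hull e)"
proof -
  let ?X = "\<Union>e\<in>A. convex hull e"
  have "open (- ?X)"
  proof (subst open_subopen, intro ballI)
    fix x assume x: "x \<in> - ?X"
    let ?C = "\<Union>e\<in>{e \<in> A. convex hull e \<inter> ball x 1 \<noteq> {}}. convex hull e"
    have "finite {e \<in> E. convex hull e \<inter> ball x 1 \<noteq> {}}"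
      by (rule drawing_locally_finite[OF E]) simp
    then have "finite {e \<in> A. convex hull e \<inter> ball x 1 \<noteq> {}}"
      by (rule rev_finite_subset) (use A in auto)
    then have "closed ?C"
      using compact_edge[OF E] A by (intro closed_UN) (auto intro: compact_imp_closed)
    then have "open (ball x 1 - ?C)" by (intro open_Diff) auto
    then show "\<exists>T. open T \<and> x \<in> T \<and> T \<subseteq> - ?X"
      using x by (intro exI[of _ "ball x 1 - ?C"]) auto
  qed
  then show ?thesis by (simp add: closed_def)
qed

lemma closed_drawn: "drawing E \<Longrightarrow> closed (drawn E)"
  unfolding drawn_def by (rule drawing_closed_subdrawing) auto

lemma vertex_on_edge:
  assumes E: "drawing E" and p: "p \<in> \<Union>E" "e \<in> E" "p \<in> convex hull e"
  shows "p \<in> e"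
proof -
  obtain e' where e': "e' \<in> E" "p \<in> e'" using p by auto
  show ?thesis
  proof (cases "e = e'")
    case False
    then have "p \<in> convex hull e \<inter> convex hull e'" using p e' by (auto intro: hull_inc)
    then show ?thesis using drawing_hull_Int[OF E p(2) e'(1) False] by auto
  qed (use e' in simp)
qed

lemma finite_vertices_bounded:
  assumes E: "drawing E" and B: "bounded B"
  shows "finite (\<Union>E \<inter> B)"
proof (rule finite_subset)
  show "\<Union>E \<inter> B \<subseteq> \<Union>{e \<in> E. convex hull e \<inter> B \<noteq> {}}" by (auto intro: hull_inc)
  show "finite (\<Union>{e \<in> E. convex hull e \<inter> B \<noteq> {}})"
    using drawing_locally_finite[OF E B] finite_edge[OF E] by (intro finite_Union) auto
qed

lemma face_props:
  assumes "f \<in> faces E"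
  shows face_connected: "connected f" and face_nonempty: "f \<noteq> {}" and face_disjoint_drawn: "f \<inter> drawn E = {}"
  using assms in_components_connected in_components_nonempty in_components_subset
  unfolding faces_eq_components by blast+

lemma open_face: "drawing E \<Longrightarrow> f \<in> faces E \<Longrightarrow> open f"
  unfolding faces_eq_components by (metis closed_drawn open_Compl open_components)

lemma faces_meet_eq: "\<lbrakk>f \<in> faces E; f' \<in> faces E; f \<inter> f' \<noteq> {}\<rbrakk> \<Longrightarrow> f = f'"
  unfolding faces_eq_components by (metis components_eq)

lemma connected_in_face:
  assumes "connected S" "S \<noteq> {}" "S \<inter> drawn E = {}"
  obtains f where "f \<in> faces E" "S \<subseteq> f"
  using exists_component_superset[of S "- drawn E"] assms unfolding faces_eq_components by blast

lemma face_at_closure_point: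
  assumes "drawing E" "f \<in> faces E" "f' \<in> faces E" "x \<in> f" "x \<in> closure f'"
  shows "f' = f"
  using assms open_face open_Int_closure_eq_empty[of f f'] faces_meet_eq by fastforce

definition left_side :: "complex \<Rightarrow> complex \<Rightarrow> complex set" where
  "left_side u v = {z. Im ((z - u) / (v - u)) > 0}"

lemma Im_swap:
  assumes "u \<noteq> v"
  shows "Im ((z - v) / (u - v)) = - Im ((z - u) / (v - u))"
proof -
  have "(z - v) / (u - v) = 1 - (z - u) / (v - u)"
    using assms by (simp add: divide_simps) (simp add: algebra_simps)
  then show ?thesis by simp
qed

lemma convex_left_side: "convex (left_side u v)"
proof -
  have "linear (\<lambda>z. Im (z / (v - u)))"
    by (intro bounded_linear.linear bounded_linear_compose[OF bounded_linear_Im bounded_linear_divide])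
  then have "convex ((\<lambda>z. Im (z / (v - u))) -` {Im (u / (v - u))<..})"
    by (rule convex_linear_vimage) simp
  also have "(\<lambda>z. Im (z / (v - u))) -` {Im (u / (v - u))<..} = left_side u v"
    by (auto simp: left_side_def diff_divide_distrib)
  finally show ?thesis .
qed

lemma Im_on_segment: "z \<in> closed_segment u v \<Longrightarrow> Im ((z - u) / (v - u)) = 0"
proof (cases "u = v")
  case False
  assume "z \<in> closed_segment u v"
  then obtain t where "z = (1 - t) *\<^sub>R u + t *\<^sub>R v" by (auto simp: in_segment)
  then have "z - u = of_real t * (v - u)" by (simp add: scaleR_conv_of_real algebra_simps)
  then show ?thesis using False by simp
qed simp

lemma left_side_near:
  assumes "u \<noteq> v" "Im ((m - u) / (v - u)) = 0" "\<rho> > 0"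
  obtains s where "s > 0" "m + of_real s * \<i> * (v - u) \<in> ball m \<rho> \<inter> left_side u v"
    "m - of_real s * \<i> * (v - u) \<in> ball m \<rho> \<inter> left_side v u"
proof
  let ?s = "\<rho> / (2 * norm (v - u))"
  show s: "?s > 0" using assms by simp
  have "norm (of_real ?s * \<i> * (v - u)) = ?s * norm (v - u)"
    unfolding norm_mult norm_of_real using less_imp_le[OF s] by (simp only: abs_of_nonneg norm_ii mult_1_right)
  also have "\<dots> = \<rho> / 2" using assms(1) by simp
  finally have n: "norm (of_real ?s * \<i> * (v - u)) < \<rho>" using assms(3) by simp
  have eq: "(m + w * (v - u) - u) / (v - u) = (m - u) / (v - u) + w" for w
    using assms(1) by (simp add: field_simps)
  have "Im ((m + of_real ?s * \<i> * (v - u) - u) / (v - u)) = ?s"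
    unfolding eq using assms(2) by (simp only: plus_complex.sel) simp
  then show "m + of_real ?s * \<i> * (v - u) \<in> ball m \<rho> \<inter> left_side u v"
    using n \<open>?s > 0\<close> by (simp add: left_side_def dist_norm)
  have "Im ((m - of_real ?s * \<i> * (v - u) - u) / (v - u)) = - ?s"
    using assms(2) eq[of "- (of_real ?s * \<i>)"] by (simp only: mult_minus_left add_uminus_conv_diff minus_complex.sel) simp
  then show "m - of_real ?s * \<i> * (v - u) \<in> ball m \<rho> \<inter> left_side v u"
    using n \<open>?s > 0\<close> Im_swap[OF assms(1)] by (simp add: left_side_def dist_norm)
qed

lemma open_meets_a_side:
  assumes S: "open S" "x \<in> S" and uv: "u \<noteq> v"
  shows "\<exists>y\<in>S. y \<in> left_side u v \<or> y \<in> left_side v u"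
proof (cases "Im ((x - u) / (v - u)) = 0")
  case True
  obtain \<rho> where \<rho>: "\<rho> > 0" "ball x \<rho> \<subseteq> S" using openE[OF S] by blast
  then show ?thesis using left_side_near[OF uv True \<rho>(1)] by blast
next
  case False
  then show ?thesis using S(2) Im_swap[OF uv, of x] by (auto simp: left_side_def intro!: bexI[of _ x])
qed

lemma edge_isolated_from_others:
  assumes E: "drawing E" "{u, v} \<in> E" and S: "compact S" "S \<subseteq> open_segment u v"
  obtains \<rho> where "\<rho> > 0" "\<And>m. m \<in> S \<Longrightarrow> ball m \<rho> \<inter> drawn E \<subseteq> closed_segment u v"
proof -
  let ?X = "\<Union>e\<in>E - {{u, v}}. convex hull e"
  have cl: "closed ?X" by (rule drawing_closed_subdrawing[OF E(1)]) auto
  have "S \<inter> ?X = {}"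
  proof (rule ccontr)
    assume "S \<inter> ?X \<noteq> {}"
    then obtain m e where m: "m \<in> S" "e \<in> E" "e \<noteq> {u, v}" "m \<in> convex hull e" by auto
    then have "m \<in> convex hull e \<inter> convex hull {u, v}"
      using S(2) by (auto simp: open_segment_def segment_convex_hull)
    then have "m \<in> {u, v}" using drawing_hull_Int[OF E(1) m(2) E(2) m(3)] by auto
    then show False using m(1) S(2) by (auto simp: open_segment_def)
  qed
  then obtain d where d: "d > 0" "\<forall>x\<in>S. \<forall>y\<in>?X. d \<le> dist x y"
    using separate_compact_closed[OF S(1) cl] by blast
  show thesis
  proof (rule that[OF d(1)])
    show "ball m d \<inter> drawn E \<subseteq> closed_segment u v" if "m \<in> S" for m
    proof
      fix z assume z: "z \<in> ball m d \<inter> drawn E"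
      then have "z \<notin> ?X" using d(2) that by force
      then show "z \<in> closed_segment u v" using z unfolding drawn_def segment_convex_hull by auto
    qed
  qed
qed

text \<open>
  The part of a thin tube around a segment which lies on one side of it is convex, so it stays within
  a single face.
\<close>

lemma one_sided_face_exists:
  assumes E: "drawing E" "{u, v} \<in> E" and uv: "u \<noteq> v"
  shows "\<exists>l\<in>faces E. \<forall>m\<in>open_segment u v. \<exists>\<rho>>0. ball m \<rho> \<inter> left_side u v \<subseteq> l"
proof -
  define m0 where "m0 = midpoint u v"
  have m0: "m0 \<in> open_segment u v" using uv by (simp add: m0_def)
  have line: "Im ((m - u) / (v - u)) = 0" if "m \<in> open_segment u v" for m
    using that by (intro Im_on_segment) (auto simp: open_segment_def)
  have tube: "\<exists>\<rho>>0. \<exists>f\<in>faces E. (ball m \<rho> \<union> ball m0 \<rho>) \<inter> left_side u v \<subseteq> f"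
    if m: "m \<in> open_segment u v" for m
  proof -
    have "closed_segment m0 m \<subseteq> open_segment u v"
      using closed_segment_subset[OF m0 m] by simp
    then obtain \<rho> where \<rho>: "\<rho> > 0" "\<And>x. x \<in> closed_segment m0 m \<Longrightarrow> ball x \<rho> \<inter> drawn E \<subseteq> closed_segment u v"
      using edge_isolated_from_others[OF E compact_segment] by metis
    define N where "N = (\<Union>x\<in>closed_segment m0 m. \<Union>y\<in>ball 0 \<rho>. {x + y}) \<inter> left_side u v"
    have conv: "convex N"
      unfolding N_def by (intro convex_Int convex_sums convex_left_side) auto
    have balls: "ball x \<rho> \<inter> left_side u v \<subseteq> N" if "x \<in> closed_segment m0 m" for x
    proof
      fix z assume z: "z \<in> ball x \<rho> \<inter> left_side u v"
      then have "z - x \<in> ball 0 \<rho>" "z = x + (z - x)" by (auto simp: dist_norm norm_minus_commute)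
      then show "z \<in> N" using that z unfolding N_def by blast
    qed
    obtain s where "m + of_real s * \<i> * (v - u) \<in> ball m \<rho> \<inter> left_side u v"
      using left_side_near[OF uv line[OF m] \<rho>(1)] by metis
    then have "N \<noteq> {}" using balls[OF ends_in_segment(2)] by blast
    moreover have "N \<inter> drawn E = {}"
    proof (rule ccontr)
      assume "N \<inter> drawn E \<noteq> {}"
      then obtain x y where xy: "x \<in> closed_segment m0 m" "y \<in> ball 0 \<rho>" "x + y \<in> left_side u v" "x + y \<in> drawn E"
        unfolding N_def by auto
      then have "x + y \<in> closed_segment u v" using \<rho>(2)[OF xy(1)] by (auto simp: dist_norm)
      then show False using xy(3) Im_on_segment by (auto simp: left_side_def)
    qed
    ultimately obtain f where "f \<in> faces E" "N \<subseteq> f"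
      by (rule connected_in_face[OF convex_connected[OF conv]])
    moreover have "(ball m \<rho> \<union> ball m0 \<rho>) \<inter> left_side u v \<subseteq> N"
      using balls[OF ends_in_segment(1)] balls[OF ends_in_segment(2)] by blast
    ultimately show ?thesis using \<rho>(1) by blast
  qed
  obtain \<rho>0 l where l: "\<rho>0 > 0" "l \<in> faces E" "ball m0 \<rho>0 \<inter> left_side u v \<subseteq> l"
    using tube[OF m0] by auto
  have "\<exists>\<rho>>0. ball m \<rho> \<inter> left_side u v \<subseteq> l" if m: "m \<in> open_segment u v" for m
  proof -
    obtain \<rho> f where f: "\<rho> > 0" "f \<in> faces E" "(ball m \<rho> \<union> ball m0 \<rho>) \<inter> left_side u v \<subseteq> f"
      using tube[OF m] by blast
    obtain s where "m0 + of_real s * \<i> * (v - u) \<in> ball m0 (min \<rho>0 \<rho>) \<inter> left_side u v"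
      using left_side_near[OF uv line[OF m0], of "min \<rho>0 \<rho>"] l(1) f(1) by auto
    then have "m0 + of_real s * \<i> * (v - u) \<in> l \<inter> f" using l(3) f(3) by auto
    then have "l = f" using faces_meet_eq[OF l(2) f(2)] by blast
    then show ?thesis using f by blast
  qed
  then show ?thesis using l(2) by blast
qed

text \<open>
  The faces \<open>l\<close> on the left and \<open>r\<close> on the right of the segment from \<open>u\<close> to \<open>v\<close>. They are the same at all
  its inner points, which turns local statements about a point of an edge into ones about the edge.
\<close>

definition faces_at_sides :: "complex set set \<Rightarrow> complex \<Rightarrow> complex \<Rightarrow> complex set \<Rightarrow> complex set \<Rightarrow> bool" where
  "faces_at_sides E u v l r \<longleftrightarrow> l \<in> faces E \<and> r \<in> faces E \<and>
     (\<forall>m\<in>open_segment u v. \<exists>\<rho>>0. ball m \<rho> \<inter> left_side u v \<subseteq> l \<and> ball m \<rho> \<inter> left_side v u \<subseteq> r)"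

lemma faces_at_sides_exist:
  assumes E: "drawing E" "{u, v} \<in> E" and uv: "u \<noteq> v"
  obtains l r where "faces_at_sides E u v l r"
proof -
  obtain l where l: "l \<in> faces E" "\<And>m. m \<in> open_segment u v \<Longrightarrow> \<exists>\<rho>>0. ball m \<rho> \<inter> left_side u v \<subseteq> l"
    using one_sided_face_exists[OF assms] by blast
  have "{v, u} \<in> E" using E(2) by (simp add: insert_commute)
  then obtain r where r: "r \<in> faces E" "\<And>m. m \<in> open_segment v u \<Longrightarrow> \<exists>\<rho>>0. ball m \<rho> \<inter> left_side v u \<subseteq> r"
    using one_sided_face_exists[OF E(1) _ uv[symmetric]] by blast
  have "\<exists>\<rho>>0. ball m \<rho> \<inter> left_side u v \<subseteq> l \<and> ball m \<rho> \<inter> left_side v u \<subseteq> r"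
    if m: "m \<in> open_segment u v" for m
  proof -
    obtain \<rho> \<rho>' where "\<rho> > 0" "ball m \<rho> \<inter> left_side u v \<subseteq> l" "\<rho>' > 0" "ball m \<rho>' \<inter> left_side v u \<subseteq> r"
      using l(2)[OF m] r(2)[of m] m by (metis open_segment_commute)
    then show ?thesis by (intro exI[of _ "min \<rho> \<rho>'"]) auto
  qed
  then show ?thesis using that l(1) r(1) unfolding faces_at_sides_def by blast
qed

lemma faces_at_sides_swap: "faces_at_sides E u v l r \<Longrightarrow> faces_at_sides E v u r l"
  unfolding faces_at_sides_def by (metis open_segment_commute)

lemma at_most_two_faces_near_edge_point:
  assumes E: "drawing E" and uv: "u \<noteq> v" and lr: "faces_at_sides E u v l r" and m: "m \<in> open_segment u v"
  obtains \<rho> where "\<rho> > 0" "\<And>f. f \<in> faces E \<Longrightarrow> f \<inter> ball m \<rho> \<noteq> {} \<Longrightarrow> f = l \<or> f = r"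
proof -
  obtain \<rho> where \<rho>: "\<rho> > 0" "ball m \<rho> \<inter> left_side u v \<subseteq> l" "ball m \<rho> \<inter> left_side v u \<subseteq> r"
    using lr m unfolding faces_at_sides_def by blast
  have "f = l \<or> f = r" if f: "f \<in> faces E" "f \<inter> ball m \<rho> \<noteq> {}" for f
  proof -
    have "open (f \<inter> ball m \<rho>)" using open_face[OF E f(1)] by auto
    then obtain y where "y \<in> f \<inter> ball m \<rho>" "y \<in> left_side u v \<or> y \<in> left_side v u"
      using open_meets_a_side[OF _ _ uv] f(2) by blast
    then have "f \<inter> l \<noteq> {} \<or> f \<inter> r \<noteq> {}" using \<rho> by blast
    then show ?thesis using lr f(1) faces_meet_eq unfolding faces_at_sides_def by blast
  qed
  then show ?thesis using that \<rho>(1) by blast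
qed

lemma face_at_edge_point:
  assumes "drawing E" "u \<noteq> v" "faces_at_sides E u v l r" "m \<in> open_segment u v"
    and f: "f \<in> faces E" "m \<in> closure f"
  shows "f = l \<or> f = r"
proof -
  obtain \<rho> where \<rho>: "\<rho> > 0" "\<And>f. f \<in> faces E \<Longrightarrow> f \<inter> ball m \<rho> \<noteq> {} \<Longrightarrow> f = l \<or> f = r"
    using at_most_two_faces_near_edge_point[OF assms(1-4)] by metis
  have "f \<inter> ball m \<rho> \<noteq> {}"
    using f(2) \<rho>(1) open_Int_closure_eq_empty[of "ball m \<rho>" f] centre_in_ball[of m \<rho>] by blast
  then show ?thesis using \<rho>(2) f(1) by blast
qed

lemma edge_subset_closure_left_face:
  assumes uv: "u \<noteq> v" and lr: "faces_at_sides E u v l r"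
  shows "convex hull {u, v} \<subseteq> closure l"
proof -
  have "m \<in> closure l" if m: "m \<in> open_segment u v" for m
    unfolding closure_approachable
  proof (intro allI impI)
    fix e :: real assume "e > 0"
    obtain \<rho> where \<rho>: "\<rho> > 0" "ball m \<rho> \<inter> left_side u v \<subseteq> l"
      using lr m unfolding faces_at_sides_def by blast
    have "Im ((m - u) / (v - u)) = 0" using m by (intro Im_on_segment) (auto simp: open_segment_def)
    then obtain s where "m + of_real s * \<i> * (v - u) \<in> ball m (min \<rho> e) \<inter> left_side u v"
      using left_side_near[OF uv, of m "min \<rho> e"] \<rho>(1) \<open>e > 0\<close> by auto
    then show "\<exists>y\<in>l. dist y m < e" using \<rho>(2)
      by (intro bexI[of _ "m + of_real s * \<i> * (v - u)"]) (auto simp: dist_commute)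
  qed
  then have "closure (open_segment u v) \<subseteq> closure l" by (intro closure_minimal) auto
  then show ?thesis using uv by (simp add: segment_convex_hull)
qed

lemma edge_subset_closure_sides:
  assumes "u \<noteq> v" "faces_at_sides E u v l r"
  shows "convex hull {u, v} \<subseteq> closure l" "convex hull {u, v} \<subseteq> closure r"
  using edge_subset_closure_left_face[OF assms]
    edge_subset_closure_left_face[OF assms(1)[symmetric] faces_at_sides_swap[OF assms(2)]]
  by (simp_all add: insert_commute)

lemma no_convex_set_on_both_sides:
  assumes uv: "u \<noteq> v" "{u, v} \<in> E" and lr: "faces_at_sides E u v l r"
    and C: "convex C" "l \<subseteq> C" "r \<subseteq> C"
  shows "C \<inter> drawn E \<noteq> {}"
proof -
  define m where "m = midpoint u v"
  have m: "m \<in> open_segment u v" using uv by (simp add: m_def)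
  then obtain \<rho> where \<rho>: "\<rho> > 0" "ball m \<rho> \<inter> left_side u v \<subseteq> l" "ball m \<rho> \<inter> left_side v u \<subseteq> r"
    using lr unfolding faces_at_sides_def by blast
  have seg: "m \<in> closed_segment u v" using m by (auto simp: open_segment_def)
  obtain s where "m + of_real s * \<i> * (v - u) \<in> ball m \<rho> \<inter> left_side u v"
    "m - of_real s * \<i> * (v - u) \<in> ball m \<rho> \<inter> left_side v u"
    using left_side_near[OF uv(1) Im_on_segment[OF seg] \<rho>(1)] by metis
  then have "m + of_real s * \<i> * (v - u) \<in> C" "m - of_real s * \<i> * (v - u) \<in> C"
    using \<rho>(2,3) C(2,3) by blast+
  then have "midpoint (m + of_real s * \<i> * (v - u)) (m - of_real s * \<i> * (v - u)) \<in> C"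
    using closed_segment_subset[OF _ _ C(1)] midpoint_in_closed_segment by blast
  moreover have "midpoint (m + of_real s * \<i> * (v - u)) (m - of_real s * \<i> * (v - u)) = m"
    by (simp add: midpoint_def scaleR_conv_of_real)
  moreover have "m \<in> drawn E" using seg uv(2) unfolding drawn_def segment_convex_hull by blast
  ultimately show ?thesis by auto
qed

lemma faces_locally_finite_off_vertices:
  assumes E: "drawing E" and p: "p \<notin> \<Union>E"
  shows "\<exists>r>0. finite {f \<in> faces E. f \<inter> ball p r \<noteq> {}}"
proof (cases "p \<in> drawn E")
  case True
  then obtain e where e: "e \<in> E" "p \<in> convex hull e" by (auto simp: drawn_def)
  obtain u v where uv: "e = {u, v}" "u \<noteq> v" using drawing_edgeE[OF E e(1)] .
  have p': "p \<in> open_segment u v"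
    using e p uv by (auto simp: open_segment_def segment_convex_hull)
  obtain l r where lr: "faces_at_sides E u v l r"
    using faces_at_sides_exist[OF E _ uv(2)] e(1) uv(1) by blast
  obtain \<rho> where \<rho>: "\<rho> > 0" "\<And>f. f \<in> faces E \<Longrightarrow> f \<inter> ball p \<rho> \<noteq> {} \<Longrightarrow> f = l \<or> f = r"
    using at_most_two_faces_near_edge_point[OF E uv(2) lr p'] by metis
  have "{f \<in> faces E. f \<inter> ball p \<rho> \<noteq> {}} \<subseteq> {l, r}" using \<rho>(2) by auto
  then show ?thesis using \<rho>(1) finite_subset by (metis finite.emptyI finite.insertI)
next
  case False
  then obtain f where f: "f \<in> faces E" "{p} \<subseteq> f"
    using connected_in_face[of "{p}" E] by auto
  then obtain r where r: "r > 0" "ball p r \<subseteq> f"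
    using openE[OF open_face[OF E f(1)], of p] by auto
  have "{f \<in> faces E. f \<inter> ball p r \<noteq> {}} \<subseteq> {f}"
    using r(2) faces_meet_eq[OF _ f(1)] by blast
  then show ?thesis using r(1) finite_subset by (metis finite.emptyI finite.insertI)
qed

lemma faces_meeting_compact_finite:
  assumes S: "compact S" "\<And>p. p \<in> S \<Longrightarrow> \<exists>r>0. finite {f \<in> \<F>. f \<inter> ball p r \<noteq> {}}"
  shows "finite {f \<in> \<F>. f \<inter> S \<noteq> {}}"
proof -
  obtain r where r: "\<And>p. p \<in> S \<Longrightarrow> r p > (0::real)" "\<And>p. p \<in> S \<Longrightarrow> finite {f \<in> \<F>. f \<inter> ball p (r p) \<noteq> {}}"
    using S(2) by metis
  have "\<exists>C\<subseteq>S. finite C \<and> S \<subseteq> (\<Union>p\<in>C. ball p (r p))"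
    by (rule compactE_image[OF S(1), of S "\<lambda>p. ball p (r p)"]) (use r(1) in auto)
  then obtain C where C: "C \<subseteq> S" "finite C" "S \<subseteq> (\<Union>p\<in>C. ball p (r p))" by blast
  have "{f \<in> \<F>. f \<inter> S \<noteq> {}} \<subseteq> (\<Union>p\<in>C. {f \<in> \<F>. f \<inter> ball p (r p) \<noteq> {}})"
    using C(3) by blast
  moreover have "finite (\<Union>p\<in>C. {f \<in> \<F>. f \<inter> ball p (r p) \<noteq> {}})" using C r(2) by blast
  ultimately show ?thesis by (rule finite_subset)
qed

text \<open>
  The radial segment from \<open>z\<close> outwards to the circle avoids the drawing: if it met an edge, then this
  edge would contain \<open>p\<close>, and \<open>z\<close> by convexity.
\<close>

lemma face_reaches_circle:
  assumes E: "drawing E" and p: "p \<in> \<Union>E" and f: "f \<in> faces E" "z \<in> f" "dist p z < r"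
    and iso: "\<And>e. e \<in> E \<Longrightarrow> convex hull e \<inter> cball p r \<noteq> {} \<Longrightarrow> p \<in> e"
  shows "f \<inter> sphere p r \<noteq> {}"
proof -
  have "p \<in> drawn E" using p by (auto simp: drawn_def intro: hull_inc)
  then have zp: "z \<noteq> p" using face_disjoint_drawn[OF f(1)] f(2) by blast
  define c where "c = r / dist p z"
  have c: "c > 1" using zp f(3) by (simp add: c_def)
  define z' where "z' = p + c *\<^sub>R (z - p)"
  have "r > 0" using f(3) zero_le_dist[of p z] by linarith
  then have z': "dist p z' = r" using zp f(3) by (simp add: z'_def c_def dist_norm norm_minus_commute)
  have "closed_segment z z' \<inter> drawn E = {}"
  proof (rule ccontr)
    assume "closed_segment z z' \<inter> drawn E \<noteq> {}"
    then obtain y e where y: "y \<in> closed_segment z z'" "e \<in> E" "y \<in> convex hull e"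
      by (auto simp: drawn_def)
    obtain w where w: "0 \<le> w" "w \<le> 1" "y = (1 - w) *\<^sub>R z + w *\<^sub>R z'" using y(1) by (auto simp: in_segment)
    define s where "s = 1 - w + w * c"
    have ys: "y = p + s *\<^sub>R (z - p)" by (simp add: w(3) s_def z'_def algebra_simps)
    have s: "1 \<le> s" "s \<le> c"
    proof -
      have "s = 1 + w * (c - 1)" by (simp add: s_def algebra_simps)
      then show "1 \<le> s" using w c by simp
      have "w * (c - 1) \<le> 1 * (c - 1)" using w c by (intro mult_right_mono) auto
      then show "s \<le> c" using \<open>s = 1 + w * (c - 1)\<close> by simp
    qed
    have "dist p y = s * dist p z" using s by (simp add: ys dist_norm norm_minus_commute)
    also have "\<dots> \<le> c * dist p z" using s by (intro mult_right_mono) auto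
    also have "\<dots> = r" using zp by (simp add: c_def)
    finally have "y \<in> cball p r" by simp
    then have "convex hull e \<inter> cball p r \<noteq> {}" using y(3) by blast
    then have "p \<in> convex hull e" using iso[OF y(2)] by (simp add: hull_inc)
    then have "closed_segment p y \<subseteq> convex hull e"
      using y(3) by (intro closed_segment_subset) auto
    moreover have "z = (1 - 1 / s) *\<^sub>R p + (1 / s) *\<^sub>R y" using s(1) by (simp add: ys algebra_simps)
    then have "z \<in> closed_segment p y" using s(1) unfolding in_segment by (intro exI[of _ "1 / s"]) auto
    ultimately have "z \<in> convex hull e" by blast
    then show False using face_disjoint_drawn[OF f(1)] f(2) y(2) by (auto simp: drawn_def)
  qed
  then obtain f' where f': "f' \<in> faces E" "closed_segment z z' \<subseteq> f'"
    using connected_in_face[of "closed_segment z z'" E] by auto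
  then have "f' = f" using faces_meet_eq[OF f'(1) f(1)] f(2) by auto
  then have "z' \<in> f" using f'(2) by auto
  then show ?thesis using z' by auto
qed

text \<open>
  Near a vertex \<open>p\<close> the drawing is a cone, so every face near \<open>p\<close> reaches a small circle around \<open>p\<close>;
  this circle carries no vertex, and compactness finishes the count.
\<close>

lemma faces_locally_finite:
  assumes E: "drawing E"
  shows "\<exists>r>0. finite {f \<in> faces E. f \<inter> ball p r \<noteq> {}}"
proof (cases "p \<in> \<Union>E")
  case False
  then show ?thesis by (rule faces_locally_finite_off_vertices[OF E])
next
  case True
  let ?X = "\<Union>e\<in>{e \<in> E. p \<notin> e}. convex hull e"
  have "closed ?X" by (rule drawing_closed_subdrawing[OF E]) auto
  moreover have "p \<notin> ?X" using vertex_on_edge[OF E True] by auto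
  ultimately obtain d where d: "d > 0" "\<And>y. y \<in> ?X \<Longrightarrow> d \<le> dist p y"
    using separate_point_closed[of ?X p] by blast
  have "finite (\<Union>E \<inter> cball p 1)" by (rule finite_vertices_bounded[OF E]) simp
  then obtain d' where d': "d' > 0" "\<And>q. q \<in> \<Union>E \<inter> cball p 1 \<Longrightarrow> q \<noteq> p \<Longrightarrow> d' \<le> dist p q"
    using finite_set_avoid[of _ p] by metis
  define r where "r = min (d / 2) (min (d' / 2) (1 / 2))"
  have r: "r > 0" "r < d" "r < d'" "r < 1" using d(1) d'(1) by (auto simp: r_def)
  have iso: "p \<in> e" if "e \<in> E" "convex hull e \<inter> cball p r \<noteq> {}" for e
  proof (rule ccontr)
    assume "p \<notin> e"
    then have "convex hull e \<subseteq> ?X" using that(1) by blast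
    then show False using d(2) r(2) that(2) by fastforce
  qed
  have far: "dist p q > r" if "q \<in> \<Union>E" "q \<noteq> p" for q
  proof (cases "q \<in> cball p 1")
    case True
    then show ?thesis using d'(2)[of q] that r(3) by fastforce
  qed (use r(4) in auto)
  have "finite {f \<in> faces E. f \<inter> sphere p r \<noteq> {}}"
  proof (rule faces_meeting_compact_finite)
    fix x assume "x \<in> sphere p r"
    then have "x \<notin> \<Union>E" using far[of x] r(1) by fastforce
    then show "\<exists>r>0. finite {f \<in> faces E. f \<inter> ball x r \<noteq> {}}"
      by (rule faces_locally_finite_off_vertices[OF E])
  qed simp
  moreover have "{f \<in> faces E. f \<inter> ball p r \<noteq> {}} \<subseteq> {f \<in> faces E. f \<inter> sphere p r \<noteq> {}}"
    using face_reaches_circle[OF E True _ _ _ iso] by fastforce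
  ultimately have "finite {f \<in> faces E. f \<inter> ball p r \<noteq> {}}" by (rule rev_finite_subset)
  then show ?thesis using r(1) by blast
qed

lemma finite_faces_meeting_bounded:
  assumes E: "drawing E" and B: "bounded B"
  shows "finite {f \<in> faces E. f \<inter> B \<noteq> {}}"
proof -
  have "finite {f \<in> faces E. f \<inter> closure B \<noteq> {}}"
    using B faces_locally_finite[OF E] by (intro faces_meeting_compact_finite) auto
  then show ?thesis by (rule rev_finite_subset) (use closure_subset in auto)
qed

lemma open_not_subset_drawn:
  assumes E: "drawing E" and S: "open S" "S \<noteq> {}"
  shows "\<exists>x\<in>S. x \<notin> drawn E"
proof (rule ccontr)
  assume sub: "\<not> (\<exists>x\<in>S. x \<notin> drawn E)"
  obtain x where x: "x \<in> S" using S by auto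
  let ?A = "{e \<in> E. convex hull e \<inter> ball x 1 \<noteq> {}}"
  have fin: "finite ?A" by (rule drawing_locally_finite[OF E]) simp
  have int: "interior (\<Union>e\<in>A. convex hull e) = {}" if "finite A" "A \<subseteq> E" for A
    using that
  proof induction
    case (insert e A)
    obtain u v where uv: "e = {u, v}" using drawing_edgeE[OF E, of e] insert.prems insertI1 by (metis subset_eq)
    have "interior (convex hull e) = {}"
      unfolding uv by (rule empty_interior_convex_hull) (auto simp: card_insert_if)
    moreover have "closed (\<Union>e\<in>A. convex hull e)"
      using insert by (intro drawing_closed_subdrawing[OF E]) auto
    ultimately show ?case
      using insert interior_closed_Un_empty_interior[of "\<Union>e\<in>A. convex hull e" "convex hull e"]
      by (simp add: Un_commute)
  qed simp
  have "S \<inter> ball x 1 \<subseteq> (\<Union>e\<in>?A. convex hull e)" using sub by (fastforce simp: drawn_def)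
  then have "S \<inter> ball x 1 \<subseteq> interior (\<Union>e\<in>?A. convex hull e)"
    using S(1) by (intro interior_maximal) auto
  then show False using int[OF fin] x by auto
qed

section \<open>The piecewise constant form of a t-holomorphic function\<close>

lemma infinite_frontier_of_bounded_open:
  fixes S :: "complex set"
  assumes "open S" "S \<noteq> {}" "bounded S"
  shows "infinite (frontier S)"
proof
  assume "finite (frontier S)"
  then have "connected (- frontier S)"
    by (intro path_connected_imp_connected path_connected_complement_countable countable_finite) auto
  moreover have "- frontier S = S \<union> - closure S" "S \<inter> - closure S = {}"
    using assms(1) closure_subset by (auto simp: frontier_def interior_open)
  ultimately have "S \<inter> - frontier S = {} \<or> - closure S \<inter> - frontier S = {}"
    using assms(1) by (intro connectedD) auto
  then have "closure S = UNIV" using assms(2) \<open>- frontier S = S \<union> - closure S\<close> by auto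
  then have "bounded (UNIV :: complex set)"
    using bounded_closure[OF assms(3)] by simp
  then show False by simp
qed

lemma ball_subset_ball_shift:
  fixes x u :: "'a::metric_space"
  assumes "dist x u < d"
  shows "ball u (r - d) \<subseteq> ball x r"
proof
  fix y assume "y \<in> ball u (r - d)"
  then show "y \<in> ball x r" using assms dist_triangle[of x y u] by simp
qed

lemma edge_subset_closures:
  assumes "u \<noteq> v" "faces_at_sides E u v l r \<or> faces_at_sides E v u l r"
  shows "convex hull {u, v} \<subseteq> closure l" "convex hull {u, v} \<subseteq> closure r"
proof -
  have "faces_at_sides E u v l r \<or> faces_at_sides E u v r l" using assms(2) faces_at_sides_swap by blast
  then show "convex hull {u, v} \<subseteq> closure l" "convex hull {u, v} \<subseteq> closure r"
    using edge_subset_closure_sides[OF assms(1)] by blast+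
qed

lemma closed_segment_eq_open: "closed_segment u v = open_segment u v \<union> {u, v}" for u v :: complex
  by (auto simp: open_segment_def)

text \<open>
  The link between t-holomorphicity and closed forms: where \<open>dg = \<eta>\<^sup>2 dz\<close>, the form \<open>a dz + cnj a dg\<close> is
  \<open>2 * Pr a \<eta> dz\<close>.
\<close>

lemma increment_eq_of_Pr_eq:
  assumes "Pr a \<eta> = Pr b \<eta>" "\<Delta> = \<eta>\<^sup>2 * \<zeta>"
  shows "a * \<zeta> + cnj a * \<Delta> = b * \<zeta> + cnj b * \<Delta>"
proof -
  have "a * \<zeta> + cnj a * \<Delta> = 2 * Pr a \<eta> * \<zeta>" "b * \<zeta> + cnj b * \<Delta> = 2 * Pr b \<eta> * \<zeta>"
    by (simp_all add: Pr_def assms(2) algebra_simps)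
  with assms(1) show ?thesis by simp
qed

text \<open>
  By convexity the closures share the segment from \<open>x\<close> to \<open>y\<close>, and all but finitely many points of it are
  not vertices. Around such a point \<open>m\<close> the drawing consists of one edge: this edge has the direction of
  the segment, and only the faces at its two sides come near \<open>m\<close>.
\<close>

lemma touching_faces_share_edge:
  assumes E: "drawing E" and st: "s \<in> faces E" "t \<in> faces E" "s \<noteq> t"
    and cv: "convex (closure s)" "convex (closure t)"
    and x: "x \<in> closure s \<inter> closure t" and y: "y \<in> closure s \<inter> closure t" and xy: "x \<noteq> y"
  obtains u v m c where "{u, v} \<in> E" "u \<noteq> v" "m \<in> open_segment u v" "m \<in> closure s \<inter> closure t"
    "faces_at_sides E u v s t" "y - x = of_real c * (v - u)"
proof -
  have seg: "closed_segment x y \<subseteq> closure s \<inter> closure t"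
    using closed_segment_subset[OF x y convex_Int[OF cv]] .
  have drawn: "z \<in> drawn E" if "z \<in> closure s \<inter> closure t" for z
  proof (rule ccontr)
    assume "z \<notin> drawn E"
    then obtain f where "f \<in> faces E" "{z} \<subseteq> f" using connected_in_face[of "{z}" E] by auto
    then show False using face_at_closure_point[OF E, of f s z] face_at_closure_point[OF E, of f t z] st that by auto
  qed
  have "finite (\<Union>E \<inter> closed_segment x y)" by (rule finite_vertices_bounded[OF E bounded_closed_segment])
  moreover have "infinite (open_segment x y)" using uncountable_open_segment[OF xy] by (rule uncountable_infinite)
  ultimately have "infinite (open_segment x y - \<Union>E \<inter> closed_segment x y)" by (rule Diff_infinite_finite)
  then obtain m where m: "m \<in> open_segment x y" "m \<notin> \<Union>E"
    by (metis DiffE IntI all_not_in_conv finite.emptyI open_closed_segment)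
  have mc: "m \<in> closure s \<inter> closure t" using m(1) seg by (auto simp: open_segment_def)
  then obtain e where e: "e \<in> E" "m \<in> convex hull e" using drawn by (auto simp: drawn_def)
  obtain u v where uv: "e = {u, v}" "u \<noteq> v" using drawing_edgeE[OF E e(1)] .
  have uvE: "{u, v} \<in> E" using e(1) uv(1) by simp
  have mo: "m \<in> open_segment u v" using e m(2) uv by (auto simp: open_segment_def segment_convex_hull)
  obtain \<rho> where \<rho>: "\<rho> > 0" "ball m \<rho> \<inter> drawn E \<subseteq> closed_segment u v"
    using edge_isolated_from_others[OF E uvE, of "{m}"] mo by auto
  obtain w where w: "0 < w" "w < 1" "m = (1 - w) *\<^sub>R x + w *\<^sub>R y"
    using m(1) by (auto simp: in_segment)
  \<comment> \<open>A second point of the segment, so close to \<open>m\<close> that it lies on the same edge, gives the direction.\<close>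
  define \<tau> where "\<tau> = min (1 - w) (\<rho> / (2 * norm (y - x)))"
  have \<tau>: "\<tau> > 0" "\<tau> \<le> 1 - w" using w \<rho>(1) xy by (auto simp: \<tau>_def)
  have "\<tau> * norm (y - x) \<le> \<rho> / (2 * norm (y - x)) * norm (y - x)"
    by (intro mult_right_mono) (auto simp: \<tau>_def)
  also have "\<dots> < \<rho>" using xy \<rho>(1) by simp
  finally have \<tau>\<rho>: "\<tau> * norm (y - x) < \<rho>" .
  define m' where "m' = m + \<tau> *\<^sub>R (y - x)"
  have "m' = (1 - (w + \<tau>)) *\<^sub>R x + (w + \<tau>) *\<^sub>R y" by (simp add: m'_def w(3) algebra_simps)
  then have "m' \<in> closed_segment x y" using w \<tau> unfolding in_segment by (intro exI[of _ "w + \<tau>"]) auto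
  then have "m' \<in> drawn E" using seg drawn by blast
  moreover have "m' \<in> ball m \<rho>" using \<tau>\<rho> \<tau>(1) by (simp add: m'_def dist_norm)
  ultimately have "m' \<in> closed_segment u v" using \<rho>(2) by blast
  then obtain a b where ab: "m = (1 - a) *\<^sub>R u + a *\<^sub>R v" "m' = (1 - b) *\<^sub>R u + b *\<^sub>R v"
    using mo by (auto simp: in_segment)
  have "m' - m = (b - a) *\<^sub>R (v - u)" unfolding ab by (simp add: algebra_simps)
  then have "\<tau> *\<^sub>R (y - x) = (b - a) *\<^sub>R (v - u)" by (simp add: m'_def)
  then have "(1 / \<tau>) *\<^sub>R \<tau> *\<^sub>R (y - x) = (1 / \<tau>) *\<^sub>R (b - a) *\<^sub>R (v - u)" by simp
  then have c: "y - x = of_real ((b - a) / \<tau>) * (v - u)" using \<tau>(1) by (simp add: scaleR_conv_of_real)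
  obtain l r where lr: "faces_at_sides E u v l r" using faces_at_sides_exist[OF E uvE uv(2)] .
  have "s = l \<or> s = r" "t = l \<or> t = r"
    using face_at_edge_point[OF E uv(2) lr mo] st mc by auto
  then consider "s = l" "t = r" | "s = r" "t = l" using st(3) by auto
  then show thesis
  proof cases
    case 1
    then show ?thesis using that[OF uvE uv(2) mo mc _ c] lr by simp
  next
    case 2
    have "of_real k * (v - u) = of_real (- k) * (u - v)" for k by (simp add: algebra_simps)
    with c have "y - x = of_real (- ((b - a) / \<tau>)) * (u - v)" by (rule trans)
    then show ?thesis
      using that[of v u m] uvE uv(2) mo mc faces_at_sides_swap[OF lr] 2
      by (metis insert_commute open_segment_commute)
  qed
qed

text \<open>
  On the line of an edge with direction \<open>d\<close>, the form \<open>cnj \<xi>\<^sup>2 d(cnj z)\<close> of the face on one side and the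
  form \<open>\<eta>\<^sup>2 dz\<close> of the face, or diagonal, on the other side coincide.
\<close>

lemma sqrt_forms_agree_on_edge:
  assumes "norm \<eta> = 1" "cnj \<eta> * cnj \<xi> \<in> {sgn d, - sgn d}" "\<zeta> = of_real c * d"
  shows "(cnj \<xi>)\<^sup>2 * cnj \<zeta> = \<eta>\<^sup>2 * \<zeta>"
proof -
  have 1: "\<eta> * cnj \<eta> = 1" using assms(1) complex_norm_square[of \<eta>] by simp
  have "(cnj \<eta> * cnj \<xi>)\<^sup>2 = (sgn d)\<^sup>2" using assms(2) by auto
  then have "(\<eta> * cnj \<eta>)\<^sup>2 * (cnj \<xi>)\<^sup>2 = \<eta>\<^sup>2 * (sgn d)\<^sup>2" by (simp add: power_mult_distrib mult_ac)
  then have 2: "(cnj \<xi>)\<^sup>2 = \<eta>\<^sup>2 * (sgn d)\<^sup>2" using 1 by simp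
  have "(sgn d)\<^sup>2 * cnj d = d"
  proof (cases "d = 0")
    case False
    have "d * cnj d = of_real ((norm d)\<^sup>2)" by (simp add: complex_norm_square[symmetric])
    then have "(sgn d)\<^sup>2 * cnj d = d * of_real ((norm d)\<^sup>2) / of_real ((norm d)\<^sup>2)"
      by (simp add: sgn_eq power2_eq_square mult_ac)
    then show ?thesis using False by simp
  qed simp
  then show ?thesis by (simp add: 2 assms(3) mult_ac)
qed

text \<open>
  Both colourings of the statement at once: \<open>Q\<close> is the colour whose faces are split and which
  carries the complex values, and \<open>dg\<close> is \<open>\<eta>\<^sup>2 dz\<close> on the other colour \<open>P\<close>. For white \<open>Q\<close> the map
  \<open>g\<close> is the conjugate of the origami map, for black \<open>Q\<close> it is the origami map.
\<close>

locale t_holomorphic_setup =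
  fixes G :: tgraph and U :: "complex set" and P Q D :: "complex set set"
    and \<eta> :: "complex set \<Rightarrow> complex" and g :: "complex \<Rightarrow> complex"
    and F Fc :: "complex set \<Rightarrow> complex" and \<kappa> \<delta> :: real
  assumes drawing_edges: "drawing (edges G)"
    and colours: "P \<union> Q \<subseteq> faces (edges G)" "P \<inter> Q = {}"
    and face_shape: "\<And>f. f \<in> P \<union> Q \<Longrightarrow> convex f" "\<And>f. f \<in> P \<union> Q \<Longrightarrow> bounded f"
    and coloured: "\<And>f f' e. \<lbrakk>f \<in> P \<union> Q; f' \<in> P \<union> Q; e \<in> edges G; f \<noteq> f';
        convex hull e \<subseteq> closure f \<inter> closure f'\<rbrakk> \<Longrightarrow> f \<in> P \<longleftrightarrow> f' \<in> Q"
    and U_covered: "U \<subseteq> (\<Union>f\<in>P \<union> Q. closure f)"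
    and split: "splitting G Q D"
    and unit: "\<And>f. f \<in> P \<union> Q \<Longrightarrow> norm (\<eta> f) = 1"
    and diagonals: "sqrt_on_diagonals Q D \<eta>"
    and g_on_P: "\<And>p x y. \<lbrakk>p \<in> P; x \<in> closure p; y \<in> closure p\<rbrakk> \<Longrightarrow> g y - g x = (\<eta> p)\<^sup>2 * (y - x)"
    and g_on_Q: "\<And>q x y. \<lbrakk>q \<in> Q; x \<in> closure q; y \<in> closure q\<rbrakk> \<Longrightarrow> g y - g x = (cnj (\<eta> q))\<^sup>2 * cnj (y - x)"
    and cvalues: "complex_values G U \<eta> P Q D F Fc"
    and lip: "Lip \<kappa> \<delta> U g" "\<kappa> < 1" "\<delta> > 0"
begin

abbreviation "E \<equiv> edges G"
abbreviation "E' \<equiv> edges G \<union> D"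
abbreviation "Tri \<equiv> triangles G U P Q D"

lemma face: "f \<in> P \<union> Q \<Longrightarrow> f \<in> faces E"
  using colours(1) by blast

lemma diagonalE:
  assumes "d \<in> D"
  obtains u v q where "d = {u, v}" "u \<noteq> v" "u \<in> \<Union>E" "v \<in> \<Union>E" "q \<in> Q" "open_segment u v \<subseteq> q"
  using split assms unfolding splitting_def by metis

text \<open>
  The diagonals are locally finite because only finitely many faces meet a bounded set, and each of
  them, being bounded, has finitely many vertices.
\<close>

lemma drawing_split: "drawing E'"
proof -
  have E: "drawing E" by (rule drawing_edges)
  have meet: "convex hull d \<inter> convex hull e = d \<inter> e" if d: "d \<in> D" and e: "e \<in> E" for d e
  proof -
    obtain u v q where uv: "d = {u, v}" "u \<in> \<Union>E" "v \<in> \<Union>E" "q \<in> Q" "open_segment u v \<subseteq> q"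
      using diagonalE[OF d] by metis
    have "q \<inter> convex hull e = {}"
      using face_disjoint_drawn[OF face, of q] uv(4) e by (auto simp: drawn_def)
    then have "convex hull d \<inter> convex hull e = {u, v} \<inter> convex hull e"
      using uv(1,5) by (auto simp: segment_convex_hull[symmetric] closed_segment_eq_open)
    also have "\<dots> = d \<inter> e"
      using vertex_on_edge[OF E uv(2) e] vertex_on_edge[OF E uv(3) e] uv(1) by (auto intro: hull_inc)
    finally show ?thesis .
  qed
  show ?thesis
    unfolding drawing_def
  proof (intro conjI allI impI ballI)
    show "card e = 2" if "e \<in> E'" for e
    proof (cases "e \<in> D")
      case True
      then show ?thesis using diagonalE[OF True] by (metis card_2_iff)
    next
      case False
      then show ?thesis using that E by (auto simp: drawing_def)
    qed
  next
    fix e e' assume ee: "e \<in> E'" "e' \<in> E'" "e \<noteq> e'"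
    consider "e \<in> E" "e' \<in> E" | "e \<in> D" "e' \<in> E" | "e \<in> E" "e' \<in> D" | "e \<in> D" "e' \<in> D" using ee by blast
    then show "convex hull e \<inter> convex hull e' = e \<inter> e'"
    proof cases
      case 1
      then show ?thesis using drawing_hull_Int[OF E] ee by blast
    next
      case 2
      then show ?thesis using meet by blast
    next
      case 3
      then show ?thesis using meet[of e' e] by (simp add: Int_commute)
    next
      case 4
      then show ?thesis using split ee unfolding splitting_def by blast
    qed
  next
    fix K :: "complex set" assume K: "bounded K"
    then obtain R where R: "K \<subseteq> ball 0 R" using bounded_subset_ballD by blast
    let ?\<F> = "{f \<in> faces E. f \<inter> ball 0 R \<noteq> {}}"
    let ?W = "\<Union>f\<in>{f \<in> Q. f \<inter> ball 0 R \<noteq> {}}. \<Union>E \<inter> closure f"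
    have "finite ?\<F>" by (rule finite_faces_meeting_bounded[OF E]) simp
    then have "finite {f \<in> Q. f \<inter> ball 0 R \<noteq> {}}" by (rule rev_finite_subset) (use face in auto)
    then have "finite ?W"
      using finite_vertices_bounded[OF E bounded_closure] face_shape(2) by (intro finite_UN_I) auto
    then have "finite (Pow ?W)" by (rule finite_Pow_iff[THEN iffD2])
    moreover have "{d \<in> D. convex hull d \<inter> K \<noteq> {}} \<subseteq> Pow ?W"
    proof
      fix d assume d: "d \<in> {d \<in> D. convex hull d \<inter> K \<noteq> {}}"
      then obtain u v q where uv: "d = {u, v}" "u \<noteq> v" "u \<in> \<Union>E" "v \<in> \<Union>E" "q \<in> Q" "open_segment u v \<subseteq> q"
        using diagonalE by blast
      have hull: "convex hull d \<subseteq> closure q"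
        using closure_mono[OF uv(6)] uv(1,2) by (simp add: segment_convex_hull)
      then have "closure q \<inter> ball 0 R \<noteq> {}" using d R by blast
      then have "q \<inter> ball 0 R \<noteq> {}" using open_Int_closure_eq_empty[of "ball 0 R" q] by (auto simp: Int_commute)
      moreover have "d \<subseteq> closure q" using hull_subset[of d convex] hull by (rule order_trans)
      ultimately show "d \<in> Pow ?W" using uv by auto
    qed
    ultimately have "finite {d \<in> D. convex hull d \<inter> K \<noteq> {}}" by (rule rev_finite_subset)
    moreover have "finite {e \<in> E. convex hull e \<inter> K \<noteq> {}}" by (rule drawing_locally_finite[OF E K])
    moreover have "{e \<in> E'. convex hull e \<inter> K \<noteq> {}} =
        {e \<in> E. convex hull e \<inter> K \<noteq> {}} \<union> {d \<in> D. convex hull d \<inter> K \<noteq> {}}" by blast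
    ultimately show "finite {e \<in> E'. convex hull e \<inter> K \<noteq> {}}" by simp
  qed
qed

lemma drawn_split: "drawn E' = drawn E \<union> drawn D"
  by (simp add: drawn_def)

lemma face_of_split:
  assumes "t \<in> faces E'"
  obtains f where "f \<in> faces E" "t \<subseteq> f"
  using connected_in_face[OF face_connected[OF assms] face_nonempty[OF assms], of E]
    face_disjoint_drawn[OF assms] by (auto simp: drawn_split)

lemma P_face_of_split:
  assumes "p \<in> P"
  shows "p \<in> faces E'"
proof -
  have p: "p \<in> faces E" using face assms by simp
  have "p \<inter> convex hull d = {}" if d: "d \<in> D" for d
  proof -
    obtain u v q where uv: "d = {u, v}" "u \<in> \<Union>E" "v \<in> \<Union>E" "q \<in> Q" "open_segment u v \<subseteq> q"
      using diagonalE[OF d] by metis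
    have "p \<inter> q = {}" using faces_meet_eq[OF p face, of q] uv(4) assms colours(2) by auto
    moreover have "u \<in> drawn E" "v \<in> drawn E" using uv(2,3) by (auto simp: drawn_def intro: hull_inc)
    ultimately show ?thesis
      using uv(1,5) face_disjoint_drawn[OF p] by (auto simp: segment_convex_hull[symmetric] closed_segment_eq_open)
  qed
  then have "p \<inter> drawn E' = {}" using face_disjoint_drawn[OF p] by (auto simp: drawn_def)
  then obtain t where t: "t \<in> faces E'" "p \<subseteq> t"
    using connected_in_face[OF face_connected[OF p] face_nonempty[OF p]] by metis
  obtain f where f: "f \<in> faces E" "t \<subseteq> f" using face_of_split[OF t(1)] .
  have "f = p" using faces_meet_eq[OF f(1) p] face_nonempty[OF p] t(2) f(2) by blast
  then have "p = t" using t(2) f(2) by blast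
  then show ?thesis using t(1) by simp
qed

lemma closure_covered_by_pieces:
  assumes q: "q \<in> Q" and z: "z \<in> closure q"
  obtains t where "t \<in> faces E'" "t \<subseteq> q" "z \<in> closure t"
proof -
  obtain r where r: "r > 0" "finite {f \<in> faces E'. f \<inter> ball z r \<noteq> {}}"
    using faces_locally_finite[OF drawing_split] by blast
  let ?T = "{t \<in> {f \<in> faces E'. f \<inter> ball z r \<noteq> {}}. t \<subseteq> q}"
  have "z \<in> (\<Union>t\<in>?T. closure t)"
  proof (rule ccontr)
    assume nz: "z \<notin> (\<Union>t\<in>?T. closure t)"
    have "finite ?T" using r(2) by (rule rev_finite_subset) auto
    then have "closed (\<Union>t\<in>?T. closure t)" by (intro closed_UN) auto
    then have op: "open (ball z r - (\<Union>t\<in>?T. closure t))" by (intro open_Diff) auto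
    have zO: "z \<in> ball z r - (\<Union>t\<in>?T. closure t)" using nz r(1) by simp
    have qf: "q \<in> faces E" using face q by simp
    have "open (q \<inter> (ball z r - (\<Union>t\<in>?T. closure t)))" using op open_face[OF drawing_edges qf] by blast
    moreover have "q \<inter> (ball z r - (\<Union>t\<in>?T. closure t)) \<noteq> {}"
      using open_Int_closure_eq_empty[OF op, of q] z zO by blast
    ultimately obtain x where x: "x \<in> q" "x \<in> ball z r" "x \<notin> (\<Union>t\<in>?T. closure t)" "x \<notin> drawn E'"
      using open_not_subset_drawn[OF drawing_split] by blast
    obtain t where t: "t \<in> faces E'" "{x} \<subseteq> t" using connected_in_face[of "{x}" E'] x(4) by auto
    obtain f where f: "f \<in> faces E" "t \<subseteq> f" using face_of_split[OF t(1)] .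
    have "f = q" using faces_meet_eq[OF f(1) qf] x(1) t(2) f(2) by blast
    then have "t \<in> ?T" using t f x(2) by blast
    then show False using x(3) t(2) closure_subset by blast
  qed
  then show ?thesis using that by blast
qed

lemma isometric_on_face:
  assumes "f \<in> P \<union> Q" "x \<in> closure f" "y \<in> closure f"
  shows "norm (g y - g x) = norm (y - x)"
proof (cases "f \<in> P")
  case True
  then show ?thesis using g_on_P[OF True assms(2,3)] unit[OF assms(1)] by (simp add: norm_mult norm_power)
next
  case False
  then show ?thesis using g_on_Q[OF _ assms(2,3)] unit[OF assms(1)] assms(1)
    by (simp add: norm_mult norm_power flip: complex_cnj_diff)
qed

text \<open>
  The map \<open>g\<close> is isometric on each face, but contracts at distance \<open>\<delta>\<close>: a face inside \<open>U\<close> has diameter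
  less than \<open>\<delta>\<close>.
\<close>

lemma face_small:
  assumes f: "f \<in> P \<union> Q" "x \<in> closure f" and x: "ball x \<rho> \<subseteq> U" "\<delta> < \<rho>"
  shows "closure f \<subseteq> ball x \<delta>"
proof
  fix y assume y: "y \<in> closure f"
  show "y \<in> ball x \<delta>"
  proof (rule ccontr)
    assume "y \<notin> ball x \<delta>"
    then have d: "\<delta> \<le> norm (y - x)" by (simp add: dist_norm norm_minus_commute)
    define w where "w = \<delta> / norm (y - x)"
    have w: "0 \<le> w" "w \<le> 1" "w * norm (y - x) = \<delta>" using d lip(3) by (auto simp: w_def divide_le_eq)
    define z where "z = (1 - w) *\<^sub>R x + w *\<^sub>R y"
    have "convex (closure f)" using face_shape(1)[OF f(1)] by (rule convex_closure)
    then have zf: "z \<in> closure f" using f(2) y w by (auto simp: z_def intro: convexD_alt)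
    have "z - x = w *\<^sub>R (y - x)" by (simp add: z_def algebra_simps)
    then have nz: "norm (z - x) = \<delta>" using w by simp
    then have "z \<in> ball x \<rho>" "x \<in> ball x \<rho>" using x(2) lip(3) by (auto simp: dist_norm norm_minus_commute)
    then have "z \<in> U" "x \<in> U" using x(1) by auto
    moreover have "norm (x - z) \<ge> \<delta>" using nz by (simp add: norm_minus_commute)
    ultimately have "norm (g z - g x) \<le> \<kappa> * norm (z - x)" using lip(1) unfolding Lip_def by blast
    then have "\<delta> \<le> \<kappa> * \<delta>" using isometric_on_face[OF f zf] nz by simp
    then show False using lip(2,3) by simp
  qed
qed

text \<open>
  The second face at an edge cannot be the unbounded uncoloured face: this face is open and would leave
  points of \<open>U\<close> near the edge uncovered.
\<close>

lemma faces_at_edge_in_U: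
  assumes f: "f \<in> P \<union> Q" "closure f \<subseteq> U" and U: "open U"
    and e: "{u, v} \<in> E" "u \<noteq> v" "m \<in> open_segment u v" "m \<in> closure f"
  obtains f' where "f' \<in> P \<union> Q" "f' \<noteq> f" "f \<in> P \<longleftrightarrow> f' \<in> Q"
    "faces_at_sides E u v f f' \<or> faces_at_sides E v u f f'"
proof -
  obtain l r where lr: "faces_at_sides E u v l r" using faces_at_sides_exist[OF drawing_edges e(1,2)] .
  have ff: "f \<in> faces E" using face f(1) .
  have "f = l \<or> f = r" using face_at_edge_point[OF drawing_edges e(2) lr e(3) ff e(4)] .
  then obtain f' where s: "faces_at_sides E u v f f' \<or> faces_at_sides E v u f f'"
    using lr faces_at_sides_swap by blast
  then have f'f: "f' \<in> faces E" by (auto simp: faces_at_sides_def)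
  have hull: "convex hull {u, v} \<subseteq> closure f" "convex hull {u, v} \<subseteq> closure f'"
    using edge_subset_closures[OF e(2) s] .
  have ne: "f' \<noteq> f"
  proof
    assume "f' = f"
    then have "f \<inter> drawn E \<noteq> {}"
      using s no_convex_set_on_both_sides[OF e(2,1), of f f' f]
        no_convex_set_on_both_sides[OF e(2)[symmetric], of E f f' f] e(1) face_shape(1)[OF f(1)]
      by (auto simp: insert_commute)
    then show False using face_disjoint_drawn[OF ff] by blast
  qed
  have "m \<in> closure f'" using hull(2) e(3) by (auto simp: open_segment_def segment_convex_hull)
  then have "f' \<inter> U \<noteq> {}" using open_Int_closure_eq_empty[OF U, of f'] e(4) f(2) by blast
  then obtain x f'' where x: "x \<in> f'" "f'' \<in> P \<union> Q" "x \<in> closure f''" using U_covered by blast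
  then have "f'' = f'" using face_at_closure_point[OF drawing_edges f'f face] by blast
  then have f'PQ: "f' \<in> P \<union> Q" using x(2) by simp
  have "f \<in> P \<longleftrightarrow> f' \<in> Q" using coloured[OF f(1) f'PQ e(1) ne[symmetric]] hull by blast
  then show ?thesis using that f'PQ ne s by blast
qed

lemma edge_midpoint_in_closure:
  assumes "e \<in> E" "convex hull e \<subseteq> closure f"
  obtains u v where "e = {u, v}" "u \<noteq> v" "midpoint u v \<in> open_segment u v" "midpoint u v \<in> closure f"
proof -
  obtain u v where uv: "e = {u, v}" "u \<noteq> v" using drawing_edgeE[OF drawing_edges assms(1)] .
  moreover have "midpoint u v \<in> closure f"
    using assms(2) uv(1) midpoint_in_closed_segment[of u v] by (auto simp: segment_convex_hull)
  ultimately show ?thesis using that by auto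
qed

lemma face_near_point_is_inner:
  assumes U: "open U" and q: "q \<in> Q" "x \<in> closure q" and x: "ball x \<rho> \<subseteq> U" "2 * \<delta> < \<rho>"
  shows "q \<in> inner_faces G U P Q"
proof -
  have q': "q \<in> P \<union> Q" using q by simp
  have sm: "closure q \<subseteq> ball x \<delta>" using face_small[OF q' q(2) x(1)] x(2) lip(3) by simp
  then have qU: "closure q \<subseteq> U" using x lip(3) by (auto simp: subset_iff)
  have "\<exists>p\<in>P. closure p \<subseteq> U \<and> convex hull e \<subseteq> closure p" if e: "e \<in> E" "convex hull e \<subseteq> closure q" for e
  proof -
    obtain u v where uv: "e = {u, v}" "u \<noteq> v" "midpoint u v \<in> open_segment u v" "midpoint u v \<in> closure q"
      using edge_midpoint_in_closure[OF e] .
    obtain p where p: "p \<in> P \<union> Q" "p \<noteq> q" "q \<in> P \<longleftrightarrow> p \<in> Q" "faces_at_sides E u v q p \<or> faces_at_sides E v u q p"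
      using faces_at_edge_in_U[OF q' qU U _ uv(2-4)] e(1) uv(1) by blast
    have "p \<in> P" using p(1,3) q(1) colours(2) by blast
    moreover have h: "convex hull e \<subseteq> closure p"
      using edge_subset_closures(2)[OF uv(2) p(4)] uv(1) by simp
    moreover have "closure p \<subseteq> U"
    proof -
      have "u \<in> closure p" using h uv(1) by (auto intro: hull_inc)
      have "u \<in> convex hull e" using uv(1) by (simp add: hull_inc)
      then have "dist x u < \<delta>" using sm e(2) by auto
      then have "ball u (\<rho> - \<delta>) \<subseteq> ball x \<rho>" by (rule ball_subset_ball_shift)
      then have b: "ball u (\<rho> - \<delta>) \<subseteq> U" using x(1) by blast
      then have "closure p \<subseteq> ball u \<delta>" using face_small[OF p(1) \<open>u \<in> closure p\<close> b] x(2) by simp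
      also have "\<dots> \<subseteq> ball u (\<rho> - \<delta>)" using x(2) by (intro subset_ball) simp
      finally show ?thesis using b by blast
    qed
    ultimately show ?thesis by blast
  qed
  then show ?thesis using q(1) qU by (auto simp: inner_faces_def)
qed

lemma faces_at_sides_refine:
  assumes uv: "u \<noteq> v" and lr: "faces_at_sides E u v l r" and lr': "faces_at_sides E' u v l' r'"
  shows "l' \<subseteq> l" "r' \<subseteq> r"
proof -
  let ?m = "midpoint u v"
  have m: "?m \<in> open_segment u v" using uv by simp
  obtain \<rho> where \<rho>: "\<rho> > 0" "ball ?m \<rho> \<inter> left_side u v \<subseteq> l" "ball ?m \<rho> \<inter> left_side v u \<subseteq> r"
    using lr m unfolding faces_at_sides_def by blast
  obtain \<rho>' where \<rho>': "\<rho>' > 0" "ball ?m \<rho>' \<inter> left_side u v \<subseteq> l'" "ball ?m \<rho>' \<inter> left_side v u \<subseteq> r'"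
    using lr' m unfolding faces_at_sides_def by blast
  obtain s where s: "?m + of_real s * \<i> * (v - u) \<in> ball ?m (min \<rho> \<rho>') \<inter> left_side u v"
    "?m - of_real s * \<i> * (v - u) \<in> ball ?m (min \<rho> \<rho>') \<inter> left_side v u"
    using left_side_near[OF uv Im_on_segment[OF midpoint_in_closed_segment], of "min \<rho> \<rho>'"] \<rho>(1) \<rho>'(1) by auto
  have sub: "ball ?m (min \<rho> \<rho>') \<subseteq> ball ?m \<rho>" "ball ?m (min \<rho> \<rho>') \<subseteq> ball ?m \<rho>'" by auto
  have "l \<inter> l' \<noteq> {}" "r \<inter> r' \<noteq> {}" using s sub \<rho> \<rho>' by blast+
  moreover have "h' \<subseteq> h" if "h \<in> faces E" "h' \<in> faces E'" "h \<inter> h' \<noteq> {}" for h h'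
  proof -
    obtain f where "f \<in> faces E" "h' \<subseteq> f" using face_of_split[OF \<open>h' \<in> faces E'\<close>] .
    then show ?thesis using faces_meet_eq[of f E h] that by blast
  qed
  ultimately show "l' \<subseteq> l" "r' \<subseteq> r" using lr lr' unfolding faces_at_sides_def by blast+
qed

lemma triangleE:
  assumes "t \<in> Tri"
  obtains q where "q \<in> Q" "q \<in> inner_faces G U P Q" "t \<subseteq> q" "t \<in> faces E'" "closure t \<subseteq> closure q"
    "convex (closure t)"
proof -
  obtain q where q: "q \<in> inner_faces G U P Q" "t \<subseteq> q" "t \<in> faces E'"
    using assms by (auto simp: triangles_def pieces_def)
  then have qQ: "q \<in> Q" by (simp add: inner_faces_def)
  then have "t \<in> pieces G Q D" using q by (auto simp: pieces_def)
  moreover have "\<forall>t\<in>pieces G Q D. \<exists>x y z. closure t = convex hull {x, y, z} \<and>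
      {x, y} \<in> E' \<and> {y, z} \<in> E' \<and> {x, z} \<in> E'"
    using split unfolding splitting_def by (elim conjE)
  ultimately obtain x y z where "closure t = convex hull {x, y, z}" by blast
  then have "convex (closure t)" by simp
  then show ?thesis using that qQ q closure_mono by blast
qed

lemma triangle_value_at_edge:
  assumes "t \<in> Tri" "p \<in> P" "e \<in> E" "convex hull e \<subseteq> closure p" "convex hull e \<subseteq> closure t"
  shows "F p = Pr (Fc t) (\<eta> p)"
  using cvalues assms unfolding complex_values_def by blast

lemma triangle_value_at_diagonal:
  assumes "t \<in> Tri" "d \<in> D" "convex hull d \<subseteq> closure t"
  shows "F d = Pr (Fc t) (\<eta> d)"
  using cvalues assms unfolding complex_values_def by blast

text \<open>
  A face of the colour \<open>P\<close> borrows its complex coefficient from a triangle across one of its edges;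
  such an edge exists because the frontier is infinite, hence not made up of vertices alone.
\<close>

lemma adjacent_triangle:
  assumes U: "open U" and p: "p \<in> P" "x \<in> closure p" and x: "ball x \<rho> \<subseteq> U" "4 * \<delta> < \<rho>"
  obtains t where "t \<in> Tri" "F p = Pr (Fc t) (\<eta> p)" "closure t \<subseteq> ball x (2 * \<delta>)"
proof -
  have p': "p \<in> P \<union> Q" using p by simp
  have pf: "p \<in> faces E" by (rule face[OF p'])
  have po: "open p" by (rule open_face[OF drawing_edges pf])
  have sm: "closure p \<subseteq> ball x \<delta>" using face_small[OF p' p(2) x(1)] x(2) lip(3) by simp
  then have pU: "closure p \<subseteq> U" using x lip(3) by (auto simp: subset_iff)
  have "infinite (frontier p)"
    using infinite_frontier_of_bounded_open[OF po face_nonempty[OF pf] face_shape(2)[OF p']] .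
  moreover have "finite (\<Union>E \<inter> frontier p)"
    using bounded_subset[OF bounded_closure[OF face_shape(2)[OF p']], of "frontier p"]
    by (intro finite_vertices_bounded[OF drawing_edges]) (simp add: frontier_def)
  ultimately have "infinite (frontier p - \<Union>E \<inter> frontier p)" by simp
  then obtain m where "m \<in> frontier p - \<Union>E \<inter> frontier p"
    by (metis all_not_in_conv finite.emptyI)
  then have m: "m \<in> closure p" "m \<notin> p" "m \<notin> \<Union>E" using po by (auto simp: frontier_def interior_open)
  have "m \<in> drawn E"
  proof (rule ccontr)
    assume "m \<notin> drawn E"
    then obtain f where "f \<in> faces E" "{m} \<subseteq> f" using connected_in_face[of "{m}" E] by auto
    then show False using face_at_closure_point[OF drawing_edges, of f p m] pf m by auto
  qed
  then obtain e where e: "e \<in> E" "m \<in> convex hull e" by (auto simp: drawn_def)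
  obtain u v where uv: "e = {u, v}" "u \<noteq> v" using drawing_edgeE[OF drawing_edges e(1)] .
  have mo: "m \<in> open_segment u v" using e m(3) uv by (auto simp: open_segment_def segment_convex_hull)
  obtain q where q: "q \<in> P \<union> Q" "p \<in> P \<longleftrightarrow> q \<in> Q" "faces_at_sides E u v p q \<or> faces_at_sides E v u p q"
    using faces_at_edge_in_U[OF p' pU U _ uv(2) mo m(1)] e(1) uv(1) by metis
  obtain u v where uv: "e = {u, v}" "u \<noteq> v" "faces_at_sides E u v p q"
    using q(3) uv by (metis insert_commute)
  have qQ: "q \<in> Q" using q(2) p(1) by simp
  have "{u, v} \<in> E'" using e(1) uv(1) by simp
  then obtain p' t where sides: "faces_at_sides E' u v p' t"
    using faces_at_sides_exist[OF drawing_split _ uv(2)] by blast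
  have tq: "t \<subseteq> q" using faces_at_sides_refine[OF uv(2,3) sides] by simp
  have hp: "convex hull e \<subseteq> closure p" "convex hull e \<subseteq> closure q"
    using edge_subset_closure_sides[OF uv(2,3)] uv(1) by auto
  have ht: "convex hull e \<subseteq> closure t" using edge_subset_closure_sides[OF uv(2) sides] uv(1) by auto
  have "u \<in> convex hull e" using uv(1) by (simp add: hull_inc)
  then have u: "u \<in> closure q" "dist x u < \<delta>" using hp sm by auto
  have bU: "ball u (\<rho> - \<delta>) \<subseteq> U" using ball_subset_ball_shift[OF u(2), of \<rho>] x(1) by (rule order_trans)
  have "q \<in> inner_faces G U P Q" using face_near_point_is_inner[OF U qQ u(1) bU] x(2) lip(3) by simp
  then have "t \<in> Tri" using tq sides by (auto simp: triangles_def pieces_def faces_at_sides_def)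
  moreover have "F p = Pr (Fc t) (\<eta> p)"
    by (rule triangle_value_at_edge[OF calculation p(1) e(1) hp(1) ht])
  moreover have "closure t \<subseteq> ball x (2 * \<delta>)"
  proof -
    have "closure t \<subseteq> closure q" by (rule closure_mono[OF tq])
    also have "\<dots> \<subseteq> ball u \<delta>" using face_small[OF q(1) u(1) bU] x(2) lip(3) by simp
    also have "\<dots> \<subseteq> ball x (2 * \<delta>)" using ball_subset_ball_shift[OF u(2), of "2 * \<delta>"] by simp
    finally show ?thesis .
  qed
  ultimately show ?thesis using that by blast
qed

text \<open>
  Two distinct pieces with a common segment meet along an edge of the graph, and then have different
  colours, or along a diagonal. In both cases \<open>Pr\<close> sends the
  complex coefficients at the two sides of the edge to the same number.
\<close>

lemma increments_agree:
  assumes s: "s \<in> P \<and> F s = Pr (a s) (\<eta> s) \<or> s \<in> Tri \<and> a s = Fc s"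
    and t: "t \<in> P \<and> F t = Pr (a t) (\<eta> t) \<or> t \<in> Tri \<and> a t = Fc t"
    and x: "x \<in> closure s \<inter> closure t" and y: "y \<in> closure s \<inter> closure t"
  shows "a s * (y - x) + cnj (a s) * (g y - g x) = a t * (y - x) + cnj (a t) * (g y - g x)"
proof (cases "s = t \<or> x = y")
  case False
  have E'face: "h \<in> faces E'" "convex (closure h)" if "h \<in> P \<or> h \<in> Tri" for h
    using that P_face_of_split face_shape(1) convex_closure triangleE by (metis UnI1)+
  have st: "s \<in> P \<or> s \<in> Tri" "t \<in> P \<or> t \<in> Tri" using s t by auto
  obtain u v m c where uv: "{u, v} \<in> E'" "u \<noteq> v" "m \<in> open_segment u v" "m \<in> closure s \<inter> closure t"
    "faces_at_sides E' u v s t" "y - x = of_real c * (v - u)"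
    using touching_faces_share_edge[OF drawing_split, of s t x y] E'face[OF st(1)] E'face[OF st(2)] False x y
    by metis
  have hs: "convex hull {u, v} \<subseteq> closure s" and ht: "convex hull {u, v} \<subseteq> closure t"
    using edge_subset_closure_sides[OF uv(2,5)] by auto
  show ?thesis
  proof (cases "{u, v} \<in> E")
    case True
    have "\<not> (s \<in> P \<and> t \<in> P)"
      using coloured[of s t "{u, v}"] True False hs ht colours(2) by blast
    moreover have "\<not> (s \<in> Tri \<and> t \<in> Tri)"
    proof
      assume "s \<in> Tri \<and> t \<in> Tri"
      then obtain q q' where q: "q \<in> Q" "s \<subseteq> q" "closure s \<subseteq> closure q"
        and q': "q' \<in> Q" "t \<subseteq> q'" "closure t \<subseteq> closure q'"
        using triangleE by metis
      obtain l r where lr: "faces_at_sides E u v l r"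
        using faces_at_sides_exist[OF drawing_edges True uv(2)] .
      then have "s \<subseteq> l" "t \<subseteq> r" using faces_at_sides_refine[OF uv(2) lr uv(5)] by auto
      moreover have "s \<noteq> {}" "t \<noteq> {}" using face_nonempty E'face[OF st(1)] E'face[OF st(2)] by auto
      ultimately have "l \<inter> q \<noteq> {}" "r \<inter> q' \<noteq> {}" using q(2) q'(2) by auto
      then have "l = q" "r = q'"
        using lr face q(1) q'(1) faces_meet_eq unfolding faces_at_sides_def by blast+
      show False
      proof (cases "q = q'")
        case True
        then have "q \<inter> drawn E \<noteq> {}"
          using no_convex_set_on_both_sides[OF uv(2) \<open>{u, v} \<in> E\<close> lr, of q] face_shape(1) q(1)
            \<open>l = q\<close> \<open>r = q'\<close> by simp
        then show False using face_disjoint_drawn face q(1) by blast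
      next
        case False
        then show False
          using coloured[of q q' "{u, v}"] \<open>{u, v} \<in> E\<close> hs ht q q' colours(2) by blast
      qed
    qed
    ultimately consider "s \<in> P" "t \<in> Tri" "t \<notin> P" "s \<notin> Tri" | "s \<in> Tri" "t \<in> P" "s \<notin> P" "t \<notin> Tri"
      using st by blast
    then show ?thesis
    proof cases
      case 1
      then have "Pr (a s) (\<eta> s) = Pr (a t) (\<eta> s)"
        using s t triangle_value_at_edge[OF 1(2,1) True hs ht] by auto
      then show ?thesis using g_on_P[OF 1(1), of x y] x y by (intro increment_eq_of_Pr_eq) auto
    next
      case 2
      then have "Pr (a s) (\<eta> t) = Pr (a t) (\<eta> t)"
        using s t triangle_value_at_edge[OF 2(1,2) True ht hs] by auto
      then show ?thesis using g_on_P[OF 2(2), of x y] x y by (intro increment_eq_of_Pr_eq) auto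
    qed
  next
    case False
    then have D: "{u, v} \<in> D" using uv(1) by blast
    obtain u' v' q where q: "{u, v} = {u', v'}" "q \<in> Q" "open_segment u' v' \<subseteq> q"
      using diagonalE[OF D] by metis
    have seg: "open_segment u v \<subseteq> q"
      using q(1,3) by (metis doubleton_eq_iff open_segment_commute)
    have qf: "q \<in> faces E" using face q(2) by simp
    have inq: "h \<in> Tri \<and> h \<notin> P \<and> closure h \<subseteq> closure q" if h: "h \<in> P \<or> h \<in> Tri" "m \<in> closure h" for h
    proof -
      have "h \<notin> P"
        using face_at_closure_point[OF drawing_edges qf face, of h m] h(2) seg uv(3) q(2) colours(2) by blast
      then have "h \<in> Tri" using h(1) by simp
      then obtain q' where q': "q' \<in> Q" "closure h \<subseteq> closure q'" using triangleE by metis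
      then have "q' = q"
        using face_at_closure_point[OF drawing_edges qf face, of q' m] h(2) seg uv(3) by blast
      then show ?thesis using \<open>h \<notin> P\<close> \<open>h \<in> Tri\<close> q' by simp
    qed
    have sq: "s \<in> Tri" "s \<notin> P" "closure s \<subseteq> closure q" and tq: "t \<in> Tri" "t \<notin> P"
      using inq[OF st(1)] inq[OF st(2)] uv(4) by auto
    have \<eta>d: "norm (\<eta> {u, v}) = 1" "cnj (\<eta> {u, v}) * cnj (\<eta> q) \<in> {sgn (v - u), - sgn (v - u)}"
      using diagonals D q(2) seg unfolding sqrt_on_diagonals_def by blast+
    have "g y - g x = (cnj (\<eta> q))\<^sup>2 * cnj (y - x)" using g_on_Q[OF q(2), of x y] x y sq(3) by blast
    also have "\<dots> = (\<eta> {u, v})\<^sup>2 * (y - x)" by (rule sqrt_forms_agree_on_edge[OF \<eta>d uv(6)])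
    finally have "g y - g x = (\<eta> {u, v})\<^sup>2 * (y - x)" .
    moreover have "Pr (a s) (\<eta> {u, v}) = Pr (a t) (\<eta> {u, v})"
      using s t sq tq triangle_value_at_diagonal[OF sq(1) D hs] triangle_value_at_diagonal[OF tq(1) D ht] by auto
    ultimately show ?thesis by (intro increment_eq_of_Pr_eq) auto
  qed
qed auto

lemma piecewise_form_exists:
  assumes U: "open U" and K: "\<And>x. x \<in> K \<Longrightarrow> ball x \<rho> \<subseteq> U" and \<rho>: "4 * \<delta> < \<rho>"
  shows "\<exists>\<P> a. piecewise_form K g \<P> a \<and>
    (\<forall>t\<in>\<P>. \<forall>x\<in>closure t \<inter> K. \<exists>t'\<in>Tri. a t = Fc t' \<and> closure t' \<subseteq> ball x (3 * \<delta>))"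
proof -
  let ?\<P> = "{t \<in> P \<union> Tri. closure t \<inter> K \<noteq> {}}"
  have disj: "t \<notin> Tri" if "t \<in> P" for t
  proof
    assume "t \<in> Tri"
    then obtain q where "q \<in> Q" "t \<subseteq> q" "t \<in> faces E'" using triangleE by metis
    then show False using faces_meet_eq[OF face face, of t q] face_nonempty[of t E'] that colours(2) by blast
  qed
  have small: "\<exists>f. f \<in> P \<union> Q \<and> closure t \<subseteq> closure f" if "t \<in> P \<union> Tri" for t
    using that triangleE by (metis UnCI UnE order_refl)
  have near: "closure t \<subseteq> ball x \<delta>" if t: "t \<in> P \<union> Tri" "x \<in> closure t" "x \<in> K" for t x
  proof -
    obtain f where f: "f \<in> P \<union> Q" "closure t \<subseteq> closure f" using small[OF t(1)] by blast
    then have "closure f \<subseteq> ball x \<delta>" using face_small[OF f(1) _ K[OF t(3)]] t(2) \<rho> lip(3) by auto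
    then show ?thesis using f(2) by blast
  qed
  define R where "R t b \<longleftrightarrow> (t \<in> P \<and> F t = Pr b (\<eta> t) \<or> t \<in> Tri \<and> b = Fc t) \<and>
      (\<forall>x\<in>closure t \<inter> K. \<exists>t'\<in>Tri. b = Fc t' \<and> closure t' \<subseteq> ball x (3 * \<delta>))" for t b
  have "\<exists>b. R t b" if t: "t \<in> ?\<P>" for t
  proof (cases "t \<in> P")
    case True
    obtain x where x: "x \<in> closure t" "x \<in> K" using t by blast
    obtain t' where t': "t' \<in> Tri" "F t = Pr (Fc t') (\<eta> t)" "closure t' \<subseteq> ball x (2 * \<delta>)"
      using adjacent_triangle[OF U True x(1) K[OF x(2)] \<rho>] .
    have "closure t' \<subseteq> ball y (3 * \<delta>)" if y: "y \<in> closure t \<inter> K" for y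
    proof -
      have "dist y x < \<delta>" using near[of t x] t x y by (auto simp: dist_commute)
      then have "ball x (2 * \<delta>) \<subseteq> ball y (3 * \<delta>)" using ball_subset_ball_shift[of y x \<delta> "3 * \<delta>"] by simp
      then show ?thesis using t'(3) by blast
    qed
    then show ?thesis using True t' unfolding R_def by blast
  next
    case False
    then have tT: "t \<in> Tri" using t by blast
    moreover have "closure t \<subseteq> ball x (3 * \<delta>)" if "x \<in> closure t \<inter> K" for x
    proof -
      have "closure t \<subseteq> ball x \<delta>" using near t that by blast
      also have "\<dots> \<subseteq> ball x (3 * \<delta>)" using lip(3) by (intro subset_ball) simp
      finally show ?thesis .
    qed
    ultimately show ?thesis unfolding R_def by blast
  qed
  then have "\<forall>t\<in>?\<P>. \<exists>b. R t b" by blast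
  then obtain a where "\<forall>t\<in>?\<P>. R t (a t)" by (rule bchoice[THEN exE])
  then have a: "\<And>t. t \<in> ?\<P> \<Longrightarrow> t \<in> P \<and> F t = Pr (a t) (\<eta> t) \<or> t \<in> Tri \<and> a t = Fc t"
    and close: "\<And>t x. \<lbrakk>t \<in> ?\<P>; x \<in> closure t \<inter> K\<rbrakk> \<Longrightarrow> \<exists>t'\<in>Tri. a t = Fc t' \<and> closure t' \<subseteq> ball x (3 * \<delta>)"
    unfolding R_def by blast+
  have "piecewise_form K g ?\<P> a"
  proof
    fix x assume "x \<in> K"
    obtain r where r: "r > 0" "finite {f \<in> faces E'. f \<inter> ball x r \<noteq> {}}"
      using faces_locally_finite[OF drawing_split] by blast
    have "{t \<in> ?\<P>. closure t \<inter> ball x r \<noteq> {}} \<subseteq> {f \<in> faces E'. f \<inter> ball x r \<noteq> {}}"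
    proof
      fix t assume t: "t \<in> {t \<in> ?\<P>. closure t \<inter> ball x r \<noteq> {}}"
      then have "t \<in> faces E'" using P_face_of_split triangleE by (metis (mono_tags, lifting) UnE mem_Collect_eq)
      moreover have "ball x r \<inter> closure t \<noteq> {}" using t by blast
      then have "ball x r \<inter> t \<noteq> {}" using open_Int_closure_eq_empty[OF open_ball] by metis
      ultimately show "t \<in> {f \<in> faces E'. f \<inter> ball x r \<noteq> {}}" by blast
    qed
    then show "\<exists>r>0. finite {t \<in> ?\<P>. closure t \<inter> ball x r \<noteq> {}}"
      using r finite_subset by blast
  next
    show "K \<subseteq> (\<Union>t\<in>?\<P>. closure t)"
    proof
      fix x assume x: "x \<in> K"
      have "\<rho> > 0" using \<rho> lip(3) by linarith
      then have "x \<in> U" using K[OF x] by auto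
      then obtain f where f: "f \<in> P \<union> Q" "x \<in> closure f" using U_covered by blast
      show "x \<in> (\<Union>t\<in>?\<P>. closure t)"
      proof (cases "f \<in> P")
        case True
        then show ?thesis using f x by blast
      next
        case False
        then have q: "f \<in> Q" using f by blast
        obtain t where t: "t \<in> faces E'" "t \<subseteq> f" "x \<in> closure t"
          using closure_covered_by_pieces[OF q f(2)] .
        have "f \<in> inner_faces G U P Q"
          using face_near_point_is_inner[OF U q f(2) K[OF x]] \<rho> lip(3) by simp
        then have "t \<in> Tri" using t by (auto simp: triangles_def pieces_def)
        then show ?thesis using t x by blast
      qed
    qed
  next
    show "norm (g y - g x) = norm (y - x)" if "t \<in> ?\<P>" "x \<in> closure t" "y \<in> closure t" for t x y
      using small[of t] that isometric_on_face by blast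
  next
    show "a s * (y - x) + cnj (a s) * (g y - g x) = a t * (y - x) + cnj (a t) * (g y - g x)"
      if "s \<in> ?\<P>" "t \<in> ?\<P>" "x \<in> closure s \<inter> closure t" "y \<in> closure s \<inter> closure t" for s t x y
      using increments_agree[OF a[OF that(1)] a[OF that(2)] that(3,4)] .
  qed
  then show ?thesis using close by blast
qed

end

section \<open>Limits of t-holomorphic functions\<close>

lemma t_embedding_coloured_faces:
  assumes "t_embedding G"
  shows "drawing (edges G)" "black G \<union> white G \<subseteq> faces (edges G)" "black G \<inter> white G = {}"
    and "\<And>f. f \<in> black G \<union> white G \<Longrightarrow> convex f" "\<And>f. f \<in> black G \<union> white G \<Longrightarrow> bounded f"
    and "\<And>f f' e. \<lbrakk>f \<in> black G \<union> white G; f' \<in> black G \<union> white G; e \<in> edges G; f \<noteq> f';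
      convex hull e \<subseteq> closure f \<inter> closure f'\<rbrakk> \<Longrightarrow> f \<in> black G \<longleftrightarrow> f' \<in> white G"
proof -
  have *: "drawing (edges G) \<and> black G \<union> white G \<subseteq> faces (edges G) \<and> properly_coloured G \<and>
      (\<forall>f\<in>black G \<union> white G. convex_polygon f)"
    using assms unfolding t_embedding_def plane_t_embedding_def finite_t_embedding_def by blast
  then show "drawing (edges G)" "black G \<union> white G \<subseteq> faces (edges G)" by blast+
  show "black G \<inter> white G = {}" using * by (simp add: properly_coloured_def)
  show "convex f" if "f \<in> black G \<union> white G" for f
    using * that by (simp add: convex_polygon_def)
  show "bounded f" if "f \<in> black G \<union> white G" for f
  proof -
    have "polytope (closure f)" using * that by (simp add: convex_polygon_def)
    then have "bounded (closure f)" by (rule polytope_imp_bounded)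
    then show ?thesis using closure_subset by (rule bounded_subset)
  qed
  show "f \<in> black G \<longleftrightarrow> f' \<in> white G"
    if "f \<in> black G \<union> white G" "f' \<in> black G \<union> white G" "e \<in> edges G" "f \<noteq> f'"
      "convex hull e \<subseteq> closure f \<inter> closure f'" for f f' e
    using * that unfolding properly_coloured_def by blast
qed

lemma white_t_holomorphic_setup:
  assumes "t_embedding G" "covers G U" "origami_sqrt G \<eta>" "origami_map G \<eta> Om"
    "splitting G (white G) D" "sqrt_on_diagonals (white G) D \<eta>"
    "complex_values G U \<eta> (black G) (white G) D F Fc" "Lip \<kappa> \<delta> U Om" "\<kappa> < 1" "\<delta> > 0"
  shows "t_holomorphic_setup G U (black G) (white G) D \<eta> (\<lambda>z. cnj (Om z)) F Fc \<kappa> \<delta>"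
proof
  note t = t_embedding_coloured_faces[OF assms(1)]
  show "drawing (edges G)" "black G \<union> white G \<subseteq> faces (edges G)" "black G \<inter> white G = {}"
    "\<And>f. f \<in> black G \<union> white G \<Longrightarrow> convex f" "\<And>f. f \<in> black G \<union> white G \<Longrightarrow> bounded f"
    by (fact t)+
  show "f \<in> black G \<longleftrightarrow> f' \<in> white G"
    if "f \<in> black G \<union> white G" "f' \<in> black G \<union> white G" "e \<in> edges G" "f \<noteq> f'"
      "convex hull e \<subseteq> closure f \<inter> closure f'" for f f' e
    by (rule t(6)[OF that])
  show "U \<subseteq> (\<Union>f\<in>black G \<union> white G. closure f)" using assms(2) by (simp add: covers_def)
  show "norm (\<eta> f) = 1" if "f \<in> black G \<union> white G" for f
    using assms(3) that by (simp add: origami_sqrt_def)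
  show "cnj (Om y) - cnj (Om x) = (\<eta> p)\<^sup>2 * (y - x)" if "p \<in> black G" "x \<in> closure p" "y \<in> closure p" for p x y
  proof -
    have "Om y - Om x = (cnj (\<eta> p))\<^sup>2 * cnj (y - x)"
      using assms(4) that unfolding origami_map_def by blast
    from arg_cong[OF this, of cnj] show ?thesis by simp
  qed
  show "cnj (Om y) - cnj (Om x) = (cnj (\<eta> q))\<^sup>2 * cnj (y - x)"
    if "q \<in> white G" "x \<in> closure q" "y \<in> closure q" for q x y
  proof -
    have "Om y - Om x = (\<eta> q)\<^sup>2 * (y - x)"
      using assms(4) that unfolding origami_map_def by blast
    from arg_cong[OF this, of cnj] show ?thesis by simp
  qed
  show "Lip \<kappa> \<delta> U (\<lambda>z. cnj (Om z))"
    using assms(8) by (simp add: Lip_def flip: complex_cnj_diff)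
qed (fact assms)+

lemma black_t_holomorphic_setup:
  assumes "t_embedding G" "covers G U" "origami_sqrt G \<eta>" "origami_map G \<eta> Om"
    "splitting G (black G) D" "sqrt_on_diagonals (black G) D \<eta>"
    "complex_values G U \<eta> (white G) (black G) D F Fc" "Lip \<kappa> \<delta> U Om" "\<kappa> < 1" "\<delta> > 0"
  shows "t_holomorphic_setup G U (white G) (black G) D \<eta> Om F Fc \<kappa> \<delta>"
proof
  note t = t_embedding_coloured_faces[OF assms(1)]
  show "drawing (edges G)" "white G \<union> black G \<subseteq> faces (edges G)" "white G \<inter> black G = {}"
    "\<And>f. f \<in> white G \<union> black G \<Longrightarrow> convex f" "\<And>f. f \<in> white G \<union> black G \<Longrightarrow> bounded f"
    using t by blast+
  show "f \<in> white G \<longleftrightarrow> f' \<in> black G"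
    if "f \<in> white G \<union> black G" "f' \<in> white G \<union> black G" "e \<in> edges G" "f \<noteq> f'"
      "convex hull e \<subseteq> closure f \<inter> closure f'" for f f' e
    using t(6)[of f' f e] that by blast
  show "U \<subseteq> (\<Union>f\<in>white G \<union> black G. closure f)" using assms(2) by (simp add: covers_def Un_commute)
  show "norm (\<eta> f) = 1" if "f \<in> white G \<union> black G" for f
    using assms(3) that by (auto simp: origami_sqrt_def)
  show "Om y - Om x = (\<eta> p)\<^sup>2 * (y - x)" if "p \<in> white G" "x \<in> closure p" "y \<in> closure p" for p x y
    using assms(4) that unfolding origami_map_def by blast
  show "Om y - Om x = (cnj (\<eta> q))\<^sup>2 * cnj (y - x)"
    if "q \<in> black G" "x \<in> closure q" "y \<in> closure q" for q x y
    using assms(4) that unfolding origami_map_def by blast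
qed (fact assms)+

text \<open>
  The diameters of the faces tend to zero, so that a value of the form near a point of \<open>K\<close> is a complex
  value \<open>Fc\<close> on a triangle near this point, which convergence compares with \<open>f\<close>.
\<close>

lemma approximating_forms_of_t_holomorphic:
  assumes U: "open U"
    and conv: "converges_on_compacts U (\<lambda>n. triangles (G n) U (P n) (Q n) (D n)) Fc f"
    and hol: "\<forall>\<^sub>F n in sequentially.
      t_holomorphic_setup (G n) U (P n) (Q n) (D n) (\<eta> n) (g n) (F n) (Fc n) \<kappa> (\<delta> n)"
    and \<delta>: "\<delta> \<longlonglongrightarrow> 0"
    and K: "compact K" "K \<subseteq> U"
  shows "approximating_forms K g f"
  unfolding approximating_forms_def
proof (intro allI impI)
  fix \<epsilon> :: real assume "\<epsilon> > 0"
  then have \<epsilon>: "\<epsilon> / 2 > 0" by simp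
  obtain \<rho> where \<rho>: "\<rho> > 0" "(\<Union>x\<in>K. cball x \<rho>) \<subseteq> U"
    using compact_subset_open_imp_cball_epsilon_subset[OF K(1) U K(2)] by blast
  define L where "L = {x + y |x y. x \<in> K \<and> y \<in> cball 0 \<rho>}"
  have L: "compact L" unfolding L_def by (intro compact_sums K(1) compact_cball)
  have ballL: "z \<in> L" if "x \<in> K" "dist x z < \<rho>" for x z
  proof -
    have "z = x + (z - x)" "z - x \<in> cball 0 \<rho>" using that by (auto simp: dist_norm norm_minus_commute)
    then show ?thesis using that(1) unfolding L_def by blast
  qed
  have LU: "L \<subseteq> U"
  proof
    fix z assume "z \<in> L"
    then obtain x y where "x \<in> K" "y \<in> cball 0 \<rho>" "z = x + y" unfolding L_def by blast
    then have "z \<in> cball x \<rho>" by (simp add: dist_norm)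
    then show "z \<in> U" using \<rho>(2) \<open>x \<in> K\<close> by blast
  qed
  have cf: "continuous_on U f" using conv by (simp add: converges_on_compacts_def)
  have "uniformly_continuous_on L f"
    using continuous_on_subset[OF cf LU] L by (rule compact_uniformly_continuous)
  then obtain d where d: "d > 0" "\<And>x y. \<lbrakk>x \<in> L; y \<in> L; dist y x < d\<rbrakk> \<Longrightarrow> dist (f y) (f x) < \<epsilon> / 2"
    using \<epsilon> unfolding uniformly_continuous_on_def by blast
  have "\<forall>\<^sub>F n in sequentially. \<forall>t\<in>triangles (G n) U (P n) (Q n) (D n). \<forall>z\<in>closure t \<inter> L. norm (Fc n t - f z) < \<epsilon> / 2"
    using conv L LU \<epsilon> unfolding converges_on_compacts_def by blast
  moreover have "\<forall>\<^sub>F n in sequentially. \<delta> n < min \<rho> d / 4"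
    using order_tendstoD(2)[OF \<delta>, of "min \<rho> d / 4"] \<rho>(1) d(1) by simp
  ultimately show "\<forall>\<^sub>F n in sequentially. \<exists>\<P> a. piecewise_form K (g n) \<P> a \<and>
      (\<forall>t\<in>\<P>. \<forall>z\<in>closure t \<inter> K. norm (a t - f z) \<le> \<epsilon>)"
    using hol
  proof eventually_elim
    case (elim n)
    interpret t_holomorphic_setup "G n" U "P n" "Q n" "D n" "\<eta> n" "g n" "F n" "Fc n" \<kappa> "\<delta> n" by fact
    have ball: "ball x \<rho> \<subseteq> U" if "x \<in> K" for x
      using \<rho>(2) that ball_subset_cball by blast
    have small: "4 * \<delta> n < \<rho>" "4 * \<delta> n < d" using elim(2) by auto
    define R where "R \<P> a \<longleftrightarrow> piecewise_form K (g n) \<P> a \<and>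
        (\<forall>t\<in>\<P>. \<forall>x\<in>closure t \<inter> K. \<exists>t'\<in>Tri. a t = Fc n t' \<and> closure t' \<subseteq> ball x (3 * \<delta> n))" for \<P> a
    have "\<exists>\<P> a. R \<P> a"
      unfolding R_def by (rule piecewise_form_exists[OF U ball small(1)])
    then obtain \<P> a where "R \<P> a" by blast
    then have pf: "piecewise_form K (g n) \<P> a"
      and a: "\<forall>t\<in>\<P>. \<forall>x\<in>closure t \<inter> K. \<exists>t'\<in>Tri. a t = Fc n t' \<and> closure t' \<subseteq> ball x (3 * \<delta> n)"
      unfolding R_def by (rule conjunct1, rule conjunct2)
    have "norm (a t - f x) \<le> \<epsilon>" if tx: "t \<in> \<P>" "x \<in> closure t \<inter> K" for t x
    proof -
      obtain t' where t': "t' \<in> Tri" "a t = Fc n t'" "closure t' \<subseteq> ball x (3 * \<delta> n)" using a tx by blast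
      have "t' \<noteq> {}" using triangleE[OF t'(1)] face_nonempty by metis
      then obtain z where z: "z \<in> closure t'" using closure_subset by blast
      then have dz: "dist x z < 3 * \<delta> n" using t'(3) by auto
      then have "z \<in> L" "dist z x < d" using ballL[of x z] tx small lip(3) by (auto simp: dist_commute)
      moreover have "x \<in> L" using ballL[of x x] tx \<rho>(1) by auto
      ultimately have "norm (f z - f x) < \<epsilon> / 2" using d(2) by (simp add: dist_norm)
      moreover have "norm (Fc n t' - f z) < \<epsilon> / 2" using elim(1) t'(1) z \<open>z \<in> L\<close> by blast
      ultimately show ?thesis
        using norm_triangle_ineq[of "Fc n t' - f z" "f z - f x"] t'(2) by simp
    qed
    then show ?case using pf by blast
  qed
qed

text \<open>
  The lower bound \<open>\<delta>\<close> on the distances disappears in the limit. The constant \<open>1\<close>, instead of \<open>\<kappa>\<close>, is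
  safe also for negative \<open>\<kappa>\<close>.
\<close>

lemma limit_of_Lip_lipschitz:
  assumes \<delta>: "\<delta> \<longlonglongrightarrow> 0" and \<kappa>: "\<kappa> < 1"
    and lip: "\<forall>\<^sub>F n in sequentially. Lip \<kappa> (\<delta> n) U (Om n)"
    and lim: "\<And>z. z \<in> U \<Longrightarrow> (\<lambda>n. Om n z) \<longlonglongrightarrow> \<theta> z"
  shows "1-lipschitz_on U \<theta>"
proof (rule lipschitz_onI)
  fix x y assume xy: "x \<in> U" "y \<in> U"
  show "dist (\<theta> x) (\<theta> y) \<le> 1 * dist x y"
  proof (cases "x = y")
    case False
    then have "\<forall>\<^sub>F n in sequentially. \<delta> n < norm (x - y)"
      using order_tendstoD(2)[OF \<delta>, of "norm (x - y)"] by simp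
    with lip have "\<forall>\<^sub>F n in sequentially. dist (Om n x) (Om n y) \<le> dist x y"
    proof eventually_elim
      case (elim n)
      then have "norm (Om n y - Om n x) \<le> \<kappa> * norm (y - x)"
        using xy unfolding Lip_def by fastforce
      also have "\<dots> \<le> 1 * norm (y - x)" using \<kappa> by (intro mult_right_mono) auto
      finally show ?case by (simp add: dist_norm norm_minus_commute)
    qed
    moreover have "(\<lambda>n. dist (Om n x) (Om n y)) \<longlonglongrightarrow> dist (\<theta> x) (\<theta> y)"
      using xy by (intro tendsto_dist lim)
    ultimately show ?thesis by (simp add: tendsto_upperbound)
  qed simp
qed simp

theorem proposition6p15:
  fixes \<kappa> :: real
    and U :: "complex set"
    and \<delta> :: "nat \<Rightarrow> real"
    and T :: "nat \<Rightarrow> tgraph"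
    and \<eta> :: "nat \<Rightarrow> complex set \<Rightarrow> complex"
    and Om :: "nat \<Rightarrow> complex \<Rightarrow> complex"
    and \<theta> :: "complex \<Rightarrow> complex"
    and D\<^sub>w D\<^sub>b :: "nat \<Rightarrow> complex set set"
  assumes "\<kappa> < 1"
    and "open U"
    and "\<And>n. \<delta> n > 0"
    and "\<delta> \<longlonglongrightarrow> 0"
    and "\<And>n. t_embedding (T n)"
    and "\<And>n. covers (T n) U"
    and "\<And>n. origami_sqrt (T n) (\<eta> n)"
    and "\<And>n. origami_map (T n) (\<eta> n) (Om n)"
    and "\<And>n. splitting (T n) (white (T n)) (D\<^sub>w n)"
    and "\<And>n. sqrt_on_diagonals (white (T n)) (D\<^sub>w n) (\<eta> n)"
    and "\<And>n. splitting (T n) (black (T n)) (D\<^sub>b n)"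
    and "\<And>n. sqrt_on_diagonals (black (T n)) (D\<^sub>b n) (\<eta> n)"
    and "\<forall>\<^sub>F n in sequentially. Lip \<kappa> (\<delta> n) U (Om n)"
    and "\<And>K. compact K \<Longrightarrow> K \<subseteq> U \<Longrightarrow> uniform_limit K Om \<theta> sequentially"
  shows "(\<forall>f. white_subsequential_limit T U \<eta> D\<^sub>w f \<longrightarrow> closed_form U f (\<lambda>z. cnj (\<theta> z))) \<and>
         (\<forall>f. black_subsequential_limit T U \<eta> D\<^sub>b f \<longrightarrow> closed_form U f \<theta>) \<and>
         ((\<forall>z\<in>U. \<theta> z = 0) \<longrightarrow>
            (\<forall>f. white_subsequential_limit T U \<eta> D\<^sub>w f \<or> black_subsequential_limit T U \<eta> D\<^sub>b f \<longrightarrow>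
               f holomorphic_on U))"
proof -
  have lim: "(\<lambda>n. Om n z) \<longlonglongrightarrow> \<theta> z" if "z \<in> U" for z
    using tendsto_uniform_limitI[OF assms(14)[of "{z}"]] that by simp
  have lip\<theta>: "1-lipschitz_on U \<theta>"
    by (rule limit_of_Lip_lipschitz[OF assms(4,1,13) lim])
  then have lip\<theta>': "1-lipschitz_on U (\<lambda>z. cnj (\<theta> z))"
    by (simp add: lipschitz_on_def dist_norm flip: complex_cnj_diff)
  have white: "\<exists>r. strict_mono r \<and> continuous_on U f \<and>
      (\<forall>K. compact K \<longrightarrow> K \<subseteq> U \<longrightarrow> approximating_forms K (\<lambda>n z. cnj (Om (r n) z)) f)"
    if f: "white_subsequential_limit T U \<eta> D\<^sub>w f" for f
  proof -
    obtain F Fc r where r: "strict_mono r"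
      and cv: "\<forall>n. complex_values (T n) U (\<eta> n) (black (T n)) (white (T n)) (D\<^sub>w n) (F n) (Fc n)"
      and conv: "converges_on_compacts U ((\<lambda>n. triangles (T n) U (black (T n)) (white (T n)) (D\<^sub>w n)) \<circ> r) (Fc \<circ> r) f"
      using f unfolding white_subsequential_limit_def Let_def by (elim exE conjE, intro that)
    have "\<forall>\<^sub>F n in sequentially. t_holomorphic_setup (T n) U (black (T n)) (white (T n)) (D\<^sub>w n) (\<eta> n)
        (\<lambda>z. cnj (Om n z)) (F n) (Fc n) \<kappa> (\<delta> n)"
      using assms(13) by eventually_elim (intro white_t_holomorphic_setup assms cv[rule_format])
    from eventually_subseq[OF r this] have "approximating_forms K (\<lambda>n z. cnj (Om (r n) z)) f"
      if "compact K" "K \<subseteq> U" for K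
      using conv that LIMSEQ_subseq_LIMSEQ[OF assms(4) r]
      by (intro approximating_forms_of_t_holomorphic[OF assms(2)]) (auto simp: o_def)
    moreover have "continuous_on U f" using conv by (simp add: converges_on_compacts_def)
    ultimately show ?thesis using r by blast
  qed
  have black: "\<exists>r. strict_mono r \<and> continuous_on U f \<and>
      (\<forall>K. compact K \<longrightarrow> K \<subseteq> U \<longrightarrow> approximating_forms K (\<lambda>n. Om (r n)) f)"
    if f: "black_subsequential_limit T U \<eta> D\<^sub>b f" for f
  proof -
    obtain F Fc r where r: "strict_mono r"
      and cv: "\<forall>n. complex_values (T n) U (\<eta> n) (white (T n)) (black (T n)) (D\<^sub>b n) (F n) (Fc n)"
      and conv: "converges_on_compacts U ((\<lambda>n. triangles (T n) U (white (T n)) (black (T n)) (D\<^sub>b n)) \<circ> r) (Fc \<circ> r) f"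
      using f unfolding black_subsequential_limit_def Let_def by (elim exE conjE, intro that)
    have "\<forall>\<^sub>F n in sequentially. t_holomorphic_setup (T n) U (white (T n)) (black (T n)) (D\<^sub>b n) (\<eta> n)
        (Om n) (F n) (Fc n) \<kappa> (\<delta> n)"
      using assms(13) by eventually_elim (intro black_t_holomorphic_setup assms cv[rule_format])
    from eventually_subseq[OF r this] have "approximating_forms K (\<lambda>n. Om (r n)) f"
      if "compact K" "K \<subseteq> U" for K
      using conv that LIMSEQ_subseq_LIMSEQ[OF assms(4) r]
      by (intro approximating_forms_of_t_holomorphic[OF assms(2)]) (auto simp: o_def)
    moreover have "continuous_on U f" using conv by (simp add: converges_on_compacts_def)
    ultimately show ?thesis using r by blast
  qed
  have limr: "(\<lambda>n. Om (r n) z) \<longlonglongrightarrow> \<theta> z" if "strict_mono r" "z \<in> U" for r z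
    using LIMSEQ_subseq_LIMSEQ[OF lim[OF that(2)] that(1)] by (simp add: o_def)
  show ?thesis
  proof (intro conjI allI impI)
    fix f assume "white_subsequential_limit T U \<eta> D\<^sub>w f"
    then obtain r where r: "strict_mono r" "continuous_on U f"
      "\<And>K. compact K \<Longrightarrow> K \<subseteq> U \<Longrightarrow> approximating_forms K (\<lambda>n z. cnj (Om (r n) z)) f" using white by blast
    show "closed_form U f (\<lambda>z. cnj (\<theta> z))"
      by (rule closed_form_limit[OF r(2,3) _ lip\<theta>']) (auto intro: tendsto_cnj limr[OF r(1)])
  next
    fix f assume "black_subsequential_limit T U \<eta> D\<^sub>b f"
    then obtain r where r: "strict_mono r" "continuous_on U f"
      "\<And>K. compact K \<Longrightarrow> K \<subseteq> U \<Longrightarrow> approximating_forms K (\<lambda>n. Om (r n)) f" using black by blast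
    show "closed_form U f \<theta>"
      by (rule closed_form_limit[OF r(2,3) _ lip\<theta>]) (auto intro: limr[OF r(1)])
  next
    fix f assume \<theta>0: "\<forall>z\<in>U. \<theta> z = 0"
      and "white_subsequential_limit T U \<eta> D\<^sub>w f \<or> black_subsequential_limit T U \<eta> D\<^sub>b f"
    then show "f holomorphic_on U"
    proof (elim disjE)
      assume "white_subsequential_limit T U \<eta> D\<^sub>w f"
      then obtain r where r: "strict_mono r" "continuous_on U f"
        "\<And>K. compact K \<Longrightarrow> K \<subseteq> U \<Longrightarrow> approximating_forms K (\<lambda>n z. cnj (Om (r n) z)) f" using white by blast
      show ?thesis
      proof (rule holomorphic_limit[OF assms(2) r(2,3)])
        show "(\<lambda>n. cnj (Om (r n) z)) \<longlonglongrightarrow> 0" if "z \<in> U" for z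
          using tendsto_cnj[OF limr[OF r(1) that]] \<theta>0 that by simp
      qed
    next
      assume "black_subsequential_limit T U \<eta> D\<^sub>b f"
      then obtain r where r: "strict_mono r" "continuous_on U f"
        "\<And>K. compact K \<Longrightarrow> K \<subseteq> U \<Longrightarrow> approximating_forms K (\<lambda>n. Om (r n)) f" using black by blast
      show ?thesis
      proof (rule holomorphic_limit[OF assms(2) r(2,3)])
        show "(\<lambda>n. Om (r n) z) \<longlonglongrightarrow> 0" if "z \<in> U" for z
          using limr[OF r(1) that] \<theta>0 that by simp
      qed
    qed
  qed
qed

end
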